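(* There are four functors $K,\ K\mathcal{A},\ K_\infty,\ \mathrm{Tor}K:\mathcal{T}PC\to \mathrm{mod}_{\Lambda_P}$ defined on objects by $$K(\mathcal C):=K(\mathcal C_0),\quad K\mathcal A(\mathcal C):=K(\mathcal A\mathcal C_0),\quad K_\infty(\mathcal C):=K(\mathcal C_\infty),\quad \mathrm{Tor}K(\mathcal C):=\big[G\langle \mathcal A\mathcal C\rangle\cap \mathcal R_{\mathcal C_0}\big]/\mathcal R_{\mathcal A\mathcal C_0},$$ and correspondingly on morphisms. There are natural transformations relating $K$, $K\mathcal A$, $K_\infty$ and $\mathrm{Tor}K$ induced by the maps $\psi:\mathrm{Tor}K(\mathcal C)\to K\mathcal A(\mathcal C)$, $j:K\mathcal A(\mathcal C)\to K(\mathcal C)$, $Q_r:K(\mathcal C)\to K\mathcal A(\mathcal C)$ ($r\ge 0$) and $\pi:K(\mathcal C)\to K_\infty(\mathcal C)$, and the four functors fit into exact sequences $$0\to \mathrm{Tor}K\xrightarrow{\ \psi\ }K\mathcal A\xrightarrow{\ j\ }K\xrightarrow{\ \pi\ }K_\infty\to 0 .$$ The four functors $\mathrm{Tor}K, K\mathcal A, K, K_\infty$ commute with the $\mathrm{op}$ functors in the domain and target. Moreover, when restricted to the subcategory of $\mathcal{T}PC$ consisting of monoidal TPCs and functors, they take values in the category of (not necessarily unital) algebras over $\Lambda_P$.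
   Context: $\Lambda_P$ is the ring of Novikov polynomials: finite sums $\sum n_kt^{a_k}$, $n_k\in\mathbb Z$, $a_k\in\mathbb R$; $\mathrm{mod}_{\Lambda_P}$ is its category of modules. Persistence modules: a persistence module over a field $\mathbf k$ is a family of vector spaces $\{M^s\}_{s\in\mathbb R}$ with maps $i_{s,t}:M^s\to M^t$ ($s\le t$), $i_{t,r}i_{s,t}=i_{s,r}$, $i_{s,s}=\mathrm{id}$; those occurring as morphism spaces are assumed lower semicontinuous ($i_{s,t}$ is an isomorphism for $t\ge s$ close to $s$) and lower bounded ($M^s=0$ for $s\ll0$). Triangulated persistence category (TPC): a persistence category $\mathcal C$ is a category whose morphisms are persistence modules $\hom_{\mathcal C}(A,B)=\{\hom^s_{\mathcal C}(A,B)\}_s$ with composition bilinear maps $\hom^r(A,B)\times\hom^s(B,C)\to\hom^{r+s}(A,C)$ compatible with the maps $i_{s,t}$, identities lying in $\hom^0$. $\mathcal C_0$ has the same objects and morphisms $\hom^0_{\mathcal C}$; $\mathcal C_\infty$ has the same objects and morphisms $\varinjlim_{\alpha}\hom^\alpha_{\mathcal C}$. $\mathcal C$ carries a shift functor $\Sigma$: functors $\Sigma^r$, $r\in\mathbb R$, compatible with the persistence structure, $\Sigma^r\Sigma^s=\Sigma^{r+s}$, $\Sigma^0=\mathrm{id}$, with natural isomorphisms $\eta_{r,s}:\Sigma^r\to\Sigma^s$, $(\eta_{r,s})_X\in\hom^{s-r}(\Sigma^rX,\Sigma^sX)$, satisfying the natural compatibility relations, $\eta_{r,r}=\mathrm{id}$.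 For $r\ge0$ put $\eta_r^X=i_{-r,0}((\eta_{r,0})_X)\in\hom^0(\Sigma^rX,X)$. An object $K$ is $r$-acyclic if $i_{0,r}(\mathrm{id}_K)=0$. $\mathcal C$ is a TPC if moreover $\mathcal C_0$ is triangulated (translation functor $T$), $\Sigma^r$ is triangulated on $\mathcal C_0$, the $\eta_{r,s}$ are compatible with the additive structure, and for every object $X$ and $r\ge 0$ there is an exact triangle $\Sigma^rX\xrightarrow{\eta_r^X}X\to Q_{r,X}\to T\Sigma^rX$ in $\mathcal C_0$ with $Q_{r,X}$ $r$-acyclic. $\mathcal C_\infty$ is then also triangulated (it is the Verdier quotient $\mathcal C_0/\mathcal A\mathcal C_0$). $\mathcal A\mathcal C$ is the full subcategory of $\mathcal C$ of objects that are $r$-acyclic for some $r\ge0$; it is a TPC and $(\mathcal A\mathcal C)_0=\mathcal A\mathcal C_0$. TPC functor: a functor $\mathcal F:\mathcal C\to\mathcal D$ compatible with the persistence structures, with $\Sigma^r\mathcal F=\mathcal F\Sigma^r$, $\mathcal F((\eta_{r,s})_X)=(\eta_{r,s})_{\mathcal F(X)}$, and whose restriction $\mathcal C_0\to\mathcal D_0$ is triangulated. $\mathcal TPC$ is the category of TPCs and TPC functors. $K$-groups: for a triangulated category $\mathcal D$, $K(\mathcal D)$ is the free abelian group on objects modulo $B=A+C$ for each exact triangle $A\to B\to C\to TA$. For a TPC all these groups are $\Lambda_P$-modules by $t^r\cdot[A]=[\Sigma^rA]$. $G\langle-\rangle$ denotes the free abelian group generated by the objects, and $\mathcal R_{\mathcal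 C_0}\subset G\langle\mathcal C\rangle$, $\mathcal R_{\mathcal A\mathcal C_0}\subset G\langle\mathcal A\mathcal C\rangle$ the subgroups generated by the relations coming from exact triangles of $\mathcal C_0$, respectively $\mathcal A\mathcal C_0$. The map $j$ is induced by the inclusion of objects $\mathcal A\mathcal C\subset\mathcal C$, $\pi$ by the identity on objects, $\psi$ by the inclusion $G\langle \mathcal A\mathcal C\rangle\cap \mathcal R_{\mathcal C_0}\subset G\langle\mathcal A\mathcal C\rangle$, and $Q_r([X])=[Q_{r,X}]$. Opposites: $\mathcal C^{\rm op}$ is the opposite category with translation $T^{-1}$, shift functor $(\Sigma^{\rm op})^r=\Sigma^{-r}$, natural transformations $\eta^{\rm op}_{r,s}=\mathrm{op}(\eta_{-s,-r})$, and exact triangles $Z\xrightarrow{\mathrm{op}(g)}Y\xrightarrow{\mathrm{op}(f)}X\xrightarrow{\mathrm{op}(-T^{-1}h)}T^{\rm op}Z$ for each exact triangle $X\xrightarrow{f}Y\xrightarrow{g}Z\xrightarrow{h}TX$; it is a TPC. On modules, $\mathrm{op}:\mathrm{mod}_{\Lambda_P}\to\mathrm{mod}_{\Lambda_P}^{\rm op}$ sends $M$ to $\overline M$, the same abelian group with $\Lambda_P$-structure in which $t^r$ acts as $t^{-r}$ acts on $M$. Monoidal TPC: a TPC with an associative symmetric operation $\otimes$ on objects with unit object, such that for each object $A$, $(-)\otimes A$ is a persistence functor, is additive and triangulated on $\mathcal C_0$, satisfies $TX\otimes A\cong T(X\otimes A)$ in $\mathcal C_0$, and there are isomorphisms $\theta_r:\Sigma^rX\otimes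 A\to\Sigma^r(X\otimes A)$ in $\mathcal C_0$ with $\theta_0=\mathrm{id}$ and $\theta_s\circ((\eta_{r,s})_X\otimes\mathrm{id}_A)=(\eta_{r,s})_{X\otimes A}\circ\theta_r$. The product on $K$-groups is $[X]\cdot[Y]=[X\otimes Y]$. *)

theory Defs
  imports Complex_Main "HOL-Algebra.Module" "HOL-Algebra.Free_Abelian_Groups"
begin

section \<open>Modules\<close>

definition linear_maps ::
  "('a, 'r) ring_scheme \<Rightarrow> ('a, 'b, 'x) module_scheme \<Rightarrow> ('a, 'c, 'y) module_scheme \<Rightarrow> ('b \<Rightarrow> 'c) set"
  where "linear_maps R M N =
    {f \<in> carrier M \<rightarrow> carrier N.
       (\<forall>x\<in>carrier M. \<forall>y\<in>carrier M. f (x \<oplus>\<^bsub>M\<^esub> y) = f x \<oplus>\<^bsub>N\<^esub> f y) \<and>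
       (\<forall>a\<in>carrier R. \<forall>x\<in>carrier M. f (a \<odot>\<^bsub>M\<^esub> x) = a \<odot>\<^bsub>N\<^esub> f x)}"

text \<open>A Novikov polynomial \<open>\<Sum> n\<^sub>k t^a\<^sub>k\<close> is the finitely supported function sending \<open>a\<^sub>k\<close> to \<open>n\<^sub>k\<close>;
  the product on \<open>real \<Rightarrow>\<^sub>0 int\<close> is convolution.\<close>

type_synonym novikov = "real \<Rightarrow>\<^sub>0 int"

definition Novikov :: "novikov ring"
  where "Novikov = \<lparr>carrier = UNIV, monoid.mult = (*), one = 1, ring.zero = 0, ring.add = (+)\<rparr>"

text \<open>\<open>novikov_bar\<close> is the ring automorphism \<open>t^r \<mapsto> t^-r\<close>.\<close>

definition novikov_bar :: "novikov \<Rightarrow> novikov"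
  where "novikov_bar p = Poly_Mapping.map_key uminus p"

definition op_module :: "(novikov, 'a) module \<Rightarrow> (novikov, 'a) module"
  where "op_module M = M\<lparr>smult := (\<lambda>p x. novikov_bar p \<odot>\<^bsub>M\<^esub> x)\<rparr>"

text \<open>Associative algebras that need not have a unit: the field \<open>one\<close> of the record is ignored.\<close>

locale nonunital_algebra = module R M for R (structure) and M (structure) +
  assumes mult_closed: "x \<in> carrier M \<Longrightarrow> y \<in> carrier M \<Longrightarrow> x \<otimes>\<^bsub>M\<^esub> y \<in> carrier M"
    and mult_assoc: "x \<in> carrier M \<Longrightarrow> y \<in> carrier M \<Longrightarrow> z \<in> carrier M \<Longrightarrow>
      (x \<otimes>\<^bsub>M\<^esub> y) \<otimes>\<^bsub>M\<^esub> z = x \<otimes>\<^bsub>M\<^esub> (y \<otimes>\<^bsub>M\<^esub> z)"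
    and mult_add_left: "x \<in> carrier M \<Longrightarrow> y \<in> carrier M \<Longrightarrow> z \<in> carrier M \<Longrightarrow>
      (x \<oplus>\<^bsub>M\<^esub> y) \<otimes>\<^bsub>M\<^esub> z = (x \<otimes>\<^bsub>M\<^esub> z) \<oplus>\<^bsub>M\<^esub> (y \<otimes>\<^bsub>M\<^esub> z)"
    and mult_add_right: "x \<in> carrier M \<Longrightarrow> y \<in> carrier M \<Longrightarrow> z \<in> carrier M \<Longrightarrow>
      x \<otimes>\<^bsub>M\<^esub> (y \<oplus>\<^bsub>M\<^esub> z) = (x \<otimes>\<^bsub>M\<^esub> y) \<oplus>\<^bsub>M\<^esub> (x \<otimes>\<^bsub>M\<^esub> z)"
    and mult_smult_left: "a \<in> carrier R \<Longrightarrow> x \<in> carrier M \<Longrightarrow> y \<in> carrier M \<Longrightarrow>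
      (a \<odot>\<^bsub>M\<^esub> x) \<otimes>\<^bsub>M\<^esub> y = a \<odot>\<^bsub>M\<^esub> (x \<otimes>\<^bsub>M\<^esub> y)"
    and mult_smult_right: "a \<in> carrier R \<Longrightarrow> x \<in> carrier M \<Longrightarrow> y \<in> carrier M \<Longrightarrow>
      x \<otimes>\<^bsub>M\<^esub> (a \<odot>\<^bsub>M\<^esub> y) = a \<odot>\<^bsub>M\<^esub> (x \<otimes>\<^bsub>M\<^esub> y)"

definition algebra_maps ::
  "('a, 'r) ring_scheme \<Rightarrow> ('a, 'b, 'x) module_scheme \<Rightarrow> ('a, 'c, 'y) module_scheme \<Rightarrow> ('b \<Rightarrow> 'c) set"
  where "algebra_maps R M N =
    {f \<in> linear_maps R M N.
       \<forall>x\<in>carrier M. \<forall>y\<in>carrier M. f (x \<otimes>\<^bsub>M\<^esub> y) = f x \<otimes>\<^bsub>N\<^esub> f y}"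


section \<open>Triangulated categories\<close>

text \<open>\<open>tcmp D X Y Z f g\<close> is the composite of \<open>f : X \<rightarrow> Y\<close> followed by \<open>g : Y \<rightarrow> Z\<close>.
  An element \<open>(X, Y, Z, f, g, h)\<close> of \<open>ttri D\<close> is an exact triangle \<open>X \<rightarrow> Y \<rightarrow> Z \<rightarrow> TX\<close>.
  Of the ring structure of a morphism set only the additive part is used.\<close>

record ('o, 'm, 'x) tricat =
  tob :: "'o set"
  thom :: "'o \<Rightarrow> 'o \<Rightarrow> ('m, 'x) ring_scheme"
  tcmp :: "'o \<Rightarrow> 'o \<Rightarrow> 'o \<Rightarrow> 'm \<Rightarrow> 'm \<Rightarrow> 'm"
  tidn :: "'o \<Rightarrow> 'm"
  Tob :: "'o \<Rightarrow> 'o"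
  Tmor :: "'o \<Rightarrow> 'o \<Rightarrow> 'm \<Rightarrow> 'm"
  ttri :: "('o \<times> 'o \<times> 'o \<times> 'm \<times> 'm \<times> 'm) set"

definition tmor :: "('o, 'm, 'x) tricat \<Rightarrow> 'o \<Rightarrow> 'o \<Rightarrow> 'm set"
  where "tmor D X Y = carrier (thom D X Y)"

definition is_iso_in :: "('o, 'm, 'x) tricat \<Rightarrow> 'o \<Rightarrow> 'o \<Rightarrow> 'm \<Rightarrow> bool"
  where "is_iso_in D X Y f \<longleftrightarrow> X \<in> tob D \<and> Y \<in> tob D \<and> f \<in> tmor D X Y \<and>
    (\<exists>g\<in>tmor D Y X. tcmp D X Y X f g = tidn D X \<and> tcmp D Y X Y g f = tidn D Y)"

definition isomorphic_in :: "('o, 'm, 'x) tricat \<Rightarrow> 'o \<Rightarrow> 'o \<Rightarrow> bool"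
  where "isomorphic_in D X Y \<longleftrightarrow> (\<exists>f. is_iso_in D X Y f)"

definition is_zero_object :: "('o, 'm, 'x) tricat \<Rightarrow> 'o \<Rightarrow> bool"
  where "is_zero_object D Z \<longleftrightarrow> Z \<in> tob D \<and> tidn D Z = \<zero>\<^bsub>thom D Z Z\<^esub>"

locale additive_category =
  fixes D :: "('o, 'm, 'x) tricat"
  assumes hom_group: "X \<in> tob D \<Longrightarrow> Y \<in> tob D \<Longrightarrow> abelian_group (thom D X Y)"
    and cmp_closed: "X \<in> tob D \<Longrightarrow> Y \<in> tob D \<Longrightarrow> Z \<in> tob D \<Longrightarrow>
      f \<in> tmor D X Y \<Longrightarrow> g \<in> tmor D Y Z \<Longrightarrow> tcmp D X Y Z f g \<in> tmor D X Z"
    and cmp_assoc: "W \<in> tob D \<Longrightarrow> X \<in> tob D \<Longrightarrow> Y \<in> tob D \<Longrightarrow> Z \<in> tob D \<Longrightarrow>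
      f \<in> tmor D W X \<Longrightarrow> g \<in> tmor D X Y \<Longrightarrow> h \<in> tmor D Y Z \<Longrightarrow>
      tcmp D W Y Z (tcmp D W X Y f g) h = tcmp D W X Z f (tcmp D X Y Z g h)"
    and idn_closed: "X \<in> tob D \<Longrightarrow> tidn D X \<in> tmor D X X"
    and idn_left: "X \<in> tob D \<Longrightarrow> Y \<in> tob D \<Longrightarrow> f \<in> tmor D X Y \<Longrightarrow>
      tcmp D X X Y (tidn D X) f = f"
    and idn_right: "X \<in> tob D \<Longrightarrow> Y \<in> tob D \<Longrightarrow> f \<in> tmor D X Y \<Longrightarrow>
      tcmp D X Y Y f (tidn D Y) = f"
    and cmp_add_left: "X \<in> tob D \<Longrightarrow> Y \<in> tob D \<Longrightarrow> Z \<in> tob D \<Longrightarrow>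
      f \<in> tmor D X Y \<Longrightarrow> f' \<in> tmor D X Y \<Longrightarrow> g \<in> tmor D Y Z \<Longrightarrow>
      tcmp D X Y Z (f \<oplus>\<^bsub>thom D X Y\<^esub> f') g = tcmp D X Y Z f g \<oplus>\<^bsub>thom D X Z\<^esub> tcmp D X Y Z f' g"
    and cmp_add_right: "X \<in> tob D \<Longrightarrow> Y \<in> tob D \<Longrightarrow> Z \<in> tob D \<Longrightarrow>
      f \<in> tmor D X Y \<Longrightarrow> g \<in> tmor D Y Z \<Longrightarrow> g' \<in> tmor D Y Z \<Longrightarrow>
      tcmp D X Y Z f (g \<oplus>\<^bsub>thom D Y Z\<^esub> g') = tcmp D X Y Z f g \<oplus>\<^bsub>thom D X Z\<^esub> tcmp D X Y Z f g'"
    and zero_object: "\<exists>Z. is_zero_object D Z"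
    and biproducts: "X \<in> tob D \<Longrightarrow> Y \<in> tob D \<Longrightarrow>
      \<exists>P\<in>tob D. \<exists>i\<in>tmor D X P. \<exists>j\<in>tmor D Y P. \<exists>p\<in>tmor D P X. \<exists>q\<in>tmor D P Y.
        tcmp D X P X i p = tidn D X \<and> tcmp D Y P Y j q = tidn D Y \<and>
        tcmp D X P Y i q = \<zero>\<^bsub>thom D X Y\<^esub> \<and> tcmp D Y P X j p = \<zero>\<^bsub>thom D Y X\<^esub> \<and>
        tcmp D P X P p i \<oplus>\<^bsub>thom D P P\<^esub> tcmp D P Y P q j = tidn D P"

locale triangulated_category = additive_category D for D :: "('o, 'm, 'x) tricat" +
  assumes T_ob: "bij_betw (Tob D) (tob D) (tob D)"
    and T_mor: "X \<in> tob D \<Longrightarrow> Y \<in> tob D \<Longrightarrow>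
      bij_betw (Tmor D X Y) (tmor D X Y) (tmor D (Tob D X) (Tob D Y))"
    and T_add: "X \<in> tob D \<Longrightarrow> Y \<in> tob D \<Longrightarrow> f \<in> tmor D X Y \<Longrightarrow> f' \<in> tmor D X Y \<Longrightarrow>
      Tmor D X Y (f \<oplus>\<^bsub>thom D X Y\<^esub> f') =
      Tmor D X Y f \<oplus>\<^bsub>thom D (Tob D X) (Tob D Y)\<^esub> Tmor D X Y f'"
    and T_idn: "X \<in> tob D \<Longrightarrow> Tmor D X X (tidn D X) = tidn D (Tob D X)"
    and T_cmp: "X \<in> tob D \<Longrightarrow> Y \<in> tob D \<Longrightarrow> Z \<in> tob D \<Longrightarrow>
      f \<in> tmor D X Y \<Longrightarrow> g \<in> tmor D Y Z \<Longrightarrow>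
      Tmor D X Z (tcmp D X Y Z f g) =
      tcmp D (Tob D X) (Tob D Y) (Tob D Z) (Tmor D X Y f) (Tmor D Y Z g)"
    and tri_typed: "(X, Y, Z, f, g, h) \<in> ttri D \<Longrightarrow>
      X \<in> tob D \<and> Y \<in> tob D \<and> Z \<in> tob D \<and>
      f \<in> tmor D X Y \<and> g \<in> tmor D Y Z \<and> h \<in> tmor D Z (Tob D X)"
    and tri_iso: "(X, Y, Z, f, g, h) \<in> ttri D \<Longrightarrow>
      is_iso_in D X X' a \<Longrightarrow> is_iso_in D Y Y' b \<Longrightarrow> is_iso_in D Z Z' c \<Longrightarrow>
      f' \<in> tmor D X' Y' \<Longrightarrow> g' \<in> tmor D Y' Z' \<Longrightarrow> h' \<in> tmor D Z' (Tob D X') \<Longrightarrow>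
      tcmp D X Y Y' f b = tcmp D X X' Y' a f' \<Longrightarrow>
      tcmp D Y Z Z' g c = tcmp D Y Y' Z' b g' \<Longrightarrow>
      tcmp D Z (Tob D X) (Tob D X') h (Tmor D X X' a) = tcmp D Z Z' (Tob D X') c h' \<Longrightarrow>
      (X', Y', Z', f', g', h') \<in> ttri D"
    and tri_idn: "X \<in> tob D \<Longrightarrow> is_zero_object D Z \<Longrightarrow>
      (X, X, Z, tidn D X, \<zero>\<^bsub>thom D X Z\<^esub>, \<zero>\<^bsub>thom D Z (Tob D X)\<^esub>) \<in> ttri D"
    and tri_cone: "X \<in> tob D \<Longrightarrow> Y \<in> tob D \<Longrightarrow> f \<in> tmor D X Y \<Longrightarrow>
      \<exists>Z g h. (X, Y, Z, f, g, h) \<in> ttri D"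
    and tri_rotate: "X \<in> tob D \<Longrightarrow> Y \<in> tob D \<Longrightarrow> Z \<in> tob D \<Longrightarrow>
      f \<in> tmor D X Y \<Longrightarrow> g \<in> tmor D Y Z \<Longrightarrow> h \<in> tmor D Z (Tob D X) \<Longrightarrow>
      (X, Y, Z, f, g, h) \<in> ttri D \<longleftrightarrow>
      (Y, Z, Tob D X, g, h, \<ominus>\<^bsub>thom D (Tob D X) (Tob D Y)\<^esub> Tmor D X Y f) \<in> ttri D"
    and tri_fill: "(X, Y, Z, f, g, h) \<in> ttri D \<Longrightarrow> (X', Y', Z', f', g', h') \<in> ttri D \<Longrightarrow>
      a \<in> tmor D X X' \<Longrightarrow> b \<in> tmor D Y Y' \<Longrightarrow>
      tcmp D X Y Y' f b = tcmp D X X' Y' a f' \<Longrightarrow>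
      \<exists>c\<in>tmor D Z Z'.
        tcmp D Y Z Z' g c = tcmp D Y Y' Z' b g' \<and>
        tcmp D Z (Tob D X) (Tob D X') h (Tmor D X X' a) = tcmp D Z Z' (Tob D X') c h'"
    and octahedral: "(X, Y, A, f, u, v) \<in> ttri D \<Longrightarrow> (Y, Z, B, g, s, t) \<in> ttri D \<Longrightarrow>
      (X, Z, E, tcmp D X Y Z f g, p, q) \<in> ttri D \<Longrightarrow>
      \<exists>a b. (A, E, B, a, b, tcmp D B (Tob D Y) (Tob D A) t (Tmor D Y A u)) \<in> ttri D \<and>
        tcmp D Y A E u a = tcmp D Y Z E g p \<and>
        tcmp D A E (Tob D X) a q = v \<and>
        tcmp D Z E B p b = s \<and>
        tcmp D E B (Tob D Y) b t = tcmp D E (Tob D X) (Tob D Y) q (Tmor D X Y f)"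

text \<open>A triangulated functor commutes with the translations up to a natural isomorphism \<open>\<phi>\<close>.\<close>

definition triangulated_functor ::
  "('o, 'm, 'x) tricat \<Rightarrow> ('p, 'n, 'y) tricat \<Rightarrow> ('o \<Rightarrow> 'p) \<Rightarrow> ('o \<Rightarrow> 'o \<Rightarrow> 'm \<Rightarrow> 'n) \<Rightarrow> bool"
  where "triangulated_functor D E Fo Fm \<longleftrightarrow>
    (\<forall>X\<in>tob D. Fo X \<in> tob E \<and> Fm X X (tidn D X) = tidn E (Fo X)) \<and>
    (\<forall>X\<in>tob D. \<forall>Y\<in>tob D. \<forall>f\<in>tmor D X Y. Fm X Y f \<in> tmor E (Fo X) (Fo Y) \<and>
       (\<forall>f'\<in>tmor D X Y.
          Fm X Y (f \<oplus>\<^bsub>thom D X Y\<^esub> f') = Fm X Y f \<oplus>\<^bsub>thom E (Fo X) (Fo Y)\<^esub> Fm X Y f') \<and>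
       (\<forall>Z\<in>tob D. \<forall>g\<in>tmor D Y Z.
          Fm X Z (tcmp D X Y Z f g) = tcmp E (Fo X) (Fo Y) (Fo Z) (Fm X Y f) (Fm Y Z g))) \<and>
    (\<exists>\<phi>.
       (\<forall>X\<in>tob D. is_iso_in E (Fo (Tob D X)) (Tob E (Fo X)) (\<phi> X)) \<and>
       (\<forall>X\<in>tob D. \<forall>Y\<in>tob D. \<forall>f\<in>tmor D X Y.
          tcmp E (Fo (Tob D X)) (Fo (Tob D Y)) (Tob E (Fo Y))
            (Fm (Tob D X) (Tob D Y) (Tmor D X Y f)) (\<phi> Y) =
          tcmp E (Fo (Tob D X)) (Tob E (Fo X)) (Tob E (Fo Y))
            (\<phi> X) (Tmor E (Fo X) (Fo Y) (Fm X Y f))) \<and>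
       (\<forall>X Y Z f g h. (X, Y, Z, f, g, h) \<in> ttri D \<longrightarrow>
          (Fo X, Fo Y, Fo Z, Fm X Y f, Fm Y Z g,
           tcmp E (Fo Z) (Fo (Tob D X)) (Tob E (Fo X)) (Fm Z (Tob D X) h) (\<phi> X)) \<in> ttri E))"

definition full_tri_sub :: "('o, 'm, 'x) tricat \<Rightarrow> 'o set \<Rightarrow> ('o, 'm, 'x) tricat"
  where "full_tri_sub D S =
    D\<lparr>tob := S,
      ttri := {(X, Y, Z, f, g, h). (X, Y, Z, f, g, h) \<in> ttri D \<and> X \<in> S \<and> Y \<in> S \<and> Z \<in> S}\<rparr>"


section \<open>Persistence categories\<close>

locale persistence_module =
  fixes k :: "('k, 'x) ring_scheme" and M :: "real \<Rightarrow> ('k, 'm) module"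
    and i :: "real \<Rightarrow> real \<Rightarrow> 'm \<Rightarrow> 'm"
  assumes base_field: "field k"
    and module: "module k (M s)"
    and linear: "s \<le> t \<Longrightarrow> i s t \<in> linear_maps k (M s) (M t)"
    and refl: "x \<in> carrier (M s) \<Longrightarrow> i s s x = x"
    and trans: "s \<le> t \<Longrightarrow> t \<le> r \<Longrightarrow> x \<in> carrier (M s) \<Longrightarrow> i t r (i s t x) = i s r x"

definition lower_semicontinuous :: "(real \<Rightarrow> ('k, 'm) module) \<Rightarrow> (real \<Rightarrow> real \<Rightarrow> 'm \<Rightarrow> 'm) \<Rightarrow> bool"
  where "lower_semicontinuous M i \<longleftrightarrow>
    (\<forall>s. \<exists>\<epsilon>>0. \<forall>t. s \<le> t \<and> t < s + \<epsilon> \<longrightarrow> bij_betw (i s t) (carrier (M s)) (carrier (M t)))"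

definition lower_bounded :: "(real \<Rightarrow> ('k, 'm) module) \<Rightarrow> bool"
  where "lower_bounded M \<longleftrightarrow> (\<exists>b. \<forall>s\<le>b. carrier (M s) = {\<zero>\<^bsub>M s\<^esub>})"

record ('o, 'm, 'p, 'n) pfun =
  fob :: "'o \<Rightarrow> 'p"
  fmor :: "real \<Rightarrow> 'o \<Rightarrow> 'o \<Rightarrow> 'm \<Rightarrow> 'n"

definition id_pfun :: "('o, 'm, 'o, 'm) pfun"
  where "id_pfun = \<lparr>fob = (\<lambda>A. A), fmor = (\<lambda>s A B f. f)\<rparr>"

definition comp_pfun :: "('p, 'n, 'q, 'l) pfun \<Rightarrow> ('o, 'm, 'p, 'n) pfun \<Rightarrow> ('o, 'm, 'q, 'l) pfun"
  where "comp_pfun G F =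
    \<lparr>fob = (\<lambda>A. fob G (fob F A)),
     fmor = (\<lambda>s A B f. fmor G s (fob F A) (fob F B) (fmor F s A B f))\<rparr>"

text \<open>Data of a persistence category with a shift functor and with a translation and exact
  triangles on its degree 0 part:
  \<open>Hom C s A B\<close> is \<open>hom\<^sup>s(A, B)\<close> and \<open>inc C s t A B\<close> is \<open>i\<^sub>s\<^sub>,\<^sub>t\<close>;
  \<open>cmp C r s A B E f g\<close> is \<open>f \<in> hom\<^sup>r(A, B)\<close> followed by \<open>g \<in> hom\<^sup>s(B, E)\<close>;
  \<open>shift C r\<close> is \<open>\<Sigma>\<^sup>r\<close> and \<open>eta C r s X\<close> is \<open>(\<eta>\<^sub>r\<^sub>,\<^sub>s)\<^sub>X\<close>;
  \<open>Tr\<close>, \<open>Trm\<close> is the translation.\<close>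

record ('k, 'o, 'm) tpc =
  Ob :: "'o set"
  Hom :: "real \<Rightarrow> 'o \<Rightarrow> 'o \<Rightarrow> ('k, 'm) module"
  inc :: "real \<Rightarrow> real \<Rightarrow> 'o \<Rightarrow> 'o \<Rightarrow> 'm \<Rightarrow> 'm"
  cmp :: "real \<Rightarrow> real \<Rightarrow> 'o \<Rightarrow> 'o \<Rightarrow> 'o \<Rightarrow> 'm \<Rightarrow> 'm \<Rightarrow> 'm"
  idn :: "'o \<Rightarrow> 'm"
  shift :: "real \<Rightarrow> ('o, 'm, 'o, 'm) pfun"
  eta :: "real \<Rightarrow> real \<Rightarrow> 'o \<Rightarrow> 'm"
  Tr :: "'o \<Rightarrow> 'o"
  Trm :: "'o \<Rightarrow> 'o \<Rightarrow> 'm \<Rightarrow> 'm"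
  Tri :: "('o \<times> 'o \<times> 'o \<times> 'm \<times> 'm \<times> 'm) set"

definition mor :: "('k, 'o, 'm) tpc \<Rightarrow> real \<Rightarrow> 'o \<Rightarrow> 'o \<Rightarrow> 'm set"
  where "mor C s A B = carrier (Hom C s A B)"

locale persistence_category =
  fixes k :: "('k, 'x) ring_scheme" and C :: "('k, 'o, 'm) tpc"
  assumes hom_persistence: "A \<in> Ob C \<Longrightarrow> B \<in> Ob C \<Longrightarrow>
      persistence_module k (\<lambda>s. Hom C s A B) (\<lambda>s t. inc C s t A B)"
    and hom_semicontinuous: "A \<in> Ob C \<Longrightarrow> B \<in> Ob C \<Longrightarrow>
      lower_semicontinuous (\<lambda>s. Hom C s A B) (\<lambda>s t. inc C s t A B)"
    and hom_bounded: "A \<in> Ob C \<Longrightarrow> B \<in> Ob C \<Longrightarrow> lower_bounded (\<lambda>s. Hom C s A B)"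
    and cmp_linear_left: "A \<in> Ob C \<Longrightarrow> B \<in> Ob C \<Longrightarrow> E \<in> Ob C \<Longrightarrow> g \<in> mor C s B E \<Longrightarrow>
      (\<lambda>f. cmp C r s A B E f g) \<in> linear_maps k (Hom C r A B) (Hom C (r + s) A E)"
    and cmp_linear_right: "A \<in> Ob C \<Longrightarrow> B \<in> Ob C \<Longrightarrow> E \<in> Ob C \<Longrightarrow> f \<in> mor C r A B \<Longrightarrow>
      (\<lambda>g. cmp C r s A B E f g) \<in> linear_maps k (Hom C s B E) (Hom C (r + s) A E)"
    and cmp_inc: "A \<in> Ob C \<Longrightarrow> B \<in> Ob C \<Longrightarrow> E \<in> Ob C \<Longrightarrow>
      f \<in> mor C r A B \<Longrightarrow> g \<in> mor C s B E \<Longrightarrow> r \<le> r' \<Longrightarrow> s \<le> s' \<Longrightarrow>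
      cmp C r' s' A B E (inc C r r' A B f) (inc C s s' B E g) =
      inc C (r + s) (r' + s') A E (cmp C r s A B E f g)"
    and cmp_assoc: "A \<in> Ob C \<Longrightarrow> B \<in> Ob C \<Longrightarrow> E \<in> Ob C \<Longrightarrow> F \<in> Ob C \<Longrightarrow>
      f \<in> mor C r A B \<Longrightarrow> g \<in> mor C s B E \<Longrightarrow> h \<in> mor C t E F \<Longrightarrow>
      cmp C (r + s) t A E F (cmp C r s A B E f g) h =
      cmp C r (s + t) A B F f (cmp C s t B E F g h)"
    and idn_closed: "A \<in> Ob C \<Longrightarrow> idn C A \<in> mor C 0 A A"
    and idn_left: "A \<in> Ob C \<Longrightarrow> B \<in> Ob C \<Longrightarrow> f \<in> mor C s A B \<Longrightarrow> cmp C 0 s A A B (idn C A) f = f"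
    and idn_right: "A \<in> Ob C \<Longrightarrow> B \<in> Ob C \<Longrightarrow> f \<in> mor C s A B \<Longrightarrow> cmp C s 0 A B B f (idn C B) = f"

definition persistence_functor ::
  "('k, 'x) ring_scheme \<Rightarrow> ('k, 'o, 'm) tpc \<Rightarrow> ('k, 'p, 'n) tpc \<Rightarrow> ('o, 'm, 'p, 'n) pfun \<Rightarrow> bool"
  where "persistence_functor k C D F \<longleftrightarrow>
    (\<forall>A\<in>Ob C. fob F A \<in> Ob D \<and> fmor F 0 A A (idn C A) = idn D (fob F A)) \<and>
    (\<forall>A\<in>Ob C. \<forall>B\<in>Ob C. \<forall>s.
       fmor F s A B \<in> linear_maps k (Hom C s A B) (Hom D s (fob F A) (fob F B)) \<and>
       (\<forall>f\<in>mor C s A B.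
          (\<forall>t\<ge>s. fmor F t A B (inc C s t A B f) = inc D s t (fob F A) (fob F B) (fmor F s A B f)) \<and>
          (\<forall>E\<in>Ob C. \<forall>r. \<forall>g\<in>mor C r B E.
             fmor F (s + r) A E (cmp C s r A B E f g) =
             cmp D s r (fob F A) (fob F B) (fob F E) (fmor F s A B f) (fmor F r B E g))))"

abbreviation sh :: "('k, 'o, 'm) tpc \<Rightarrow> real \<Rightarrow> 'o \<Rightarrow> 'o"
  where "sh C r \<equiv> fob (shift C r)"

text \<open>The shift functor is strict monoidal from \<open>(\<real>, +)\<close>, regarded as a category with exactly one
  morphism between any two objects, to persistence endofunctors. The last three axioms are the
  vertical composition and the two whiskerings; with \<open>eta_refl\<close> they make every
  \<open>\<eta>\<^sub>r\<^sub>,\<^sub>s\<close> an isomorphism with inverse \<open>\<eta>\<^sub>s\<^sub>,\<^sub>r\<close>. Compatibility of \<open>\<eta>\<close> with direct sums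
  is an instance of naturality.\<close>

locale shifted_persistence_category = persistence_category k C
  for k :: "('k, 'x) ring_scheme" and C :: "('k, 'o, 'm) tpc" +
  assumes shift_functor: "persistence_functor k C C (shift C r)"
    and shift_0_ob: "A \<in> Ob C \<Longrightarrow> sh C 0 A = A"
    and shift_0_mor: "A \<in> Ob C \<Longrightarrow> B \<in> Ob C \<Longrightarrow> f \<in> mor C s A B \<Longrightarrow> fmor (shift C 0) s A B f = f"
    and shift_add_ob: "A \<in> Ob C \<Longrightarrow> sh C r (sh C t A) = sh C (r + t) A"
    and shift_add_mor: "A \<in> Ob C \<Longrightarrow> B \<in> Ob C \<Longrightarrow> f \<in> mor C s A B \<Longrightarrow>
      fmor (shift C r) s (sh C t A) (sh C t B) (fmor (shift C t) s A B f) =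
      fmor (shift C (r + t)) s A B f"
    and eta_closed: "X \<in> Ob C \<Longrightarrow> eta C r s X \<in> mor C (s - r) (sh C r X) (sh C s X)"
    and eta_natural: "X \<in> Ob C \<Longrightarrow> Y \<in> Ob C \<Longrightarrow> f \<in> mor C a X Y \<Longrightarrow>
      cmp C a (s - r) (sh C r X) (sh C r Y) (sh C s Y) (fmor (shift C r) a X Y f) (eta C r s Y) =
      cmp C (s - r) a (sh C r X) (sh C s X) (sh C s Y) (eta C r s X) (fmor (shift C s) a X Y f)"
    and eta_refl: "X \<in> Ob C \<Longrightarrow> eta C r r X = idn C (sh C r X)"
    and eta_trans: "X \<in> Ob C \<Longrightarrow>
      cmp C (s - r) (t - s) (sh C r X) (sh C s X) (sh C t X) (eta C r s X) (eta C s t X) = eta C r t X"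
    and eta_shift: "X \<in> Ob C \<Longrightarrow> eta C r s (sh C t X) = eta C (r + t) (s + t) X"
    and shift_eta: "X \<in> Ob C \<Longrightarrow>
      fmor (shift C t) (s - r) (sh C r X) (sh C s X) (eta C r s X) = eta C (t + r) (t + s) X"

definition eta_map :: "('k, 'o, 'm) tpc \<Rightarrow> real \<Rightarrow> 'o \<Rightarrow> 'm"
  where "eta_map C r X = inc C (- r) 0 (sh C r X) X (eta C r 0 X)"

definition acyclic_of :: "('k, 'o, 'm) tpc \<Rightarrow> real \<Rightarrow> 'o \<Rightarrow> bool"
  where "acyclic_of C r K \<longleftrightarrow> K \<in> Ob C \<and> inc C 0 r K K (idn C K) = \<zero>\<^bsub>Hom C r K K\<^esub>"

definition C_zero :: "('k, 'o, 'm) tpc \<Rightarrow> ('o, 'm, _) tricat"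
  where "C_zero C =
    \<lparr>tob = Ob C, thom = Hom C 0, tcmp = cmp C 0 0, tidn = idn C, Tob = Tr C, Tmor = Trm C, ttri = Tri C\<rparr>"

text \<open>\<open>is_cone_eta C r X Q\<close>: \<open>Q\<close> is an \<open>r\<close>-acyclic object \<open>Q\<^sub>r\<^sub>,\<^sub>X\<close> completing \<open>\<eta>\<^sub>r\<^sup>X\<close> to an exact triangle.\<close>

definition is_cone_eta :: "('k, 'o, 'm) tpc \<Rightarrow> real \<Rightarrow> 'o \<Rightarrow> 'o \<Rightarrow> bool"
  where "is_cone_eta C r X Q \<longleftrightarrow>
    acyclic_of C r Q \<and> (\<exists>g h. (sh C r X, X, Q, eta_map C r X, g, h) \<in> Tri C)"

locale triangulated_persistence_category = shifted_persistence_category k C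
  for k :: "('k, 'x) ring_scheme" and C :: "('k, 'o, 'm) tpc" +
  assumes C_zero_triangulated: "triangulated_category (C_zero C)"
    and shift_triangulated:
      "triangulated_functor (C_zero C) (C_zero C) (sh C r) (fmor (shift C r) 0)"
    and cone_eta: "X \<in> Ob C \<Longrightarrow> r \<ge> 0 \<Longrightarrow> \<exists>Q. is_cone_eta C r X Q"

definition tpc_functor ::
  "('k, 'x) ring_scheme \<Rightarrow> ('k, 'o, 'm) tpc \<Rightarrow> ('k, 'p, 'n) tpc \<Rightarrow> ('o, 'm, 'p, 'n) pfun \<Rightarrow> bool"
  where "tpc_functor k C D F \<longleftrightarrow>
    persistence_functor k C D F \<and>
    (\<forall>r. \<forall>A\<in>Ob C. fob F (sh C r A) = sh D r (fob F A)) \<and>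
    (\<forall>r s. \<forall>A\<in>Ob C. \<forall>B\<in>Ob C. \<forall>f\<in>mor C s A B.
       fmor F s (sh C r A) (sh C r B) (fmor (shift C r) s A B f) =
       fmor (shift D r) s (fob F A) (fob F B) (fmor F s A B f)) \<and>
    (\<forall>r s. \<forall>X\<in>Ob C. fmor F (s - r) (sh C r X) (sh C s X) (eta C r s X) = eta D r s (fob F X)) \<and>
    triangulated_functor (C_zero C) (C_zero D) (fob F) (fmor F 0)"


subsection \<open>Acyclic objects\<close>

definition acyclics :: "('k, 'o, 'm) tpc \<Rightarrow> 'o set"
  where "acyclics C = {K \<in> Ob C. \<exists>r\<ge>0. acyclic_of C r K}"

definition AC_zero :: "('k, 'o, 'm) tpc \<Rightarrow> ('o, 'm, _) tricat"
  where "AC_zero C = full_tri_sub (C_zero C) (acyclics C)"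


subsection \<open>The category \<open>C\<^sub>\<infinity>\<close>\<close>

text \<open>A morphism of \<open>C\<^sub>\<infinity>\<close> is a class of pairs \<open>(\<alpha>, f)\<close> with \<open>f \<in> hom\<^sup>\<alpha>\<close>, two pairs being identified when they
  become equal in some \<open>hom\<^sup>\<gamma>\<close>.\<close>

definition colim_pairs :: "('k, 'o, 'm) tpc \<Rightarrow> 'o \<Rightarrow> 'o \<Rightarrow> (real \<times> 'm) set"
  where "colim_pairs C A B = {(\<alpha>, f). f \<in> mor C \<alpha> A B}"

definition colim_rel :: "('k, 'o, 'm) tpc \<Rightarrow> 'o \<Rightarrow> 'o \<Rightarrow> ((real \<times> 'm) \<times> (real \<times> 'm)) set"
  where "colim_rel C A B = {((\<alpha>, f), (\<beta>, g)). f \<in> mor C \<alpha> A B \<and> g \<in> mor C \<beta> A B \<and>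
    (\<exists>\<gamma>. \<alpha> \<le> \<gamma> \<and> \<beta> \<le> \<gamma> \<and> inc C \<alpha> \<gamma> A B f = inc C \<beta> \<gamma> A B g)}"

definition colim_class :: "('k, 'o, 'm) tpc \<Rightarrow> 'o \<Rightarrow> 'o \<Rightarrow> real \<Rightarrow> 'm \<Rightarrow> (real \<times> 'm) set"
  where "colim_class C A B \<alpha> f = colim_rel C A B `` {(\<alpha>, f)}"

definition colim_hom :: "('k, 'o, 'm) tpc \<Rightarrow> 'o \<Rightarrow> 'o \<Rightarrow> ((real \<times> 'm) set) ring"
  where "colim_hom C A B =
    \<lparr>carrier = colim_pairs C A B // colim_rel C A B,
     monoid.mult = (\<lambda>_ _. undefined), one = undefined,
     ring.zero = colim_class C A B 0 \<zero>\<^bsub>Hom C 0 A B\<^esub>,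
     ring.add = (\<lambda>a b. \<Union>(\<alpha>, f)\<in>a. \<Union>(\<beta>, g)\<in>b.
       colim_class C A B (max \<alpha> \<beta>)
         (inc C \<alpha> (max \<alpha> \<beta>) A B f \<oplus>\<^bsub>Hom C (max \<alpha> \<beta>) A B\<^esub> inc C \<beta> (max \<alpha> \<beta>) A B g))\<rparr>"

definition colim_cmp ::
  "('k, 'o, 'm) tpc \<Rightarrow> 'o \<Rightarrow> 'o \<Rightarrow> 'o \<Rightarrow> (real \<times> 'm) set \<Rightarrow> (real \<times> 'm) set \<Rightarrow> (real \<times> 'm) set"
  where "colim_cmp C A B E a b =
    (\<Union>(\<alpha>, f)\<in>a. \<Union>(\<beta>, g)\<in>b. colim_class C A E (\<alpha> + \<beta>) (cmp C \<alpha> \<beta> A B E f g))"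

text \<open>The translation of \<open>C\<^sub>\<infinity>\<close> is the one induced on the Verdier quotient. Every morphism \<open>a : A \<rightarrow> B\<close> of
  \<open>C\<^sub>\<infinity>\<close> is a fraction \<open>[f] \<circ> [\<eta>\<^sub>r\<^sup>A]\<^sup>-\<^sup>1\<close> with \<open>r \<ge> 0\<close> and \<open>f \<in> hom\<^sup>0(\<Sigma>\<^sup>rA, B)\<close>, and its translate is
  \<open>[Tf] \<circ> [T\<eta>\<^sub>r\<^sup>A]\<^sup>-\<^sup>1\<close>.\<close>

definition colim_T :: "('k, 'o, 'm) tpc \<Rightarrow> 'o \<Rightarrow> 'o \<Rightarrow> (real \<times> 'm) set \<Rightarrow> (real \<times> 'm) set"
  where "colim_T C A B a = (THE b. b \<in> carrier (colim_hom C (Tr C A) (Tr C B)) \<and>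
    (\<exists>r\<ge>0. \<exists>f\<in>mor C 0 (sh C r A) B.
       colim_cmp C (sh C r A) A B (colim_class C (sh C r A) A 0 (eta_map C r A)) a =
         colim_class C (sh C r A) B 0 f \<and>
       colim_cmp C (Tr C (sh C r A)) (Tr C A) (Tr C B)
           (colim_class C (Tr C (sh C r A)) (Tr C A) 0 (Trm C (sh C r A) A (eta_map C r A))) b =
         colim_class C (Tr C (sh C r A)) (Tr C B) 0 (Trm C (sh C r A) B f)))"

definition C_inf_cat :: "('k, 'o, 'm) tpc \<Rightarrow> ('o, (real \<times> 'm) set, unit) tricat"
  where "C_inf_cat C =
    \<lparr>tob = Ob C, thom = colim_hom C, tcmp = colim_cmp C,
     tidn = (\<lambda>A. colim_class C A A 0 (idn C A)), Tob = Tr C, Tmor = colim_T C, ttri = {}\<rparr>"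

text \<open>The exact triangles of the Verdier quotient are the triangles of \<open>C\<^sub>\<infinity>\<close> isomorphic to images of
  exact triangles of \<open>C\<^sub>0\<close>.\<close>

definition C_inf :: "('k, 'o, 'm) tpc \<Rightarrow> ('o, (real \<times> 'm) set, unit) tricat"
  where "C_inf C = (let D = C_inf_cat C in D\<lparr>ttri := {(X, Y, Z, f, g, h).
    f \<in> tmor D X Y \<and> g \<in> tmor D Y Z \<and> h \<in> tmor D Z (Tr C X) \<and>
    (\<exists>X' Y' Z' f' g' h' a b c. (X', Y', Z', f', g', h') \<in> Tri C \<and>
       is_iso_in D X' X a \<and> is_iso_in D Y' Y b \<and> is_iso_in D Z' Z c \<and>
       tcmp D X' Y' Y (colim_class C X' Y' 0 f') b = tcmp D X' X Y a f \<and>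
       tcmp D Y' Z' Z (colim_class C Y' Z' 0 g') c = tcmp D Y' Y Z b g \<and>
       tcmp D Z' (Tr C X') (Tr C X) (colim_class C Z' (Tr C X') 0 h') (Tmor D X' X a) =
         tcmp D Z' Z (Tr C X) c h)}\<rparr>)"


subsection \<open>Opposites\<close>

definition Tr_inv :: "('k, 'o, 'm) tpc \<Rightarrow> 'o \<Rightarrow> 'o"
  where "Tr_inv C = the_inv_into (Ob C) (Tr C)"

definition Trm_inv :: "('k, 'o, 'm) tpc \<Rightarrow> 'o \<Rightarrow> 'o \<Rightarrow> 'm \<Rightarrow> 'm"
  where "Trm_inv C X Y =
    the_inv_into (mor C 0 (Tr_inv C X) (Tr_inv C Y)) (Trm C (Tr_inv C X) (Tr_inv C Y))"

definition op_pfun :: "('o, 'm, 'p, 'n) pfun \<Rightarrow> ('o, 'm, 'p, 'n) pfun"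
  where "op_pfun F = \<lparr>fob = fob F, fmor = (\<lambda>s A B. fmor F s B A)\<rparr>"

definition op_tpc :: "('k, 'o, 'm) tpc \<Rightarrow> ('k, 'o, 'm) tpc"
  where "op_tpc C =
    \<lparr>Ob = Ob C,
     Hom = (\<lambda>s A B. Hom C s B A),
     inc = (\<lambda>s t A B. inc C s t B A),
     cmp = (\<lambda>r s A B E f g. cmp C s r E B A g f),
     idn = idn C,
     shift = (\<lambda>r. op_pfun (shift C (- r))),
     eta = (\<lambda>r s. eta C (- s) (- r)),
     Tr = Tr_inv C,
     Trm = (\<lambda>X Y. Trm_inv C Y X),
     Tri = {(Z, Y, X, g, f, \<ominus>\<^bsub>Hom C 0 (Tr_inv C Z) X\<^esub> Trm_inv C Z (Tr C X) h) | X Y Z f g h.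
       (X, Y, Z, f, g, h) \<in> Tri C}\<rparr>"


subsection \<open>Monoidal structures\<close>

text \<open>\<open>ten M A\<close> is the functor \<open>(-) \<otimes> A\<close>.\<close>

record ('o, 'm) tensor =
  ten :: "'o \<Rightarrow> ('o, 'm, 'o, 'm) pfun"
  unit_ob :: "'o"

abbreviation tens :: "('o, 'm) tensor \<Rightarrow> 'o \<Rightarrow> 'o \<Rightarrow> 'o"
  where "tens M X A \<equiv> fob (ten M A) X"

text \<open>Associativity, symmetry and the unit law are only required up to isomorphism in \<open>C\<^sub>0\<close>, so that
  both strict structures and structures with coherence isomorphisms are covered.
  The isomorphisms \<open>TX \<otimes> A \<cong> T(X \<otimes> A)\<close> are part of \<open>triangulated_functor\<close>.\<close>

locale monoidal_tpc = triangulated_persistence_category k C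
  for k :: "('k, 'x) ring_scheme" and C :: "('k, 'o, 'm) tpc" +
  fixes M :: "('o, 'm) tensor"
  assumes ten_functor: "A \<in> Ob C \<Longrightarrow> persistence_functor k C C (ten M A)"
    and ten_triangulated: "A \<in> Ob C \<Longrightarrow>
      triangulated_functor (C_zero C) (C_zero C) (fob (ten M A)) (fmor (ten M A) 0)"
    and ten_assoc: "X \<in> Ob C \<Longrightarrow> Y \<in> Ob C \<Longrightarrow> Z \<in> Ob C \<Longrightarrow>
      isomorphic_in (C_zero C) (tens M (tens M X Y) Z) (tens M X (tens M Y Z))"
    and ten_sym: "X \<in> Ob C \<Longrightarrow> Y \<in> Ob C \<Longrightarrow> isomorphic_in (C_zero C) (tens M X Y) (tens M Y X)"
    and unit_closed: "unit_ob M \<in> Ob C"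
    and ten_unit: "X \<in> Ob C \<Longrightarrow> isomorphic_in (C_zero C) (tens M X (unit_ob M)) X"
    and ten_shift: "X \<in> Ob C \<Longrightarrow> A \<in> Ob C \<Longrightarrow>
      \<exists>\<theta>. (\<forall>r. is_iso_in (C_zero C) (tens M (sh C r X) A) (sh C r (tens M X A)) (\<theta> r)) \<and>
        \<theta> 0 = idn C (tens M X A) \<and>
        (\<forall>r s. cmp C (s - r) 0 (tens M (sh C r X) A) (tens M (sh C s X) A) (sh C s (tens M X A))
                 (fmor (ten M A) (s - r) (sh C r X) (sh C s X) (eta C r s X)) (\<theta> s) =
               cmp C 0 (s - r) (tens M (sh C r X) A) (sh C r (tens M X A)) (sh C s (tens M X A))
                 (\<theta> r) (eta C r s (tens M X A)))"

definition monoidal_functor ::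
  "('k, 'x) ring_scheme \<Rightarrow> ('k, 'o, 'm) tpc \<Rightarrow> ('o, 'm) tensor \<Rightarrow> ('k, 'p, 'n) tpc \<Rightarrow> ('p, 'n) tensor \<Rightarrow>
    ('o, 'm, 'p, 'n) pfun \<Rightarrow> bool"
  where "monoidal_functor k C M D N F \<longleftrightarrow>
    tpc_functor k C D F \<and>
    (\<forall>X\<in>Ob C. \<forall>Y\<in>Ob C.
       isomorphic_in (C_zero D) (fob F (tens M X Y)) (tens N (fob F X) (fob F Y))) \<and>
    isomorphic_in (C_zero D) (fob F (unit_ob M)) (unit_ob N)"


section \<open>K-groups\<close>

definition G_free :: "('o, 'm, 'x) tricat \<Rightarrow> ('o \<Rightarrow>\<^sub>0 int) monoid"
  where "G_free D = free_Abelian_group (tob D)"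

definition R_tri :: "('o, 'm, 'x) tricat \<Rightarrow> ('o \<Rightarrow>\<^sub>0 int) set"
  where "R_tri D = generate (G_free D)
    {frag_of B - (frag_of A + frag_of E) | A B E. \<exists>f g h. (A, B, E, f, g, h) \<in> ttri D}"

text \<open>\<open>novikov_act s\<close> is the action on a free abelian group determined by \<open>t^r \<cdot> X = s r X\<close>.\<close>

definition novikov_act :: "(real \<Rightarrow> 'o \<Rightarrow> 'o) \<Rightarrow> novikov \<Rightarrow> ('o \<Rightarrow>\<^sub>0 int) \<Rightarrow> ('o \<Rightarrow>\<^sub>0 int)"
  where "novikov_act s p x =
    (\<Sum>r\<in>Poly_Mapping.keys p.
       frag_cmul (Poly_Mapping.lookup p r) (frag_extend (\<lambda>X. frag_of (s r X)) x))"

text \<open>The quotient \<open>G / R\<close> as a module over the Novikov polynomials. No product is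
  specified at this point.\<close>

definition quot_module ::
  "('k, 'o, 'm) tpc \<Rightarrow> ('o \<Rightarrow>\<^sub>0 int) monoid \<Rightarrow> ('o \<Rightarrow>\<^sub>0 int) set \<Rightarrow> (novikov, ('o \<Rightarrow>\<^sub>0 int) set) module"
  where "quot_module C G R =
    \<lparr>carrier = carrier (G Mod R), monoid.mult = (\<lambda>_ _. undefined), one = undefined,
     ring.zero = one (G Mod R), ring.add = monoid.mult (G Mod R),
     smult = (\<lambda>p x. \<Union>g\<in>x. R #>\<^bsub>G\<^esub> novikov_act (sh C) p g)\<rparr>"

text \<open>The map into \<open>G / R\<close> induced by a map into \<open>G\<close>.\<close>

definition quot_map ::
  "('p \<Rightarrow>\<^sub>0 int) monoid \<Rightarrow> ('p \<Rightarrow>\<^sub>0 int) set \<Rightarrow> (('o \<Rightarrow>\<^sub>0 int) \<Rightarrow> ('p \<Rightarrow>\<^sub>0 int)) \<Rightarrow>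
    ('o \<Rightarrow>\<^sub>0 int) set \<Rightarrow> ('p \<Rightarrow>\<^sub>0 int) set"
  where "quot_map G R u x = (\<Union>g\<in>x. R #>\<^bsub>G\<^esub> u g)"

definition K_group :: "('k, 'o, 'm) tpc \<Rightarrow> ('o, 'n, 'x) tricat \<Rightarrow> (novikov, ('o \<Rightarrow>\<^sub>0 int) set) module"
  where "K_group C D = quot_module C (G_free D) (R_tri D)"

definition K_class :: "('o, 'm, 'x) tricat \<Rightarrow> 'o \<Rightarrow> ('o \<Rightarrow>\<^sub>0 int) set"
  where "K_class D X = R_tri D #>\<^bsub>G_free D\<^esub> frag_of X"

definition K :: "('k, 'o, 'm) tpc \<Rightarrow> (novikov, ('o \<Rightarrow>\<^sub>0 int) set) module"
  where "K C = K_group C (C_zero C)"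

definition KA :: "('k, 'o, 'm) tpc \<Rightarrow> (novikov, ('o \<Rightarrow>\<^sub>0 int) set) module"
  where "KA C = K_group C (AC_zero C)"

definition K_inf :: "('k, 'o, 'm) tpc \<Rightarrow> (novikov, ('o \<Rightarrow>\<^sub>0 int) set) module"
  where "K_inf C = K_group C (C_inf C)"

definition TorG :: "('k, 'o, 'm) tpc \<Rightarrow> ('o \<Rightarrow>\<^sub>0 int) monoid"
  where "TorG C =
    (G_free (AC_zero C))\<lparr>carrier := carrier (G_free (AC_zero C)) \<inter> R_tri (C_zero C)\<rparr>"

definition TorK :: "('k, 'o, 'm) tpc \<Rightarrow> (novikov, ('o \<Rightarrow>\<^sub>0 int) set) module"
  where "TorK C = quot_module C (TorG C) (R_tri (AC_zero C))"


subsection \<open>Action on functors\<close>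

definition free_map :: "('o, 'm, 'p, 'n) pfun \<Rightarrow> ('o \<Rightarrow>\<^sub>0 int) \<Rightarrow> ('p \<Rightarrow>\<^sub>0 int)"
  where "free_map F = frag_extend (\<lambda>X. frag_of (fob F X))"

text \<open>The first argument is the target of the functor.\<close>

definition K_map ::
  "('k, 'p, 'n) tpc \<Rightarrow> ('o, 'm, 'p, 'n) pfun \<Rightarrow> ('o \<Rightarrow>\<^sub>0 int) set \<Rightarrow> ('p \<Rightarrow>\<^sub>0 int) set"
  where "K_map D F = quot_map (G_free (C_zero D)) (R_tri (C_zero D)) (free_map F)"

definition KA_map ::
  "('k, 'p, 'n) tpc \<Rightarrow> ('o, 'm, 'p, 'n) pfun \<Rightarrow> ('o \<Rightarrow>\<^sub>0 int) set \<Rightarrow> ('p \<Rightarrow>\<^sub>0 int) set"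
  where "KA_map D F = quot_map (G_free (AC_zero D)) (R_tri (AC_zero D)) (free_map F)"

definition K_inf_map ::
  "('k, 'p, 'n) tpc \<Rightarrow> ('o, 'm, 'p, 'n) pfun \<Rightarrow> ('o \<Rightarrow>\<^sub>0 int) set \<Rightarrow> ('p \<Rightarrow>\<^sub>0 int) set"
  where "K_inf_map D F = quot_map (G_free (C_inf D)) (R_tri (C_inf D)) (free_map F)"

definition TorK_map ::
  "('k, 'p, 'n) tpc \<Rightarrow> ('o, 'm, 'p, 'n) pfun \<Rightarrow> ('o \<Rightarrow>\<^sub>0 int) set \<Rightarrow> ('p \<Rightarrow>\<^sub>0 int) set"
  where "TorK_map D F = quot_map (TorG D) (R_tri (AC_zero D)) (free_map F)"


subsection \<open>Comparison maps\<close>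

definition psi_map :: "('k, 'o, 'm) tpc \<Rightarrow> ('o \<Rightarrow>\<^sub>0 int) set \<Rightarrow> ('o \<Rightarrow>\<^sub>0 int) set"
  where "psi_map C = quot_map (G_free (AC_zero C)) (R_tri (AC_zero C)) (\<lambda>g. g)"

definition j_map :: "('k, 'o, 'm) tpc \<Rightarrow> ('o \<Rightarrow>\<^sub>0 int) set \<Rightarrow> ('o \<Rightarrow>\<^sub>0 int) set"
  where "j_map C = quot_map (G_free (C_zero C)) (R_tri (C_zero C)) (\<lambda>g. g)"

definition pi_map :: "('k, 'o, 'm) tpc \<Rightarrow> ('o \<Rightarrow>\<^sub>0 int) set \<Rightarrow> ('o \<Rightarrow>\<^sub>0 int) set"
  where "pi_map C = quot_map (G_free (C_inf C)) (R_tri (C_inf C)) (\<lambda>g. g)"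

definition Q_map :: "('k, 'o, 'm) tpc \<Rightarrow> real \<Rightarrow> ('o \<Rightarrow>\<^sub>0 int) set \<Rightarrow> ('o \<Rightarrow>\<^sub>0 int) set"
  where "Q_map C r = quot_map (G_free (AC_zero C)) (R_tri (AC_zero C))
    (frag_extend (\<lambda>X. frag_of (SOME Q. is_cone_eta C r X Q)))"


subsection \<open>Products\<close>

definition free_prod :: "('o, 'm) tensor \<Rightarrow> ('o \<Rightarrow>\<^sub>0 int) \<Rightarrow> ('o \<Rightarrow>\<^sub>0 int) \<Rightarrow> ('o \<Rightarrow>\<^sub>0 int)"
  where "free_prod M x y = frag_extend (\<lambda>X. frag_extend (\<lambda>Y. frag_of (tens M X Y)) y) x"

definition quot_prod ::
  "('o \<Rightarrow>\<^sub>0 int) monoid \<Rightarrow> ('o \<Rightarrow>\<^sub>0 int) set \<Rightarrow> ('o, 'm) tensor \<Rightarrow>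
    ('o \<Rightarrow>\<^sub>0 int) set \<Rightarrow> ('o \<Rightarrow>\<^sub>0 int) set \<Rightarrow> ('o \<Rightarrow>\<^sub>0 int) set"
  where "quot_prod G R M x y = (\<Union>g\<in>x. \<Union>g'\<in>y. R #>\<^bsub>G\<^esub> free_prod M g g')"

definition K_alg :: "('k, 'o, 'm) tpc \<Rightarrow> ('o, 'm) tensor \<Rightarrow> (novikov, ('o \<Rightarrow>\<^sub>0 int) set) module"
  where "K_alg C M = (K C)\<lparr>monoid.mult := quot_prod (G_free (C_zero C)) (R_tri (C_zero C)) M\<rparr>"

definition KA_alg :: "('k, 'o, 'm) tpc \<Rightarrow> ('o, 'm) tensor \<Rightarrow> (novikov, ('o \<Rightarrow>\<^sub>0 int) set) module"
  where "KA_alg C M = (KA C)\<lparr>monoid.mult := quot_prod (G_free (AC_zero C)) (R_tri (AC_zero C)) M\<rparr>"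

definition K_inf_alg :: "('k, 'o, 'm) tpc \<Rightarrow> ('o, 'm) tensor \<Rightarrow> (novikov, ('o \<Rightarrow>\<^sub>0 int) set) module"
  where "K_inf_alg C M = (K_inf C)\<lparr>monoid.mult := quot_prod (G_free (C_inf C)) (R_tri (C_inf C)) M\<rparr>"

definition TorK_alg :: "('k, 'o, 'm) tpc \<Rightarrow> ('o, 'm) tensor \<Rightarrow> (novikov, ('o \<Rightarrow>\<^sub>0 int) set) module"
  where "TorK_alg C M = (TorK C)\<lparr>monoid.mult := quot_prod (TorG C) (R_tri (AC_zero C)) M\<rparr>"

end

theory Submission
  imports Defs
begin

text \<open>
  All groups in the statement are quotients of groups of chains, that is finite integer combinations of objects, by
  relations coming from exact triangles. Two facts about these relations carry the theorem.

  The relations of \<open>K\<^sub>\<infinity>\<close> are those of \<open>K(C\<^sub>0)\<close> together with the chains of acyclic objects (\<open>R_tri_C_inf\<close>).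
  Let \<open>f \<in> hom\<^sup>\<alpha>(A, B)\<close> represent an isomorphism of \<open>C\<^sub>\<infinity>\<close>. Then the cone of \<open>\<Sigma>\<^sup>\<alpha>A \<rightarrow> A \<rightarrow> B\<close> is acyclic
  (\<open>iso_cone_acyclic\<close>), and \<open>A\<close> and \<open>\<Sigma>\<^sup>\<alpha>A\<close> also differ by an acyclic cone, so \<open>[A] = [B]\<close> modulo acyclic objects.
  Conversely an acyclic object is isomorphic to a zero object in \<open>C\<^sub>\<infinity>\<close>. With this description the exact sequence is a
  comparison of subgroups of chains.

  The class \<open>[Q\<^sub>r\<^sub>,\<^sub>X]\<close> in \<open>K(AC\<^sub>0)\<close> is additive on exact triangles \<open>A \<rightarrow> B \<rightarrow> E\<close> of \<open>C\<^sub>0\<close> (\<open>eta_cone_additive\<close>). Two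
  octahedra over the diagonal \<open>\<Sigma>\<^sup>rA \<rightarrow> B\<close> give an exact triangle \<open>Q\<^sub>B \<rightarrow> Q' \<rightarrow> TQ\<^sub>A\<close> in which \<open>Q'\<close> is the cone of a morphism
  \<open>e' : \<Sigma>\<^sup>rE \<rightarrow> E\<close>. It agrees with \<open>\<eta>\<^sub>r\<^sup>E\<close> on \<open>\<Sigma>\<^sup>rB\<close>, but it may differ from \<open>\<eta>\<^sub>r\<^sup>E\<close>. For small \<open>r\<close>, however,
  semicontinuity makes composition with \<open>\<eta>\<^sub>r\<close> bijective on the finitely many morphism groups that occur. Hence
  \<open>e' = \<eta>\<^sub>r\<^sup>E x\<close> for some \<open>x : E \<rightarrow> E\<close>, and \<open>x\<close> is an automorphism by the five lemma (\<open>five_lemma_endo\<close>), so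
  \<open>[Q'] = [Q\<^sub>E]\<close>. For large \<open>r\<close> write \<open>r = n\<delta>\<close> with \<open>\<delta>\<close> small: \<open>\<eta>\<^sub>r\<close> is a composite of \<open>n\<close> shifted copies of \<open>\<eta>\<^sub>\<delta>\<close>,
  and the octahedron splits \<open>[Q\<^sub>r\<^sub>,\<^sub>X]\<close> accordingly (\<open>eta_cone_add\<close>).

  The same device relates \<open>\<eta>\<close> to the translation. The axioms do not compare \<open>\<eta>\<^sub>r\<^sup>T\<^sup>X\<close> with \<open>T\<eta>\<^sub>r\<^sup>X\<close>, but for small \<open>r\<close> each
  is a multiple of the other (\<open>eta_translate_small\<close>), and subdividing \<open>r\<close> shows that \<open>X\<close> is acyclic if \<open>TX\<close> is
  (\<open>acyclic_untranslate\<close>). The converse is more direct: if \<open>\<eta>\<^sub>r\<^sup>X = 0\<close>, then \<open>T\<Sigma>\<^sup>rX\<close> is a retract of the acyclic cone of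
  \<open>\<eta>\<^sub>r\<^sup>X\<close> (\<open>acyclic_translate\<close>). Together they make the translation of \<open>C\<^sub>\<infinity>\<close> well defined on identities, for \<open>C\<close> as
  well as for \<open>C\<^sup>o\<^sup>p\<close>, where \<open>T\<^sup>-\<^sup>1\<close> takes the place of \<open>T\<close>. The relations of \<open>C\<close> and of \<open>C\<^sup>o\<^sup>p\<close> then coincide.

  For products, associativity, symmetry and compatibility with shifts hold up to isomorphism in \<open>C\<^sub>0\<close>, hence modulo the
  relations, and the relations are ideals because \<open>(-) \<otimes> A\<close> is an exact functor that preserves acyclic objects.
\<close>

section \<open>Quotients of free abelian groups as Novikov modules\<close>

definition is_subgroup :: "('o \<Rightarrow>\<^sub>0 int) set \<Rightarrow> bool"
  where "is_subgroup H \<longleftrightarrow> 0 \<in> H \<and> (\<forall>x\<in>H. \<forall>y\<in>H. x - y \<in> H)"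

definition coset :: "('o \<Rightarrow>\<^sub>0 int) set \<Rightarrow> ('o \<Rightarrow>\<^sub>0 int) \<Rightarrow> ('o \<Rightarrow>\<^sub>0 int) set"
  where "coset R g = {x. x - g \<in> R}"

definition additive_map :: "(('o \<Rightarrow>\<^sub>0 int) \<Rightarrow> ('p \<Rightarrow>\<^sub>0 int)) \<Rightarrow> bool"
  where "additive_map u \<longleftrightarrow> (\<forall>x y. u (x - y) = u x - u y)"

lemma subgroup_zero: "is_subgroup H \<Longrightarrow> 0 \<in> H"
  by (simp add: is_subgroup_def)

lemma subgroup_diff: "is_subgroup H \<Longrightarrow> x \<in> H \<Longrightarrow> y \<in> H \<Longrightarrow> x - y \<in> H"
  by (simp add: is_subgroup_def)

lemma subgroup_uminus: "is_subgroup H \<Longrightarrow> x \<in> H \<Longrightarrow> - x \<in> H"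
  using subgroup_diff[of H 0 x] subgroup_zero by force

lemma subgroup_uminus_iff: "is_subgroup H \<Longrightarrow> - x \<in> H \<longleftrightarrow> x \<in> H"
  using subgroup_uminus[of H x] subgroup_uminus[of H "- x"] by auto

lemma subgroup_minus_commute: "is_subgroup H \<Longrightarrow> x - y \<in> H \<longleftrightarrow> y - x \<in> H"
  using subgroup_uminus_iff[of H "x - y"] by simp

lemma subgroup_add:
  assumes "is_subgroup H" "x \<in> H" "y \<in> H" shows "x + y \<in> H"
  using subgroup_diff[OF assms(1,2) subgroup_uminus[OF assms(1,3)]] by simp

lemma subgroup_trans:
  assumes "is_subgroup H" "x - y \<in> H" "y - z \<in> H" shows "x - z \<in> H"
  using subgroup_add[OF assms] by simp

lemma subgroup_sum: "is_subgroup H \<Longrightarrow> (\<And>i. i \<in> I \<Longrightarrow> f i \<in> H) \<Longrightarrow> sum f I \<in> H"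
  by (induction I rule: infinite_finite_induct) (auto simp: subgroup_zero subgroup_add)

lemma subgroup_cmul: "is_subgroup H \<Longrightarrow> x \<in> H \<Longrightarrow> frag_cmul n x \<in> H"
  by (rule frag_closure_minus_cmul) (auto simp: subgroup_zero subgroup_diff)

lemma subgroup_Int: "is_subgroup H \<Longrightarrow> is_subgroup H' \<Longrightarrow> is_subgroup (H \<inter> H')"
  by (auto simp: is_subgroup_def)

lemma subgroup_keys: "is_subgroup {c. Poly_Mapping.keys c \<subseteq> S}"
  unfolding is_subgroup_def using keys_diff by force

lemma additive_map_extend [intro]: "additive_map (frag_extend f)"
  by (simp add: additive_map_def frag_extend_diff)

lemma additive_map_id [intro]: "additive_map (\<lambda>x. x)"
  by (simp add: additive_map_def)

lemma additive_map_diff: "additive_map u \<Longrightarrow> u (x - y) = u x - u y"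
  by (simp add: additive_map_def)

lemma additive_map_zero: "additive_map u \<Longrightarrow> u 0 = 0"
  by (metis additive_map_def diff_self)

lemma additive_map_add: "additive_map u \<Longrightarrow> u (x + y) = u x + u y"
  by (metis additive_map_diff add_diff_cancel_right' diff_add_cancel)

lemma additive_map_sum: "additive_map u \<Longrightarrow> u (sum f I) = (\<Sum>i\<in>I. u (f i))"
  by (induction I rule: infinite_finite_induct) (auto simp: additive_map_zero additive_map_add)

lemma additive_map_cmul: "additive_map u \<Longrightarrow> u (frag_cmul n x) = frag_cmul n (u x)"
proof -
  assume u: "additive_map u"
  have nat: "u (frag_cmul (int m) x) = frag_cmul (int m) (u x)" for m
    by (induction m) (simp_all add: frag_cmul_distrib additive_map_add[OF u] additive_map_zero[OF u])
  have "n = int (nat n) - int (nat (- n))" by simp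
  then show ?thesis
    by (metis nat u additive_map_diff frag_cmul_diff_distrib)
qed

lemma subgroup_vimage: "additive_map u \<Longrightarrow> is_subgroup H \<Longrightarrow> is_subgroup (u -` H)"
  by (auto simp: is_subgroup_def additive_map_zero additive_map_diff)

lemma frag_span:
  assumes "is_subgroup H" "\<And>X. X \<in> S \<Longrightarrow> frag_of X \<in> H" "Poly_Mapping.keys c \<subseteq> S"
  shows "c \<in> H"
  using assms(3) by (induction rule: frag_induction)
    (auto simp: assms(2) subgroup_zero[OF assms(1)] subgroup_diff[OF assms(1)])

text \<open>Used with objectwise isomorphic or equivalent constructions \<open>f\<close> and \<open>g\<close>: they need to be compared on generators only.\<close>

lemma extend_agree_mod:
  assumes "is_subgroup H" "\<And>X. X \<in> S \<Longrightarrow> f X - g X \<in> H" "Poly_Mapping.keys c \<subseteq> S"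
  shows "frag_extend f c - frag_extend g c \<in> H"
  using assms(3)
proof (induction rule: frag_induction)
  case (diff a b)
  then show ?case
    using subgroup_diff[OF assms(1) diff] by (simp add: frag_extend_diff algebra_simps)
qed (auto simp: assms(2) subgroup_zero[OF assms(1)])

lemma extend_of: "frag_extend frag_of c = c"
  by (rule frag_expansion[symmetric])

lemma extend_extend: "frag_extend f (frag_extend g c) = frag_extend (\<lambda>X. frag_extend f (g X)) c"
  using subset_UNIV by (induction c rule: frag_induction) (auto simp: frag_extend_diff)

subsection \<open>Cosets\<close>

lemma coset_refl: "is_subgroup R \<Longrightarrow> g \<in> coset R g"
  by (simp add: coset_def subgroup_zero)

lemma coset_eq_iff: "is_subgroup R \<Longrightarrow> coset R g = coset R h \<longleftrightarrow> g - h \<in> R"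
proof
  assume R: "is_subgroup R" and "coset R g = coset R h"
  then show "g - h \<in> R"
    using coset_refl[OF R, of g] by (simp add: coset_def)
next
  assume R: "is_subgroup R" and *: "g - h \<in> R"
  then have **: "h - g \<in> R"
    using subgroup_minus_commute by blast
  show "coset R g = coset R h"
    unfolding coset_def using subgroup_trans[OF R _ *] subgroup_trans[OF R _ **] by auto
qed

lemma coset_eqI: "is_subgroup R \<Longrightarrow> g - h \<in> R \<Longrightarrow> coset R g = coset R h"
  by (simp add: coset_eq_iff)

text \<open>Both the free groups \<open>G\<langle>-\<rangle>\<close> and the group of chains in the definition of \<open>TorK\<close> are of this form: a group \<open>S\<close> of
  chains with pointwise addition.\<close>

definition frag_group :: "('o \<Rightarrow>\<^sub>0 int) monoid \<Rightarrow> ('o \<Rightarrow>\<^sub>0 int) set \<Rightarrow> bool"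
  where "frag_group G S \<longleftrightarrow> is_subgroup S \<and> carrier G = S \<and> monoid.mult G = (+) \<and> one G = 0"

lemma r_coset_eq: "frag_group G S \<Longrightarrow> R #>\<^bsub>G\<^esub> g = coset R g"
  by (force simp: r_coset_def coset_def frag_group_def)

lemma frag_group_free: "frag_group (free_Abelian_group S) {c. Poly_Mapping.keys c \<subseteq> S}"
  by (auto simp: frag_group_def free_Abelian_group_def subgroup_keys)

lemma frag_group_restrict:
  assumes "frag_group G S" "is_subgroup H"
  shows "frag_group (G\<lparr>carrier := carrier G \<inter> H\<rparr>) (S \<inter> H)"
  using assms by (auto simp: frag_group_def subgroup_Int)

locale frag_quotient =
  fixes G :: "('o \<Rightarrow>\<^sub>0 int) monoid" and S R :: "('o \<Rightarrow>\<^sub>0 int) set"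
  assumes frag_group: "frag_group G S" and subR: "is_subgroup R" and R_le: "R \<subseteq> S"
begin

lemma subS: "is_subgroup S"
  using frag_group by (simp add: frag_group_def)

lemma carrier_Mod: "carrier (G Mod R) = coset R ` S"
  using frag_group r_coset_eq[OF frag_group, of R]
  by (auto simp: FactGroup_def RCOSETS_def frag_group_def)

lemma mult_Mod: "coset R g \<otimes>\<^bsub>G Mod R\<^esub> coset R h = coset R (g + h)"
proof -
  have "\<exists>a. a - g \<in> R \<and> (\<exists>b. b - h \<in> R \<and> x = a + b)" if "x - (g + h) \<in> R" for x
    by (rule exI[of _ "x - h"]) (use that subgroup_zero[OF subR] in \<open>auto simp: algebra_simps intro!: exI[of _ h]\<close>)
  moreover have "a + b - (g + h) \<in> R" if "a - g \<in> R" "b - h \<in> R" for a b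
    using subgroup_add[OF subR that] by (simp add: algebra_simps)
  ultimately show ?thesis
    using frag_group by (auto simp: FactGroup_def set_mult_def coset_def frag_group_def)
qed

lemma one_Mod: "\<one>\<^bsub>G Mod R\<^esub> = coset R 0"
  by (simp add: FactGroup_def coset_def)

lemma UN_coset:
  assumes "\<And>h. h \<in> S \<Longrightarrow> h - g \<in> R \<Longrightarrow> f h = A" "g \<in> S"
  shows "(\<Union>h\<in>coset R g. f h) = A"
proof -
  have "f h = A" if "h \<in> coset R g" for h
  proof -
    have "(h - g) + g \<in> S"
      using that R_le assms(2) by (intro subgroup_add[OF subS]) (auto simp: coset_def)
    then show ?thesis using that assms(1) by (simp add: coset_def)
  qed
  then show ?thesis using coset_refl[OF subR, of g] by auto
qed

lemmas quot_simps = carrier_Mod mult_Mod one_Mod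

end

lemma quot_map_coset:
  assumes "frag_quotient G S R" "frag_quotient G' S' R'" "additive_map u"
    and "\<And>x. x \<in> R \<Longrightarrow> u x \<in> R'" "g \<in> S"
  shows "quot_map G' R' u (coset R g) = coset R' (u g)"
proof -
  interpret A: frag_quotient G S R by fact
  interpret B: frag_quotient G' S' R' by fact
  show ?thesis
    unfolding quot_map_def
    by (rule A.UN_coset)
       (auto simp: r_coset_eq[OF B.frag_group] coset_eq_iff[OF B.subR] assms simp flip: additive_map_diff[OF assms(3)])
qed

lemma quot_map_comp:
  assumes "frag_quotient G S R" "frag_quotient G' S' R'" "frag_quotient G'' S'' R''" "additive_map u" "additive_map v"
    and "\<And>x. x \<in> R \<Longrightarrow> u x \<in> R'" "\<And>x. x \<in> S \<Longrightarrow> u x \<in> S'" "\<And>x. x \<in> R' \<Longrightarrow> v x \<in> R''" "x \<in> coset R ` S"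
  shows "quot_map G'' R'' (\<lambda>x. v (u x)) x = quot_map G'' R'' v (quot_map G' R' u x)"
proof -
  obtain g where g: "g \<in> S" "x = coset R g" using assms(9) by blast
  have "additive_map (\<lambda>x. v (u x))" using assms(4,5) by (simp add: additive_map_def)
  then show ?thesis
    using quot_map_coset[OF assms(1,3) _ _ g(1), of "\<lambda>x. v (u x)"] quot_map_coset[OF assms(1,2,4,6) g(1)]
      quot_map_coset[OF assms(2,3,5,8) assms(7)[OF g(1)]] assms(6,8) g(2) by simp
qed

subsection \<open>The Novikov action\<close>

lemma frag_cmul_diff: "frag_cmul n (x - y) = frag_cmul n x - frag_cmul n y"
  by (rule poly_mapping_eqI) (simp add: lookup_minus algebra_simps)

lemma novikov_act_diff: "novikov_act s p (x - y) = novikov_act s p x - novikov_act s p y"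
  by (simp add: novikov_act_def frag_extend_diff sum_subtractf frag_cmul_diff)

lemma additive_novikov_act: "additive_map (novikov_act s p)"
  by (simp add: additive_map_def novikov_act_diff)

lemma novikov_act_alt:
  "novikov_act s p x = frag_extend (\<lambda>r. frag_extend (\<lambda>X. frag_of (s r X)) x) p"
  by (simp add: novikov_act_def frag_extend_def)

lemma novikov_act_in:
  assumes "is_subgroup H" "\<And>r. frag_extend (\<lambda>X. frag_of (s r X)) x \<in> H"
  shows "novikov_act s p x \<in> H"
  unfolding novikov_act_def by (intro subgroup_sum subgroup_cmul assms)

text \<open>Since \<open>t^r\<close> generate the Novikov polynomials additively, commuting with shifts modulo \<open>H\<close> is enough.\<close>

lemma novikov_act_commute:
  assumes "is_subgroup H" "additive_map u"
    and "\<And>r. u (frag_extend (\<lambda>X. frag_of (s r X)) x) - frag_extend (\<lambda>X. frag_of (t r X)) (u x) \<in> H"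
  shows "u (novikov_act s p x) - novikov_act t p (u x) \<in> H"
  unfolding novikov_act_def additive_map_sum[OF assms(2)] additive_map_cmul[OF assms(2)]
    sum_subtractf[symmetric] frag_cmul_diff[symmetric]
  by (intro subgroup_sum subgroup_cmul assms)

lemma novikov_act_mult:
  assumes "\<And>r t X. X \<in> S \<Longrightarrow> s r (s t X) = s (r + t) X" "Poly_Mapping.keys x \<subseteq> S"
  shows "novikov_act s (p * q) x = novikov_act s p (novikov_act s q x)"
proof -
  have base: "frag_extend (\<lambda>X. frag_of (s (a + b) X)) x
      = frag_extend (\<lambda>X. frag_of (s a X)) (frag_extend (\<lambda>X. frag_of (s b X)) x)" for a b
    unfolding extend_extend by (rule frag_extend_eq) (use assms in auto)
  have 1: "novikov_act s (frag_of a * q) x = frag_extend (\<lambda>X. frag_of (s a X)) (novikov_act s q x)" for a q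
    using subset_UNIV[of "Poly_Mapping.keys q"]
  proof (induction q rule: frag_induction)
    case (one b)
    then show ?case by (simp add: novikov_act_alt mult_single base)
  next
    case (diff q q')
    then show ?case by (simp add: novikov_act_alt right_diff_distrib frag_extend_diff)
  qed (simp add: novikov_act_alt)
  show ?thesis
    using subset_UNIV[of "Poly_Mapping.keys p"]
  proof (induction p rule: frag_induction)
    case (one a)
    then show ?case by (simp add: 1) (simp add: novikov_act_alt)
  next
    case (diff q q')
    then show ?case by (simp add: novikov_act_alt left_diff_distrib frag_extend_diff)
  qed (simp add: novikov_act_alt)
qed

lemma vimage_uminus_real: "uminus -` A = uminus ` (A :: real set)"
  by (auto intro: rev_image_eqI)

text \<open>The opposite of a persistence category has \<open>\<Sigma>\<^sup>-\<^sup>r\<close> as its \<open>r\<close>-th shift, whence the twist of the module structure.\<close>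

lemma novikov_act_bar: "novikov_act (\<lambda>r. s (- r)) p x = novikov_act s (novikov_bar p) x"
proof -
  have keys: "Poly_Mapping.keys (novikov_bar p) = uminus ` Poly_Mapping.keys p"
    unfolding novikov_bar_def by (subst keys_map_key) (simp_all add: vimage_uminus_real)
  have lookup: "Poly_Mapping.lookup (novikov_bar p) r = Poly_Mapping.lookup p (- r)" for r
    unfolding novikov_bar_def by (simp add: map_key.rep_eq)
  show ?thesis
    unfolding novikov_act_def keys by (subst sum.reindex) (auto simp: lookup)
qed

lemma cring_Novikov: "cring Novikov"
proof (rule cringI)
  show "abelian_group Novikov"
  proof (rule abelian_groupI)
    fix x assume "x \<in> carrier Novikov"
    show "\<exists>y\<in>carrier Novikov. y \<oplus>\<^bsub>Novikov\<^esub> x = \<zero>\<^bsub>Novikov\<^esub>"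
      by (rule bexI[of _ "- x"]) (auto simp: Novikov_def)
  qed (auto simp: Novikov_def algebra_simps)
  show "comm_monoid Novikov"
    by (rule comm_monoidI) (auto simp: Novikov_def algebra_simps)
qed (auto simp: Novikov_def algebra_simps)

text \<open>The shift \<open>s\<close> acts on the objects \<open>U\<close>, and the chains \<open>S\<close> and relations \<open>R\<close> are stable under it; then \<open>S / R\<close> is a
  Novikov module. All four functors take values in modules of this kind.\<close>

locale novikov_quotient = frag_quotient G S R for G S R +
  fixes U :: "'o set" and s :: "real \<Rightarrow> 'o \<Rightarrow> 'o"
  assumes S_keys: "x \<in> S \<Longrightarrow> Poly_Mapping.keys x \<subseteq> U"
    and s0: "X \<in> U \<Longrightarrow> s 0 X = X" and s_add: "X \<in> U \<Longrightarrow> s r (s t X) = s (r + t) X"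
    and s_S: "x \<in> S \<Longrightarrow> frag_extend (\<lambda>X. frag_of (s r X)) x \<in> S"
    and s_R: "x \<in> R \<Longrightarrow> frag_extend (\<lambda>X. frag_of (s r X)) x \<in> R"
begin

lemma act_S: "x \<in> S \<Longrightarrow> novikov_act s p x \<in> S"
  by (rule novikov_act_in[OF subS s_S])

lemma act_R: "x \<in> R \<Longrightarrow> novikov_act s p x \<in> R"
  by (rule novikov_act_in[OF subR s_R])

lemma smult_coset:
  assumes "s = sh C" "g \<in> S"
  shows "p \<odot>\<^bsub>quot_module C G R\<^esub> coset R g = coset R (novikov_act s p g)"
proof -
  have "novikov_act (sh C) p h - novikov_act (sh C) p g \<in> R" if "h - g \<in> R" for h
    using act_R[OF that] assms by (simp add: novikov_act_diff)
  then show ?thesis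
    using assms by (auto simp: quot_module_def r_coset_eq[OF frag_group] intro!: UN_coset coset_eqI[OF subR])
qed

lemma module_simps:
  assumes "s = sh C"
  shows "carrier (quot_module C G R) = coset R ` S"
    "g \<in> S \<Longrightarrow> p \<odot>\<^bsub>quot_module C G R\<^esub> coset R g = coset R (novikov_act s p g)"
    "coset R g \<oplus>\<^bsub>quot_module C G R\<^esub> coset R h = coset R (g + h)"
    "\<zero>\<^bsub>quot_module C G R\<^esub> = coset R 0"
  using smult_coset[OF assms] quot_simps by (simp_all add: quot_module_def)

lemma module_quot:
  assumes "s = sh C" shows "module Novikov (quot_module C G R)"
proof (rule moduleI)
  note simps = module_simps[OF assms]
  show "abelian_group (quot_module C G R)"
  proof (rule abelian_groupI)
    fix x assume "x \<in> carrier (quot_module C G R)"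
    then obtain g where "g \<in> S" "x = coset R g" by (auto simp: simps)
    then show "\<exists>y\<in>carrier (quot_module C G R). y \<oplus>\<^bsub>quot_module C G R\<^esub> x = \<zero>\<^bsub>quot_module C G R\<^esub>"
      by (intro bexI[of _ "coset R (- g)"]) (auto simp: simps subgroup_uminus[OF subS])
  qed (auto simp: simps subgroup_add[OF subS] subgroup_zero[OF subS] algebra_simps)
next
  note simps = module_simps[OF assms]
  fix a x assume "x \<in> carrier (quot_module C G R)"
  then obtain g where g: "g \<in> S" "x = coset R g" by (auto simp: simps)
  then show "a \<odot>\<^bsub>quot_module C G R\<^esub> x \<in> carrier (quot_module C G R)"
    by (auto simp: simps act_S)
  fix b
  show "(a \<oplus>\<^bsub>Novikov\<^esub> b) \<odot>\<^bsub>quot_module C G R\<^esub> x = a \<odot>\<^bsub>quot_module C G R\<^esub> x \<oplus>\<^bsub>quot_module C G R\<^esub> b \<odot>\<^bsub>quot_module C G R\<^esub> x"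
    using g by (simp add: simps Novikov_def novikov_act_alt frag_extend_add)
  show "(a \<otimes>\<^bsub>Novikov\<^esub> b) \<odot>\<^bsub>quot_module C G R\<^esub> x = a \<odot>\<^bsub>quot_module C G R\<^esub> (b \<odot>\<^bsub>quot_module C G R\<^esub> x)"
    using g by (simp add: simps act_S Novikov_def novikov_act_mult[OF s_add S_keys])
  have "frag_extend (\<lambda>X. frag_of (s 0 X)) g = frag_extend frag_of g"
    by (rule frag_extend_eq) (use S_keys[OF g(1)] s0 in auto)
  moreover have "novikov_act s 1 g = frag_extend (\<lambda>X. frag_of (s 0 X)) g"
    unfolding novikov_act_alt by (metis frag_extend_of single_one)
  ultimately show "\<one>\<^bsub>Novikov\<^esub> \<odot>\<^bsub>quot_module C G R\<^esub> x = x"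
    using g by (simp add: simps Novikov_def extend_of)
next
  note simps = module_simps[OF assms]
  fix a x y assume "x \<in> carrier (quot_module C G R)" "y \<in> carrier (quot_module C G R)"
  then obtain g h where gh: "g \<in> S" "x = coset R g" "h \<in> S" "y = coset R h" by (auto simp: simps)
  then show "a \<odot>\<^bsub>quot_module C G R\<^esub> (x \<oplus>\<^bsub>quot_module C G R\<^esub> y) = a \<odot>\<^bsub>quot_module C G R\<^esub> x \<oplus>\<^bsub>quot_module C G R\<^esub> a \<odot>\<^bsub>quot_module C G R\<^esub> y"
    by (simp add: simps subgroup_add[OF subS] additive_map_add[OF additive_novikov_act])
qed (rule cring_Novikov)

end

lemma quot_map_linear:
  assumes A: "novikov_quotient G S R U (sh C)" and B: "novikov_quotient G' S' R' U' (sh D)"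
    and u: "additive_map u" "\<And>x. x \<in> R \<Longrightarrow> u x \<in> R'" "\<And>x. x \<in> S \<Longrightarrow> u x \<in> S'"
    and c: "\<And>r x. x \<in> S \<Longrightarrow> u (frag_extend (\<lambda>X. frag_of (sh C r X)) x)
        - frag_extend (\<lambda>X. frag_of (sh D r X)) (u x) \<in> R'"
  shows "quot_map G' R' u \<in> linear_maps Novikov (quot_module C G R) (quot_module D G' R')"
proof -
  interpret A: novikov_quotient G S R U "sh C" by fact
  interpret B: novikov_quotient G' S' R' U' "sh D" by fact
  have map: "quot_map G' R' u (coset R g) = coset R' (u g)" if "g \<in> S" for g
    by (rule quot_map_coset[OF A.frag_quotient_axioms B.frag_quotient_axioms u(1,2) that])
  have "coset R' (u (novikov_act (sh C) p g)) = coset R' (novikov_act (sh D) p (u g))" if "g \<in> S" for p g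
    by (rule coset_eqI[OF B.subR novikov_act_commute[OF B.subR u(1) c[OF that]]])
  then show ?thesis
    unfolding linear_maps_def A.module_simps(1)[OF refl] B.module_simps(1)[OF refl]
    by (auto simp: A.module_simps(2,3)[OF refl] B.module_simps(2,3)[OF refl] map u A.act_S
        subgroup_add[OF A.subS] additive_map_add[OF u(1)])
qed

section \<open>Triangulated categories\<close>

lemma (in abelian_group) double_eq_zero: "a \<in> carrier G \<Longrightarrow> a \<oplus> a = a \<Longrightarrow> a = \<zero>"
  using add.l_cancel_one[of a a] by simp

lemma (in abelian_group) minus_eq_zero_iff: "a \<in> carrier G \<Longrightarrow> b \<in> carrier G \<Longrightarrow> a \<ominus> b = \<zero> \<longleftrightarrow> a = b"
  by (metis a_inv_closed minus_eq minus_equality minus_minus r_neg)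

context additive_category
begin

abbreviation zer :: "'o \<Rightarrow> 'o \<Rightarrow> 'm" where "zer X Y \<equiv> \<zero>\<^bsub>thom D X Y\<^esub>"

lemma zero_closed: "X \<in> tob D \<Longrightarrow> Y \<in> tob D \<Longrightarrow> zer X Y \<in> tmor D X Y"
  unfolding tmor_def by (rule abelian_monoid.zero_closed[OF abelian_group.axioms(1)[OF hom_group]])

lemma minus_closed: "X \<in> tob D \<Longrightarrow> Y \<in> tob D \<Longrightarrow> f \<in> tmor D X Y \<Longrightarrow> \<ominus>\<^bsub>thom D X Y\<^esub> f \<in> tmor D X Y"
  unfolding tmor_def by (rule abelian_group.a_inv_closed[OF hom_group])

lemma diff_closed: "X \<in> tob D \<Longrightarrow> Y \<in> tob D \<Longrightarrow> f \<in> tmor D X Y \<Longrightarrow> g \<in> tmor D X Y \<Longrightarrow>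
    f \<ominus>\<^bsub>thom D X Y\<^esub> g \<in> tmor D X Y"
  unfolding tmor_def by (rule abelian_group.minus_closed[OF hom_group])

lemma add_closed: "X \<in> tob D \<Longrightarrow> Y \<in> tob D \<Longrightarrow> f \<in> tmor D X Y \<Longrightarrow> g \<in> tmor D X Y \<Longrightarrow>
    f \<oplus>\<^bsub>thom D X Y\<^esub> g \<in> tmor D X Y"
  unfolding tmor_def by (rule abelian_monoid.a_closed[OF abelian_group.axioms(1)[OF hom_group]])

lemma diff_eq_zero_iff: "X \<in> tob D \<Longrightarrow> Y \<in> tob D \<Longrightarrow> f \<in> tmor D X Y \<Longrightarrow> g \<in> tmor D X Y \<Longrightarrow>
    f \<ominus>\<^bsub>thom D X Y\<^esub> g = zer X Y \<longleftrightarrow> f = g"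
  unfolding tmor_def by (rule abelian_group.minus_eq_zero_iff[OF hom_group])

lemma cmp_zero_left:
  assumes "X \<in> tob D" "Y \<in> tob D" "Z \<in> tob D" "g \<in> tmor D Y Z"
  shows "tcmp D X Y Z (zer X Y) g = zer X Z"
proof -
  interpret A: abelian_group "thom D X Y" using assms hom_group by blast
  interpret B: abelian_group "thom D X Z" using assms hom_group by blast
  have "tcmp D X Y Z (zer X Y \<oplus>\<^bsub>thom D X Y\<^esub> zer X Y) g = tcmp D X Y Z (zer X Y) g \<oplus>\<^bsub>thom D X Z\<^esub> tcmp D X Y Z (zer X Y) g"
    by (intro cmp_add_left assms zero_closed)
  then show ?thesis
    using B.double_eq_zero cmp_closed[OF assms(1-3) zero_closed[OF assms(1,2)] assms(4)]
    by (simp add: tmor_def)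
qed

lemma cmp_zero_right:
  assumes "X \<in> tob D" "Y \<in> tob D" "Z \<in> tob D" "f \<in> tmor D X Y"
  shows "tcmp D X Y Z f (zer Y Z) = zer X Z"
proof -
  interpret A: abelian_group "thom D Y Z" using assms hom_group by blast
  interpret B: abelian_group "thom D X Z" using assms hom_group by blast
  have "tcmp D X Y Z f (zer Y Z \<oplus>\<^bsub>thom D Y Z\<^esub> zer Y Z) = tcmp D X Y Z f (zer Y Z) \<oplus>\<^bsub>thom D X Z\<^esub> tcmp D X Y Z f (zer Y Z)"
    by (intro cmp_add_right assms zero_closed)
  then show ?thesis
    using B.double_eq_zero cmp_closed[OF assms(1-4) zero_closed[OF assms(2,3)]]
    by (simp add: tmor_def)
qed

lemma cmp_minus_left:
  assumes "X \<in> tob D" "Y \<in> tob D" "Z \<in> tob D" "f \<in> tmor D X Y" "g \<in> tmor D Y Z"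
  shows "tcmp D X Y Z (\<ominus>\<^bsub>thom D X Y\<^esub> f) g = \<ominus>\<^bsub>thom D X Z\<^esub> tcmp D X Y Z f g"
proof -
  interpret A: abelian_group "thom D X Y" using assms hom_group by blast
  interpret B: abelian_group "thom D X Z" using assms hom_group by blast
  have "tcmp D X Y Z (\<ominus>\<^bsub>thom D X Y\<^esub> f) g \<oplus>\<^bsub>thom D X Z\<^esub> tcmp D X Y Z f g = zer X Z"
    using cmp_add_left[OF assms(1-3) minus_closed[OF assms(1,2,4)] assms(4,5)]
      A.l_neg[OF assms(4)[unfolded tmor_def]] cmp_zero_left[OF assms(1-3,5)] by simp
  then show ?thesis
    using B.minus_equality cmp_closed[OF assms] cmp_closed[OF assms(1-3) minus_closed[OF assms(1,2,4)] assms(5)]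
    by (simp add: tmor_def)
qed

lemma cmp_minus_right:
  assumes "X \<in> tob D" "Y \<in> tob D" "Z \<in> tob D" "f \<in> tmor D X Y" "g \<in> tmor D Y Z"
  shows "tcmp D X Y Z f (\<ominus>\<^bsub>thom D Y Z\<^esub> g) = \<ominus>\<^bsub>thom D X Z\<^esub> tcmp D X Y Z f g"
proof -
  interpret A: abelian_group "thom D Y Z" using assms hom_group by blast
  interpret B: abelian_group "thom D X Z" using assms hom_group by blast
  have "tcmp D X Y Z f (\<ominus>\<^bsub>thom D Y Z\<^esub> g) \<oplus>\<^bsub>thom D X Z\<^esub> tcmp D X Y Z f g = zer X Z"
    using cmp_add_right[OF assms(1-4) minus_closed[OF assms(2,3,5)] assms(5)]
      A.l_neg[OF assms(5)[unfolded tmor_def]] cmp_zero_right[OF assms(1-4)] by simp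
  then show ?thesis
    using B.minus_equality cmp_closed[OF assms] cmp_closed[OF assms(1-4) minus_closed[OF assms(2,3,5)]]
    by (simp add: tmor_def)
qed

lemma cmp_diff_left:
  assumes "X \<in> tob D" "Y \<in> tob D" "Z \<in> tob D" "f \<in> tmor D X Y" "f' \<in> tmor D X Y" "g \<in> tmor D Y Z"
  shows "tcmp D X Y Z (f \<ominus>\<^bsub>thom D X Y\<^esub> f') g = tcmp D X Y Z f g \<ominus>\<^bsub>thom D X Z\<^esub> tcmp D X Y Z f' g"
  by (simp add: a_minus_def cmp_add_left cmp_minus_left minus_closed assms)

lemma cmp_diff_right:
  assumes "X \<in> tob D" "Y \<in> tob D" "Z \<in> tob D" "f \<in> tmor D X Y" "g \<in> tmor D Y Z" "g' \<in> tmor D Y Z"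
  shows "tcmp D X Y Z f (g \<ominus>\<^bsub>thom D Y Z\<^esub> g') = tcmp D X Y Z f g \<ominus>\<^bsub>thom D X Z\<^esub> tcmp D X Y Z f g'"
  by (simp add: a_minus_def cmp_add_right cmp_minus_right minus_closed assms)

lemma minus_eq_zero_iff:
  assumes "X \<in> tob D" "Y \<in> tob D" "f \<in> tmor D X Y"
  shows "\<ominus>\<^bsub>thom D X Y\<^esub> f = zer X Y \<longleftrightarrow> f = zer X Y"
proof -
  interpret A: abelian_group "thom D X Y" using assms hom_group by blast
  show ?thesis using A.add.inv_eq_1_iff assms(3) by (simp add: tmor_def)
qed

lemma is_iso_idn: "X \<in> tob D \<Longrightarrow> is_iso_in D X X (tidn D X)"
  unfolding is_iso_in_def using idn_closed idn_left by blast

end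

context triangulated_category
begin

lemma Tob_closed: "X \<in> tob D \<Longrightarrow> Tob D X \<in> tob D"
  using T_ob by (auto simp: bij_betw_def)

lemma Tob_surj: "X \<in> tob D \<Longrightarrow> \<exists>Y\<in>tob D. X = Tob D Y"
  using T_ob by (auto simp: bij_betw_def)

lemma Tmor_closed: "X \<in> tob D \<Longrightarrow> Y \<in> tob D \<Longrightarrow> f \<in> tmor D X Y \<Longrightarrow> Tmor D X Y f \<in> tmor D (Tob D X) (Tob D Y)"
  using T_mor by (auto simp: bij_betw_def)

lemma Tmor_surj: "X \<in> tob D \<Longrightarrow> Y \<in> tob D \<Longrightarrow> f \<in> tmor D (Tob D X) (Tob D Y) \<Longrightarrow> \<exists>g\<in>tmor D X Y. f = Tmor D X Y g"
  using T_mor[of X Y] by (auto simp: bij_betw_def)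

lemma Tmor_inj: "X \<in> tob D \<Longrightarrow> Y \<in> tob D \<Longrightarrow> f \<in> tmor D X Y \<Longrightarrow> g \<in> tmor D X Y \<Longrightarrow>
    Tmor D X Y f = Tmor D X Y g \<longleftrightarrow> f = g"
  using T_mor[of X Y] by (auto simp: bij_betw_def inj_on_def)

lemma Tmor_zero:
  assumes "X \<in> tob D" "Y \<in> tob D" shows "Tmor D X Y (zer X Y) = zer (Tob D X) (Tob D Y)"
proof -
  interpret A: abelian_group "thom D X Y" using assms hom_group by blast
  interpret B: abelian_group "thom D (Tob D X) (Tob D Y)" using assms hom_group Tob_closed by blast
  show ?thesis
    using T_add[OF assms zero_closed[OF assms] zero_closed[OF assms]] B.double_eq_zero
      Tmor_closed[OF assms zero_closed[OF assms]] by (simp add: tmor_def)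
qed

lemma Tmor_minus:
  assumes "X \<in> tob D" "Y \<in> tob D" "f \<in> tmor D X Y"
  shows "Tmor D X Y (\<ominus>\<^bsub>thom D X Y\<^esub> f) = \<ominus>\<^bsub>thom D (Tob D X) (Tob D Y)\<^esub> Tmor D X Y f"
proof -
  interpret A: abelian_group "thom D X Y" using assms hom_group by blast
  interpret B: abelian_group "thom D (Tob D X) (Tob D Y)" using assms hom_group Tob_closed by blast
  have "Tmor D X Y (\<ominus>\<^bsub>thom D X Y\<^esub> f) \<oplus>\<^bsub>thom D (Tob D X) (Tob D Y)\<^esub> Tmor D X Y f = zer (Tob D X) (Tob D Y)"
    using T_add[OF assms(1,2) minus_closed[OF assms] assms(3)] A.l_neg[OF assms(3)[unfolded tmor_def]]
      Tmor_zero[OF assms(1,2)] by simp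
  then show ?thesis
    using B.minus_equality Tmor_closed[OF assms] Tmor_closed[OF assms(1,2) minus_closed[OF assms]]
    by (simp add: tmor_def)
qed

lemma is_zero_object_T: "is_zero_object D Z \<Longrightarrow> is_zero_object D (Tob D Z)"
  unfolding is_zero_object_def using T_idn Tmor_zero Tob_closed by metis

lemma tri_rotate_right:
  assumes "(X, Y, Z, f, g, h) \<in> ttri D"
  shows "(Y, Z, Tob D X, g, h, \<ominus>\<^bsub>thom D (Tob D X) (Tob D Y)\<^esub> Tmor D X Y f) \<in> ttri D"
  using assms tri_typed[OF assms] tri_rotate by blast

lemma tri_zero_left:
  assumes "is_zero_object D Z" "W \<in> tob D"
  shows "(Z, W, W, zer Z W, tidn D W, zer W (Tob D Z)) \<in> ttri D"
proof -
  have Z: "Z \<in> tob D" using assms by (simp add: is_zero_object_def)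
  have "zer (Tob D Z) (Tob D W) = \<ominus>\<^bsub>thom D (Tob D Z) (Tob D W)\<^esub> Tmor D Z W (zer Z W)"
    using minus_eq_zero_iff Tmor_zero Z assms(2) Tob_closed zero_closed by metis
  then have "(W, W, Tob D Z, tidn D W, zer W (Tob D Z),
      \<ominus>\<^bsub>thom D (Tob D Z) (Tob D W)\<^esub> Tmor D Z W (zer Z W)) \<in> ttri D"
    using tri_idn[OF assms(2) is_zero_object_T[OF assms(1)]] by simp
  then show ?thesis
    using tri_rotate[of Z W W "zer Z W" "tidn D W" "zer W (Tob D Z)"] Z assms(2) zero_closed idn_closed Tob_closed
    by blast
qed

lemma tri_zero_middle:
  assumes "is_zero_object D Z" "W \<in> tob D"
  shows "\<exists>h. (W, Z, Tob D W, zer W Z, zer Z (Tob D W), h) \<in> ttri D"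
  using tri_rotate_right[OF tri_idn[OF assms(2,1)]] by blast

text \<open>Exactness of the represented functors, from completing a commutative square against a trivial triangle.\<close>

lemma tri_cmp_zero:
  assumes "(X, Y, Z, f, g, h) \<in> ttri D" shows "tcmp D X Y Z f g = zer X Z"
proof -
  note t = tri_typed[OF assms]
  obtain O0 where O: "is_zero_object D O0" using zero_object by blast
  then have O': "O0 \<in> tob D" by (simp add: is_zero_object_def)
  have X: "X \<in> tob D" using t by blast
  obtain c where "c \<in> tmor D O0 Z" "tcmp D X O0 Z (zer X O0) c = tcmp D X Y Z f g"
    using tri_fill[OF tri_idn[OF X O] assms idn_closed[OF X], of f] t idn_left by blast
  then show ?thesis using cmp_zero_left[of X O0 Z c] t O' by simp
qed

lemma tri_cmp_zero3:
  assumes "(X, Y, Z, f, g, h) \<in> ttri D"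
  shows "tcmp D Z (Tob D X) (Tob D Y) h (Tmor D X Y f) = zer Z (Tob D Y)"
  using tri_cmp_zero[OF tri_rotate_right[OF tri_rotate_right[OF assms]]] tri_typed[OF assms]
    cmp_minus_right[of Z "Tob D X" "Tob D Y" h "Tmor D X Y f"] minus_eq_zero_iff[of Z "Tob D Y"]
    Tob_closed Tmor_closed cmp_closed by metis

lemma tri_factor_out:
  assumes tri: "(X, Y, Z, f, g, h) \<in> ttri D"
    and W: "W \<in> tob D" and t: "t \<in> tmor D Y W" "tcmp D X Y W f t = zer X W"
  shows "\<exists>s\<in>tmor D Z W. t = tcmp D Y Z W g s"
proof -
  note ty = tri_typed[OF tri]
  obtain O0 where O: "is_zero_object D O0" using zero_object by blast
  then have O': "O0 \<in> tob D" by (simp add: is_zero_object_def)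
  obtain c where "c \<in> tmor D Z W" "tcmp D Y Z W g c = tcmp D Y W W t (tidn D W)"
    using tri_fill[OF tri tri_zero_left[OF O W] zero_closed[of X O0] t(1)]
      cmp_zero_right[of X O0 W "zer X O0"] zero_closed ty O' W t(2) by metis
  then show ?thesis using idn_right ty W t(1) by metis
qed

text \<open>The third map of a morphism of triangles is free to be filled in, so both triangles are rotated first; the lift is obtained
  on translates.\<close>

lemma tri_factor_in:
  assumes tri: "(X, Y, Z, f, g, h) \<in> ttri D"
    and W: "W \<in> tob D" and t: "t \<in> tmor D W Y" "tcmp D W Y Z t g = zer W Z"
  shows "\<exists>s\<in>tmor D W X. t = tcmp D W X Y s f"
proof -
  note ty = tri_typed[OF tri]
  obtain O0 where O: "is_zero_object D O0" using zero_object by blast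
  then have O': "O0 \<in> tob D" by (simp add: is_zero_object_def)
  let ?m = "\<lambda>A B. a_inv (thom D (Tob D A) (Tob D B))"
  have c: "Tob D W \<in> tob D" "Tob D X \<in> tob D" "Tob D Y \<in> tob D" using Tob_closed ty W by auto
  obtain c where c1: "c \<in> tmor D (Tob D W) (Tob D X)"
    and c2: "tcmp D (Tob D W) (Tob D W) (Tob D Y) (?m W W (Tmor D W W (tidn D W))) (Tmor D W Y t)
      = tcmp D (Tob D W) (Tob D X) (Tob D Y) c (?m X Y (Tmor D X Y f))"
    using tri_fill[OF tri_rotate_right[OF tri_idn[OF W O]] tri_rotate_right[OF tri] t(1) zero_closed[of O0 Z]]
      cmp_zero_left[of W O0 Z] zero_closed[of O0 Z] ty O' W t(2) by metis
  have "?m W Y (Tmor D W Y t) = ?m W Y (tcmp D (Tob D W) (Tob D X) (Tob D Y) c (Tmor D X Y f))"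
    using c2 cmp_minus_right[OF c(1,2,3) c1, of "Tmor D X Y f"]
      cmp_minus_left[OF c(1,1,3), of "Tmor D W W (tidn D W)" "Tmor D W Y t"]
      idn_left[OF c(1,3)] T_idn[OF W] idn_closed[OF c(1)] Tmor_closed ty W t(1) by simp
  then have eq: "Tmor D W Y t = tcmp D (Tob D W) (Tob D X) (Tob D Y) c (Tmor D X Y f)"
    using abelian_group.minus_minus[OF hom_group[OF c(1,3)]] cmp_closed[OF c c1] Tmor_closed ty W t(1)
    unfolding tmor_def by metis
  obtain s where s: "s \<in> tmor D W X" "c = Tmor D W X s" using Tmor_surj[OF W _ c1] ty by blast
  have "Tmor D W Y t = Tmor D W Y (tcmp D W X Y s f)"
    using eq s T_cmp[OF W _ _ s(1)] ty by metis
  then show ?thesis using Tmor_inj[OF W] t(1) s(1) cmp_closed[OF W] ty by metis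
qed

lemma tri_factor_in2:
  assumes tri: "(X, Y, Z, f, g, h) \<in> ttri D"
    and W: "W \<in> tob D" and t: "t \<in> tmor D W Z" "tcmp D W Z (Tob D X) t h = zer W (Tob D X)"
  shows "\<exists>s\<in>tmor D W Y. t = tcmp D W Y Z s g"
  by (rule tri_factor_in[OF tri_rotate_right[OF tri] W t])

lemma tri_factor_in3:
  assumes tri: "(X, Y, Z, f, g, h) \<in> ttri D"
    and W: "W \<in> tob D" and t: "t \<in> tmor D W (Tob D X)"
      "tcmp D W (Tob D X) (Tob D Y) t (Tmor D X Y f) = zer W (Tob D Y)"
  shows "\<exists>s\<in>tmor D W Z. t = tcmp D W Z (Tob D X) s h"
proof -
  note ty = tri_typed[OF tri]
  have "tcmp D W (Tob D X) (Tob D Y) t (\<ominus>\<^bsub>thom D (Tob D X) (Tob D Y)\<^esub> Tmor D X Y f) = zer W (Tob D Y)"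
    using t ty W Tob_closed Tmor_closed zero_closed minus_eq_zero_iff[of W "Tob D Y"] by (simp add: cmp_minus_right)
  then show ?thesis
    by (rule tri_factor_in[OF tri_rotate_right[OF tri_rotate_right[OF tri]] W t(1)])
qed

lemma tri_of_iso:
  assumes "is_iso_in D X Y f" "is_zero_object D Z"
  shows "(X, Y, Z, f, zer Y Z, zer Z (Tob D X)) \<in> ttri D"
proof -
  have X: "X \<in> tob D" and Y: "Y \<in> tob D" and f: "f \<in> tmor D X Y" using assms by (auto simp: is_iso_in_def)
  have Z: "Z \<in> tob D" using assms by (simp add: is_zero_object_def)
  show ?thesis
    by (rule tri_iso[OF tri_idn[OF X assms(2)] is_iso_idn[OF X] assms(1) is_iso_idn[OF Z] f])
      (use X Y Z f Tob_closed zero_closed T_idn in \<open>simp_all add: cmp_zero_left cmp_zero_right idn_closed\<close>)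
qed

text \<open>Two cones of the same morphism differ by a cone of an identity: the octahedron on \<open>f \<circ> id\<close>.\<close>

lemma cones_triangle:
  assumes "(X, Y, Z, f, g, h) \<in> ttri D" "(X, Y, Z', f, g', h') \<in> ttri D" "is_zero_object D O0"
  shows "\<exists>a b c. (Z, Z', O0, a, b, c) \<in> ttri D"
proof -
  have "tcmp D X Y Y f (tidn D Y) = f" "Y \<in> tob D" using tri_typed[OF assms(1)] idn_right by auto
  then show ?thesis
    using octahedral[OF assms(1) tri_idn[OF _ assms(3)], of Z' g' h'] assms(2) by metis
qed

end

subsection \<open>The relations of the Grothendieck group\<close>

definition tri_relation :: "('o, 'm, 'x) tricat \<Rightarrow> ('o \<Rightarrow>\<^sub>0 int) set"
  where "tri_relation D = {frag_of B - (frag_of A + frag_of E) | A B E. \<exists>f g h. (A, B, E, f, g, h) \<in> ttri D}"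

definition tri_objects :: "('o, 'm, 'x) tricat \<Rightarrow> bool"
  where "tri_objects D \<longleftrightarrow> (\<forall>A B E f g h. (A, B, E, f, g, h) \<in> ttri D \<longrightarrow> A \<in> tob D \<and> B \<in> tob D \<and> E \<in> tob D)"

lemma R_tri_eq: "R_tri D = generate (G_free D) (tri_relation D)"
  by (simp add: R_tri_def tri_relation_def)

lemma tri_relation_sub:
  assumes "tri_objects D" shows "tri_relation D \<subseteq> carrier (G_free D)"
proof -
  have "frag_of B - (frag_of A + frag_of E) \<in> {c. Poly_Mapping.keys c \<subseteq> tob D}"
    if "A \<in> tob D" "B \<in> tob D" "E \<in> tob D" for A B E
    using that by (intro subgroup_diff subgroup_add subgroup_keys) auto
  then show ?thesis
    using assms unfolding tri_relation_def tri_objects_def G_free_def by fastforce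
qed

lemma R_tri_carrier:
  assumes "tri_objects D" shows "R_tri D \<subseteq> {c. Poly_Mapping.keys c \<subseteq> tob D}"
  using group.generate_incl[OF group_free_Abelian_group tri_relation_sub[OF assms, unfolded G_free_def]]
  by (auto simp: R_tri_eq G_free_def dest!: subsetD)

lemma R_tri_subgroup:
  assumes "tri_objects D" shows "is_subgroup (R_tri D)"
proof -
  have sg: "subgroup (R_tri D) (free_Abelian_group (tob D))"
    using group.generate_is_subgroup[OF group_free_Abelian_group tri_relation_sub[OF assms, unfolded G_free_def]]
    by (simp add: R_tri_eq G_free_def)
  have "x - y \<in> R_tri D" if "x \<in> R_tri D" "y \<in> R_tri D" for x y
  proof -
    have "inv\<^bsub>free_Abelian_group (tob D)\<^esub> y = - y"
      using R_tri_carrier[OF assms] that by auto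
    then show ?thesis
      using subgroup.m_closed[OF sg that(1) subgroup.m_inv_closed[OF sg that(2)]] by simp
  qed
  then show ?thesis
    using subgroup.one_closed[OF sg] by (simp add: is_subgroup_def)
qed

lemma R_tri_rel: "(A, B, E, f, g, h) \<in> ttri D \<Longrightarrow> frag_of B - (frag_of A + frag_of E) \<in> R_tri D"
  unfolding R_tri_eq by (rule generate.incl) (simp add: tri_relation_def, blast)

lemma R_tri_least:
  assumes "tri_objects D" "is_subgroup H"
    and "\<And>A B E f g h. (A, B, E, f, g, h) \<in> ttri D \<Longrightarrow> frag_of B - (frag_of A + frag_of E) \<in> H"
  shows "R_tri D \<subseteq> H"
proof
  fix x assume "x \<in> R_tri D"
  then have "x \<in> generate (free_Abelian_group (tob D)) (tri_relation D)"
    by (simp add: R_tri_eq G_free_def)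
  then show "x \<in> H"
  proof (induction rule: generate.induct)
    case one
    then show ?case using subgroup_zero[OF assms(2)] by simp
  next
    case (incl h)
    then show ?case using assms(3) by (auto simp: tri_relation_def)
  next
    case (inv h)
    then have "h \<in> H" using assms(3) by (auto simp: tri_relation_def)
    moreover have "Poly_Mapping.keys h \<subseteq> tob D"
      using subsetD[OF tri_relation_sub[OF assms(1)] inv] by (simp add: G_free_def)
    ultimately show ?case using subgroup_uminus[OF assms(2)] by simp
  next
    case (eng h1 h2)
    then show ?case using subgroup_add[OF assms(2)] by simp
  qed
qed

lemma R_tri_cong: "tob D = tob D' \<Longrightarrow> tri_relation D = tri_relation D' \<Longrightarrow> R_tri D = R_tri D'"
  by (simp add: R_tri_eq G_free_def)

text \<open>To respect the relations it is enough to respect each triangle, because the preimage of a subgroup is a subgroup.\<close>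

lemma R_tri_map:
  assumes "tri_objects D" "is_subgroup H" "additive_map u"
    and "\<And>A B E f g h. (A, B, E, f, g, h) \<in> ttri D \<Longrightarrow> u (frag_of B) - (u (frag_of A) + u (frag_of E)) \<in> H"
    and "x \<in> R_tri D"
  shows "u x \<in> H"
proof -
  have "R_tri D \<subseteq> u -` H"
    by (rule R_tri_least[OF assms(1) subgroup_vimage[OF assms(3,2)]])
      (auto simp: additive_map_diff[OF assms(3)] additive_map_add[OF assms(3)] intro: assms(4))
  then show ?thesis using assms(5) by auto
qed

lemma (in triangulated_category) tri_objects: "tri_objects D"
  using tri_typed by (auto simp: tri_objects_def)

lemma tri_objects_full: "tri_objects (full_tri_sub D S)"
  by (auto simp: tri_objects_def full_tri_sub_def)

lemma G_free_frag_group: "frag_group (G_free D) {c. Poly_Mapping.keys c \<subseteq> tob D}"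
  by (simp add: G_free_def frag_group_free)

section \<open>Persistence categories\<close>

lemma linear_maps_closed: "f \<in> linear_maps R M N \<Longrightarrow> x \<in> carrier M \<Longrightarrow> f x \<in> carrier N"
  by (auto simp: linear_maps_def)

lemma linear_maps_add: "f \<in> linear_maps R M N \<Longrightarrow> x \<in> carrier M \<Longrightarrow> y \<in> carrier M \<Longrightarrow>
    f (x \<oplus>\<^bsub>M\<^esub> y) = f x \<oplus>\<^bsub>N\<^esub> f y"
  by (simp add: linear_maps_def)

lemma linear_maps_zero:
  assumes "module k M" "module k N" "f \<in> linear_maps k M N" shows "f \<zero>\<^bsub>M\<^esub> = \<zero>\<^bsub>N\<^esub>"
proof -
  interpret M: abelian_group M by (rule module.axioms(2)[OF assms(1)])
  interpret N: abelian_group N by (rule module.axioms(2)[OF assms(2)])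
  show ?thesis
    using linear_maps_add[OF assms(3) M.zero_closed M.zero_closed]
      N.double_eq_zero[OF linear_maps_closed[OF assms(3) M.zero_closed]] by simp
qed

lemma linear_maps_diff:
  assumes "module k M" "module k N" "f \<in> linear_maps k M N" "x \<in> carrier M" "y \<in> carrier M"
  shows "f (x \<ominus>\<^bsub>M\<^esub> y) = f x \<ominus>\<^bsub>N\<^esub> f y"
proof -
  interpret M: abelian_group M by (rule module.axioms(2)[OF assms(1)])
  interpret N: abelian_group N by (rule module.axioms(2)[OF assms(2)])
  have y: "\<ominus>\<^bsub>M\<^esub> y \<in> carrier M" using assms by simp
  note cl = linear_maps_closed[OF assms(3)]
  have "f (\<ominus>\<^bsub>M\<^esub> y) = \<ominus>\<^bsub>N\<^esub> f y"
    using linear_maps_add[OF assms(3) y assms(5)] linear_maps_zero[OF assms(1-3)] M.l_neg[OF assms(5)]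
      N.minus_equality[OF _ cl[OF assms(5)] cl[OF y]] by simp
  then show ?thesis
    using linear_maps_add[OF assms(3,4) y] by (simp add: M.minus_eq N.minus_eq)
qed

text \<open>A null morphism is one whose class in \<open>C\<^sub>\<infinity>\<close> vanishes.\<close>

definition null :: "('k, 'o, 'm) tpc \<Rightarrow> real \<Rightarrow> 'o \<Rightarrow> 'o \<Rightarrow> 'm \<Rightarrow> bool"
  where "null C s A B f \<longleftrightarrow> f \<in> mor C s A B \<and> (\<exists>t\<ge>s. inc C s t A B f = \<zero>\<^bsub>Hom C t A B\<^esub>)"

context persistence_category
begin

abbreviation zr :: "real \<Rightarrow> 'o \<Rightarrow> 'o \<Rightarrow> 'm" where "zr s A B \<equiv> \<zero>\<^bsub>Hom C s A B\<^esub>"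

lemma hom_module: "A \<in> Ob C \<Longrightarrow> B \<in> Ob C \<Longrightarrow> module k (Hom C s A B)"
  using persistence_module.module[OF hom_persistence] .

lemma hom_abelian: "A \<in> Ob C \<Longrightarrow> B \<in> Ob C \<Longrightarrow> abelian_group (Hom C s A B)"
  using module.axioms(2)[OF hom_module] .

lemma zero_mor: "A \<in> Ob C \<Longrightarrow> B \<in> Ob C \<Longrightarrow> zr s A B \<in> mor C s A B"
  unfolding mor_def by (rule abelian_monoid.zero_closed[OF abelian_group.axioms(1)[OF hom_abelian]])

lemma diff_mor: "A \<in> Ob C \<Longrightarrow> B \<in> Ob C \<Longrightarrow> f \<in> mor C s A B \<Longrightarrow> g \<in> mor C s A B \<Longrightarrow>
    f \<ominus>\<^bsub>Hom C s A B\<^esub> g \<in> mor C s A B"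
  unfolding mor_def by (rule abelian_group.minus_closed[OF hom_abelian])

lemma diff_mor_zero: "A \<in> Ob C \<Longrightarrow> B \<in> Ob C \<Longrightarrow> f \<in> mor C s A B \<Longrightarrow> g \<in> mor C s A B \<Longrightarrow>
    f \<ominus>\<^bsub>Hom C s A B\<^esub> g = zr s A B \<longleftrightarrow> f = g"
  unfolding mor_def by (rule abelian_group.minus_eq_zero_iff[OF hom_abelian])

lemma cmp_mor:
  assumes "A \<in> Ob C" "B \<in> Ob C" "E \<in> Ob C" "f \<in> mor C r A B" "g \<in> mor C s B E" "r + s = t"
  shows "cmp C r s A B E f g \<in> mor C t A E"
  using linear_maps_closed[OF cmp_linear_left[OF assms(1-3,5)]] assms(4,6) unfolding mor_def by blast

lemma cmp_zr_left:
  assumes "A \<in> Ob C" "B \<in> Ob C" "E \<in> Ob C" "g \<in> mor C s B E"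
  shows "cmp C r s A B E (zr r A B) g = zr (r + s) A E"
  using linear_maps_zero[OF hom_module[OF assms(1,2)] hom_module[OF assms(1,3)] cmp_linear_left[OF assms]] .

lemma cmp_zr_right:
  assumes "A \<in> Ob C" "B \<in> Ob C" "E \<in> Ob C" "f \<in> mor C r A B"
  shows "cmp C r s A B E f (zr s B E) = zr (r + s) A E"
  using linear_maps_zero[OF hom_module[OF assms(2,3)] hom_module[OF assms(1,3)] cmp_linear_right[OF assms]] .

lemma cmp_diff_left:
  assumes "A \<in> Ob C" "B \<in> Ob C" "E \<in> Ob C" "f \<in> mor C r A B" "f' \<in> mor C r A B" "g \<in> mor C s B E"
  shows "cmp C r s A B E (f \<ominus>\<^bsub>Hom C r A B\<^esub> f') g
    = cmp C r s A B E f g \<ominus>\<^bsub>Hom C (r + s) A E\<^esub> cmp C r s A B E f' g"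
  using linear_maps_diff[OF hom_module[OF assms(1,2)] hom_module[OF assms(1,3)] cmp_linear_left[OF assms(1-3,6)]
      assms(4,5)[unfolded mor_def]] .

lemma cmp_diff_right:
  assumes "A \<in> Ob C" "B \<in> Ob C" "E \<in> Ob C" "f \<in> mor C r A B" "g \<in> mor C s B E" "g' \<in> mor C s B E"
  shows "cmp C r s A B E f (g \<ominus>\<^bsub>Hom C s B E\<^esub> g')
    = cmp C r s A B E f g \<ominus>\<^bsub>Hom C (r + s) A E\<^esub> cmp C r s A B E f g'"
  using linear_maps_diff[OF hom_module[OF assms(2,3)] hom_module[OF assms(1,3)] cmp_linear_right[OF assms(1-4)]
      assms(5,6)[unfolded mor_def]] .

lemma inc_linear: "A \<in> Ob C \<Longrightarrow> B \<in> Ob C \<Longrightarrow> s \<le> t \<Longrightarrow> inc C s t A B \<in> linear_maps k (Hom C s A B) (Hom C t A B)"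
  using persistence_module.linear[OF hom_persistence] .

lemma inc_mor: "A \<in> Ob C \<Longrightarrow> B \<in> Ob C \<Longrightarrow> s \<le> t \<Longrightarrow> f \<in> mor C s A B \<Longrightarrow> inc C s t A B f \<in> mor C t A B"
  using linear_maps_closed[OF inc_linear] unfolding mor_def .

lemma inc_zr: "A \<in> Ob C \<Longrightarrow> B \<in> Ob C \<Longrightarrow> s \<le> t \<Longrightarrow> inc C s t A B (zr s A B) = zr t A B"
  by (rule linear_maps_zero[OF hom_module hom_module inc_linear])

lemma inc_diff: "A \<in> Ob C \<Longrightarrow> B \<in> Ob C \<Longrightarrow> s \<le> t \<Longrightarrow> f \<in> mor C s A B \<Longrightarrow> g \<in> mor C s A B \<Longrightarrow>
    inc C s t A B (f \<ominus>\<^bsub>Hom C s A B\<^esub> g) = inc C s t A B f \<ominus>\<^bsub>Hom C t A B\<^esub> inc C s t A B g"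
  unfolding mor_def by (rule linear_maps_diff[OF hom_module hom_module inc_linear])

lemma inc_refl: "A \<in> Ob C \<Longrightarrow> B \<in> Ob C \<Longrightarrow> f \<in> mor C s A B \<Longrightarrow> inc C s s A B f = f"
  unfolding mor_def using persistence_module.refl[OF hom_persistence] .

lemma inc_trans: "A \<in> Ob C \<Longrightarrow> B \<in> Ob C \<Longrightarrow> s \<le> t \<Longrightarrow> t \<le> r \<Longrightarrow> f \<in> mor C s A B \<Longrightarrow>
    inc C t r A B (inc C s t A B f) = inc C s r A B f"
  unfolding mor_def using persistence_module.trans[OF hom_persistence] .

lemma inc_cmp_left:
  assumes "A \<in> Ob C" "B \<in> Ob C" "E \<in> Ob C" "f \<in> mor C r A B" "g \<in> mor C s B E" "r \<le> r'"
  shows "cmp C r' s A B E (inc C r r' A B f) g = inc C (r + s) (r' + s) A E (cmp C r s A B E f g)"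
  using cmp_inc[OF assms order_refl] inc_refl[OF assms(2,3,5)] by simp

lemma inc_cmp_right:
  assumes "A \<in> Ob C" "B \<in> Ob C" "E \<in> Ob C" "f \<in> mor C r A B" "g \<in> mor C s B E" "s \<le> s'"
  shows "cmp C r s' A B E f (inc C s s' B E g) = inc C (r + s) (r + s') A E (cmp C r s A B E f g)"
  using cmp_inc[OF assms(1-5) order_refl assms(6)] inc_refl[OF assms(1,2,4)] by simp

subsection \<open>Morphisms that die in the colimit\<close>

lemma null_cmp_left:
  assumes "A \<in> Ob C" "B \<in> Ob C" "E \<in> Ob C" "null C r A B f" "g \<in> mor C s B E"
  shows "null C (r + s) A E (cmp C r s A B E f g)"
proof -
  obtain t where t: "r \<le> t" "inc C r t A B f = zr t A B" and f: "f \<in> mor C r A B"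
    using assms(4) by (auto simp: null_def)
  then have "inc C (r + s) (t + s) A E (cmp C r s A B E f g) = zr (t + s) A E"
    using inc_cmp_left[OF assms(1-3) f assms(5) t(1)] cmp_zr_left[OF assms(1-3,5)] by simp
  then show ?thesis
    unfolding null_def using t(1) cmp_mor[OF assms(1-3) f assms(5) refl] by (intro conjI exI[of _ "t + s"]) auto
qed

lemma null_cmp_right:
  assumes "A \<in> Ob C" "B \<in> Ob C" "E \<in> Ob C" "f \<in> mor C r A B" "null C s B E g"
  shows "null C (r + s) A E (cmp C r s A B E f g)"
proof -
  obtain t where t: "s \<le> t" "inc C s t B E g = zr t B E" and g: "g \<in> mor C s B E"
    using assms(5) by (auto simp: null_def)
  then have "inc C (r + s) (r + t) A E (cmp C r s A B E f g) = zr (r + t) A E"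
    using inc_cmp_right[OF assms(1-4) g t(1)] cmp_zr_right[OF assms(1-4)] by simp
  then show ?thesis
    unfolding null_def using t(1) cmp_mor[OF assms(1-4) g refl] by (intro conjI exI[of _ "r + t"]) auto
qed

lemma null_inc_iff:
  assumes "A \<in> Ob C" "B \<in> Ob C" "f \<in> mor C s A B" "s \<le> t"
  shows "null C t A B (inc C s t A B f) \<longleftrightarrow> null C s A B f"
proof
  assume "null C t A B (inc C s t A B f)"
  then obtain r where "t \<le> r" "inc C t r A B (inc C s t A B f) = zr r A B" by (auto simp: null_def)
  then show "null C s A B f"
    unfolding null_def using assms inc_trans[OF assms(1,2,4) _ assms(3), of r]
    by (intro conjI exI[of _ r]) auto
next
  assume "null C s A B f"
  then obtain r where r: "s \<le> r" "inc C s r A B f = zr r A B" by (auto simp: null_def)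
  let ?m = "max r t"
  have "inc C s ?m A B f = zr ?m A B"
    using inc_trans[OF assms(1,2) r(1) _ assms(3), of ?m] r(2) inc_zr[OF assms(1,2), of r ?m] by simp
  then show "null C t A B (inc C s t A B f)"
    unfolding null_def using assms inc_trans[OF assms(1,2,4) _ assms(3), of ?m] inc_mor[OF assms(1,2,4,3)]
    by (intro conjI exI[of _ ?m]) auto
qed

lemma null_zr: "A \<in> Ob C \<Longrightarrow> B \<in> Ob C \<Longrightarrow> null C s A B (zr s A B)"
  unfolding null_def using zero_mor inc_refl by blast

lemma acyclics_iff: "Q \<in> acyclics C \<longleftrightarrow> Q \<in> Ob C \<and> null C 0 Q Q (idn C Q)"
  using idn_closed by (auto simp: acyclics_def acyclic_of_def null_def)

lemma acyclics_Ob: "Q \<in> acyclics C \<Longrightarrow> Q \<in> Ob C"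
  by (simp add: acyclics_iff)

text \<open>Composing with the null identity of an acyclic object makes every morphism from it or to it null.\<close>

lemma null_from_acyclic: "Q \<in> acyclics C \<Longrightarrow> B \<in> Ob C \<Longrightarrow> f \<in> mor C s Q B \<Longrightarrow> null C s Q B f"
  using null_cmp_left[of Q Q B 0 "idn C Q" f s] idn_left[of Q B f s] by (simp add: acyclics_iff)

lemma null_to_acyclic: "Q \<in> acyclics C \<Longrightarrow> A \<in> Ob C \<Longrightarrow> f \<in> mor C s A Q \<Longrightarrow> null C s A Q f"
  using null_cmp_right[of A Q Q f s 0 "idn C Q"] idn_right[of A Q f s] by (simp add: acyclics_iff)

subsection \<open>The colimit category\<close>

lemma equiv_colim:
  assumes "A \<in> Ob C" "B \<in> Ob C" shows "equiv (colim_pairs C A B) (colim_rel C A B)"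
proof (rule equivI)
  show "colim_rel C A B \<subseteq> colim_pairs C A B \<times> colim_pairs C A B"
    by (auto simp: colim_rel_def colim_pairs_def)
  show "refl_on (colim_pairs C A B) (colim_rel C A B)"
    by (auto simp: refl_on_def colim_rel_def colim_pairs_def)
  show "sym (colim_rel C A B)"
    unfolding sym_def colim_rel_def by force
  show "trans (colim_rel C A B)"
  proof (rule transI, clarsimp simp: colim_rel_def)
    fix \<alpha> f \<beta> g \<delta> h \<gamma> \<gamma>'
    assume m: "f \<in> mor C \<alpha> A B" "g \<in> mor C \<beta> A B" "h \<in> mor C \<delta> A B"
      and 1: "\<alpha> \<le> \<gamma>" "\<beta> \<le> \<gamma>" "inc C \<alpha> \<gamma> A B f = inc C \<beta> \<gamma> A B g"
      and 2: "\<beta> \<le> \<gamma>'" "\<delta> \<le> \<gamma>'" "inc C \<beta> \<gamma>' A B g = inc C \<delta> \<gamma>' A B h"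
    let ?m = "max \<gamma> \<gamma>'"
    have "inc C \<alpha> ?m A B f = inc C \<beta> ?m A B g"
      using inc_trans[OF assms 1(1) _ m(1), of ?m] inc_trans[OF assms 1(2) _ m(2), of ?m] 1(3) by simp
    moreover have "inc C \<beta> ?m A B g = inc C \<delta> ?m A B h"
      using inc_trans[OF assms 2(1) _ m(2), of ?m] inc_trans[OF assms 2(2) _ m(3), of ?m] 2(3) by simp
    ultimately show "\<exists>\<gamma>. \<alpha> \<le> \<gamma> \<and> \<delta> \<le> \<gamma> \<and> inc C \<alpha> \<gamma> A B f = inc C \<delta> \<gamma> A B h"
      using 1 2 by (intro exI[of _ ?m]) auto
  qed
qed

lemma colim_class_eq_iff:
  assumes "A \<in> Ob C" "B \<in> Ob C" "f \<in> mor C \<alpha> A B" "g \<in> mor C \<beta> A B"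
  shows "colim_class C A B \<alpha> f = colim_class C A B \<beta> g \<longleftrightarrow>
    (\<exists>\<gamma>. \<alpha> \<le> \<gamma> \<and> \<beta> \<le> \<gamma> \<and> inc C \<alpha> \<gamma> A B f = inc C \<beta> \<gamma> A B g)"
  unfolding colim_class_def
  by (subst eq_equiv_class_iff[OF equiv_colim[OF assms(1,2)]]) (use assms in \<open>auto simp: colim_pairs_def colim_rel_def\<close>)

lemma colim_class_eq_null:
  assumes "A \<in> Ob C" "B \<in> Ob C" "f \<in> mor C \<alpha> A B" "g \<in> mor C \<alpha> A B"
  shows "colim_class C A B \<alpha> f = colim_class C A B \<alpha> g \<longleftrightarrow> null C \<alpha> A B (f \<ominus>\<^bsub>Hom C \<alpha> A B\<^esub> g)"
proof -
  have "inc C \<alpha> \<gamma> A B f = inc C \<alpha> \<gamma> A B g \<longleftrightarrow> inc C \<alpha> \<gamma> A B (f \<ominus>\<^bsub>Hom C \<alpha> A B\<^esub> g) = zr \<gamma> A B"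
    if "\<alpha> \<le> \<gamma>" for \<gamma>
    using inc_diff[OF assms(1,2) that assms(3,4)] diff_mor_zero[OF assms(1,2) inc_mor inc_mor] assms that by simp
  then show ?thesis
    unfolding colim_class_eq_iff[OF assms] null_def using diff_mor[OF assms] by auto
qed

lemma colim_class_inc:
  assumes "A \<in> Ob C" "B \<in> Ob C" "f \<in> mor C \<alpha> A B" "\<alpha> \<le> \<beta>"
  shows "colim_class C A B \<beta> (inc C \<alpha> \<beta> A B f) = colim_class C A B \<alpha> f"
  using inc_refl[OF assms(1,2) inc_mor[OF assms(1,2,4,3)]] assms
  by (subst colim_class_eq_iff) (auto simp: inc_mor)

lemma colim_carrier: "x \<in> carrier (colim_hom C A B) \<longleftrightarrow> (\<exists>\<alpha>. \<exists>f\<in>mor C \<alpha> A B. x = colim_class C A B \<alpha> f)"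
  by (auto simp: colim_hom_def quotient_def colim_pairs_def colim_class_def)

lemma mem_colim_class:
  "(\<beta>, g) \<in> colim_class C A B \<alpha> f \<longleftrightarrow> ((\<alpha>, f), (\<beta>, g)) \<in> colim_rel C A B"
  by (simp add: colim_class_def)

lemma colim_cmp_class:
  assumes "A \<in> Ob C" "B \<in> Ob C" "E \<in> Ob C" "f \<in> mor C \<alpha> A B" "g \<in> mor C \<beta> B E"
  shows "colim_cmp C A B E (colim_class C A B \<alpha> f) (colim_class C B E \<beta> g)
    = colim_class C A E (\<alpha> + \<beta>) (cmp C \<alpha> \<beta> A B E f g)"
proof -
  have self: "(\<alpha>, f) \<in> colim_class C A B \<alpha> f" "(\<beta>, g) \<in> colim_class C B E \<beta> g"
    using assms by (auto simp: mem_colim_class colim_rel_def)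
  have "colim_class C A E (\<alpha>' + \<beta>') (cmp C \<alpha>' \<beta>' A B E f' g') = colim_class C A E (\<alpha> + \<beta>) (cmp C \<alpha> \<beta> A B E f g)"
    if "(\<alpha>', f') \<in> colim_class C A B \<alpha> f" "(\<beta>', g') \<in> colim_class C B E \<beta> g" for \<alpha>' f' \<beta>' g'
  proof -
    from that obtain \<gamma> \<delta> where m: "f' \<in> mor C \<alpha>' A B" "g' \<in> mor C \<beta>' B E"
      and 1: "\<alpha> \<le> \<gamma>" "\<alpha>' \<le> \<gamma>" "inc C \<alpha> \<gamma> A B f = inc C \<alpha>' \<gamma> A B f'"
      and 2: "\<beta> \<le> \<delta>" "\<beta>' \<le> \<delta>" "inc C \<beta> \<delta> B E g = inc C \<beta>' \<delta> B E g'"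
      by (auto simp: mem_colim_class colim_rel_def)
    have "inc C (\<alpha>' + \<beta>') (\<gamma> + \<delta>) A E (cmp C \<alpha>' \<beta>' A B E f' g') = inc C (\<alpha> + \<beta>) (\<gamma> + \<delta>) A E (cmp C \<alpha> \<beta> A B E f g)"
      using cmp_inc[OF assms(1-5) 1(1) 2(1)] cmp_inc[OF assms(1-3) m 1(2) 2(2)] 1(3) 2(3) by simp
    then show ?thesis
      using 1 2 cmp_mor[OF assms(1-5) refl] cmp_mor[OF assms(1-3) m refl] assms
      by (subst colim_class_eq_iff) (auto intro!: exI[of _ "\<gamma> + \<delta>"])
  qed
  note eq = this
  show ?thesis unfolding colim_cmp_def
  proof (rule Set.set_eqI, rule iffI)
    fix x assume "x \<in> (\<Union>(\<alpha>, f)\<in>colim_class C A B \<alpha> f. \<Union>(\<beta>, g)\<in>colim_class C B E \<beta> g.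
      colim_class C A E (\<alpha> + \<beta>) (cmp C \<alpha> \<beta> A B E f g))"
    then show "x \<in> colim_class C A E (\<alpha> + \<beta>) (cmp C \<alpha> \<beta> A B E f g)"
      using eq by fastforce
  qed (use self in fastforce)
qed

text \<open>An isomorphism of \<open>C\<^sub>\<infinity>\<close> is represented by morphisms of finite degree that become mutually inverse in
  sufficiently high degrees.\<close>

lemma colim_iso_data:
  assumes "is_iso_in (C_inf_cat C) A B x"
  shows "A \<in> Ob C \<and> B \<in> Ob C \<and> (\<exists>\<alpha> \<beta> \<gamma> \<delta>. \<exists>f\<in>mor C \<alpha> A B. \<exists>g\<in>mor C \<beta> B A.
    \<alpha> + \<beta> \<le> \<gamma> \<and> 0 \<le> \<gamma> \<and> inc C (\<alpha> + \<beta>) \<gamma> A A (cmp C \<alpha> \<beta> A B A f g) = inc C 0 \<gamma> A A (idn C A) \<and>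
    \<beta> + \<alpha> \<le> \<delta> \<and> 0 \<le> \<delta> \<and> inc C (\<beta> + \<alpha>) \<delta> B B (cmp C \<beta> \<alpha> B A B g f) = inc C 0 \<delta> B B (idn C B))"
proof -
  from assms obtain y where AB: "A \<in> Ob C" "B \<in> Ob C" and "x \<in> carrier (colim_hom C A B)"
    "y \<in> carrier (colim_hom C B A)"
    and xy: "colim_cmp C A B A x y = colim_class C A A 0 (idn C A)"
      "colim_cmp C B A B y x = colim_class C B B 0 (idn C B)"
    unfolding is_iso_in_def C_inf_cat_def tmor_def by auto
  then obtain \<alpha> f \<beta> g where f: "f \<in> mor C \<alpha> A B" "x = colim_class C A B \<alpha> f"
    and g: "g \<in> mor C \<beta> B A" "y = colim_class C B A \<beta> g"
    unfolding colim_carrier by blast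
  have "colim_class C A A (\<alpha> + \<beta>) (cmp C \<alpha> \<beta> A B A f g) = colim_class C A A 0 (idn C A)"
    "colim_class C B B (\<beta> + \<alpha>) (cmp C \<beta> \<alpha> B A B g f) = colim_class C B B 0 (idn C B)"
    using xy f g AB by (simp_all add: colim_cmp_class)
  then show ?thesis
    using f(1) g(1) AB
      colim_class_eq_iff[OF AB(1,1) cmp_mor[OF AB(1,2,1) f(1) g(1) refl] idn_closed[OF AB(1)]]
      colim_class_eq_iff[OF AB(2,2) cmp_mor[OF AB(2,1,2) g(1) f(1) refl] idn_closed[OF AB(2)]]
    by blast
qed

lemma colim_iso_idn:
  assumes "A \<in> Ob C" shows "is_iso_in (C_inf_cat C) A A (colim_class C A A 0 (idn C A))"
proof -
  have "colim_class C A A 0 (idn C A) \<in> carrier (colim_hom C A A)"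
    using assms idn_closed by (auto simp: colim_carrier)
  moreover have "colim_cmp C A A A (colim_class C A A 0 (idn C A)) (colim_class C A A 0 (idn C A)) = colim_class C A A 0 (idn C A)"
    using assms by (simp add: colim_cmp_class idn_closed idn_left)
  ultimately show ?thesis
    using assms unfolding is_iso_in_def C_inf_cat_def tmor_def by auto
qed

text \<open>All morphisms between acyclic objects vanish in \<open>C\<^sub>\<infinity>\<close>, so the zero morphism is inverse to the zero morphism.\<close>

lemma colim_iso_acyclic:
  assumes "A \<in> acyclics C" "B \<in> acyclics C"
  shows "is_iso_in (C_inf_cat C) A B (colim_class C A B 0 (zr 0 A B))"
proof -
  have z: "colim_class C X X 0 (zr 0 X X) = colim_class C X X 0 (idn C X)" if X: "X \<in> acyclics C" for X
  proof -
    note Ob = acyclics_Ob[OF X]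
    show ?thesis
      using null_from_acyclic[OF X Ob diff_mor[OF Ob Ob zero_mor[OF Ob Ob] idn_closed[OF Ob]]]
      by (subst colim_class_eq_null) (auto simp: Ob zero_mor idn_closed)
  qed
  have Ob: "A \<in> Ob C" "B \<in> Ob C" using assms acyclics_Ob by auto
  have "colim_class C X Y 0 (zr 0 X Y) \<in> carrier (colim_hom C X Y)" if "X \<in> Ob C" "Y \<in> Ob C" for X Y
    using zero_mor[OF that] unfolding colim_carrier by blast
  then show ?thesis
    using z assms Ob zero_mor cmp_zr_left[of _ _ _ _ 0 0]
    unfolding is_iso_in_def C_inf_cat_def tmor_def
    by (auto simp: colim_cmp_class intro!: bexI[of _ "colim_class C B A 0 (zr 0 B A)"])
qed

end

section \<open>Triangulated persistence categories\<close>

lemma C_zero_simps [simp]: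
  "tob (C_zero C) = Ob C" "thom (C_zero C) = Hom C 0" "tcmp (C_zero C) = cmp C 0 0" "tidn (C_zero C) = idn C"
  "Tob (C_zero C) = Tr C" "Tmor (C_zero C) = Trm C" "ttri (C_zero C) = Tri C" "tmor (C_zero C) A B = mor C 0 A B"
  by (simp_all add: C_zero_def tmor_def mor_def)

context shifted_persistence_category
begin

lemma sh_Ob: "X \<in> Ob C \<Longrightarrow> sh C r X \<in> Ob C"
  using shift_functor[of r] by (auto simp: persistence_functor_def)

lemma shift_mor: "X \<in> Ob C \<Longrightarrow> Y \<in> Ob C \<Longrightarrow> f \<in> mor C s X Y \<Longrightarrow> fmor (shift C r) s X Y f \<in> mor C s (sh C r X) (sh C r Y)"
  using shift_functor[of r] unfolding persistence_functor_def linear_maps_def mor_def by blast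

lemma shift_inc: "X \<in> Ob C \<Longrightarrow> Y \<in> Ob C \<Longrightarrow> f \<in> mor C s X Y \<Longrightarrow> s \<le> t \<Longrightarrow>
    fmor (shift C r) t X Y (inc C s t X Y f) = inc C s t (sh C r X) (sh C r Y) (fmor (shift C r) s X Y f)"
  using shift_functor[of r] unfolding persistence_functor_def by blast

lemma eta_from: "W \<in> Ob C \<Longrightarrow> eta C 0 s W \<in> mor C s W (sh C s W)"
  using eta_closed[of W 0 s] by (simp add: shift_0_ob)

lemma eta_to: "W \<in> Ob C \<Longrightarrow> eta C s 0 W \<in> mor C (- s) (sh C s W) W"
  using eta_closed[of W s 0] by (simp add: shift_0_ob)

lemma eta_from_to: "W \<in> Ob C \<Longrightarrow> cmp C s (- s) W (sh C s W) W (eta C 0 s W) (eta C s 0 W) = idn C W"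
  using eta_trans[of W s 0 0] eta_refl[of W 0] by (simp add: shift_0_ob)

lemma eta_to_from: "W \<in> Ob C \<Longrightarrow> cmp C (- s) s (sh C s W) W (sh C s W) (eta C s 0 W) (eta C 0 s W) = idn C (sh C s W)"
  using eta_trans[of W 0 s s] eta_refl[of W s] by (simp add: shift_0_ob)

lemma cmp_eta_from_to:
  assumes "X \<in> Ob C" "W \<in> Ob C" "f \<in> mor C r X W"
  shows "cmp C (r + s) (- s) X (sh C s W) W (cmp C r s X W (sh C s W) f (eta C 0 s W)) (eta C s 0 W) = f"
  using cmp_assoc[OF assms(1,2) sh_Ob[OF assms(2)] assms(2,3) eta_from[OF assms(2)] eta_to[OF assms(2)], of s]
    idn_right[OF assms] by (simp add: eta_from_to assms)

lemma eta_from_to_cmp: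
  assumes "X \<in> Ob C" "W \<in> Ob C" "f \<in> mor C r W X"
  shows "cmp C s (r - s) W (sh C s W) X (eta C 0 s W) (cmp C (- s) r (sh C s W) W X (eta C s 0 W) f) = f"
  using cmp_assoc[OF assms(2) sh_Ob[OF assms(2)] assms(2,1) eta_from[OF assms(2)] eta_to[OF assms(2)] assms(3), of s]
    idn_left[OF assms(2,1,3)] by (simp add: eta_from_to assms)

lemma eta_to_from_cmp:
  assumes "X \<in> Ob C" "W \<in> Ob C" "f \<in> mor C r (sh C s W) X"
  shows "cmp C (- s) (s + r) (sh C s W) W X (eta C s 0 W) (cmp C s r W (sh C s W) X (eta C 0 s W) f) = f"
  using cmp_assoc[OF sh_Ob[OF assms(2)] assms(2) sh_Ob[OF assms(2)] assms(1) eta_to[OF assms(2)] eta_from[OF assms(2)] assms(3), of s]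
    idn_left[OF sh_Ob[OF assms(2)] assms(1,3)] by (simp add: eta_to_from assms)

lemma eta_map_mor: "X \<in> Ob C \<Longrightarrow> r \<ge> 0 \<Longrightarrow> eta_map C r X \<in> mor C 0 (sh C r X) X"
  unfolding eta_map_def using inc_mor[OF sh_Ob _ _ eta_to] by simp

lemma eta_map_cmp:
  assumes "X \<in> Ob C" "Y \<in> Ob C" "f \<in> mor C s X Y" "r \<ge> 0"
  shows "cmp C 0 s (sh C r X) X Y (eta_map C r X) f
    = cmp C (- r) (s + r) (sh C r X) X Y (eta C r 0 X) (inc C s (s + r) X Y f)"
  using assms inc_cmp_left[OF sh_Ob assms(1,2) eta_to assms(3), of "r" 0 ] 
    inc_cmp_right[OF sh_Ob assms(1,2) eta_to assms(3), of "s + r" r]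
  by (simp add: eta_map_def)

text \<open>\<open>\<eta>\<^sub>r\<^sup>X\<close> is \<open>i\<^sub>0\<^sub>,\<^sub>r\<close> in disguise, under \<open>hom\<^sup>s(\<Sigma>\<^sup>rX, Y) = hom\<^sup>s\<^sup>+\<^sup>r(X, Y)\<close>.\<close>

lemma eta_map_cmp_zero_iff:
  assumes "X \<in> Ob C" "Y \<in> Ob C" "f \<in> mor C s X Y" "r \<ge> 0"
  shows "cmp C 0 s (sh C r X) X Y (eta_map C r X) f = zr s (sh C r X) Y \<longleftrightarrow> inc C s (s + r) X Y f = zr (s + r) X Y"
proof -
  have i: "inc C s (s + r) X Y f \<in> mor C (s + r) X Y"
    using assms by (intro inc_mor) auto
  show ?thesis
    unfolding eta_map_cmp[OF assms]
    using eta_from_to_cmp[OF assms(2,1) i, of r] assms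
      cmp_zr_right[OF assms(1) sh_Ob assms(2) eta_from, of r s] cmp_zr_right[OF sh_Ob assms(1,2) eta_to, of r "s + r"]
    by (auto simp: add.commute)
qed

lemma eta_map_shift:
  assumes "X \<in> Ob C" "r \<ge> 0"
  shows "fmor (shift C t) 0 (sh C r X) X (eta_map C r X) = eta_map C r (sh C t X)"
proof -
  have "fmor (shift C t) 0 (sh C r X) X (eta_map C r X)
      = inc C (- r) 0 (sh C t (sh C r X)) (sh C t X) (fmor (shift C t) (- r) (sh C r X) X (eta C r 0 X))"
    unfolding eta_map_def using shift_inc[OF sh_Ob assms(1) eta_to, of r 0 t] assms by simp
  moreover have "fmor (shift C t) (- r) (sh C r X) X (eta C r 0 X) = eta C (t + r) t X"
    using shift_eta[OF assms(1), of t 0 r] assms by (simp add: shift_0_ob)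
  moreover have "eta C r 0 (sh C t X) = eta C (t + r) t X"
    using eta_shift[OF assms(1), of r 0 t] by (simp add: add.commute)
  ultimately show ?thesis
    using assms by (simp add: eta_map_def shift_add_ob add.commute)
qed

lemma eta_map_natural:
  assumes "X \<in> Ob C" "Y \<in> Ob C" "f \<in> mor C 0 X Y" "r \<ge> 0"
  shows "cmp C 0 0 (sh C r X) (sh C r Y) Y (fmor (shift C r) 0 X Y f) (eta_map C r Y)
    = cmp C 0 0 (sh C r X) X Y (eta_map C r X) f"
proof -
  have "cmp C 0 (- r) (sh C r X) (sh C r Y) Y (fmor (shift C r) 0 X Y f) (eta C r 0 Y)
      = cmp C (- r) 0 (sh C r X) X Y (eta C r 0 X) f"
    using eta_natural[OF assms(1-3), of 0 r] assms by (simp add: shift_0_ob shift_0_mor)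
  then show ?thesis
    unfolding eta_map_def using assms
      inc_cmp_right[OF sh_Ob[OF assms(1)] sh_Ob[OF assms(2)] assms(2) shift_mor[OF assms(1-3)] eta_to[OF assms(2)], of r 0]
      inc_cmp_left[OF sh_Ob[OF assms(1)] assms(1,2) eta_to[OF assms(1)] assms(3), of r 0] by simp
qed

lemma eta_map_add:
  assumes "X \<in> Ob C" "r \<ge> 0" "t \<ge> 0"
  shows "cmp C 0 0 (sh C (r + t) X) (sh C t X) X (eta_map C r (sh C t X)) (eta_map C t X) = eta_map C (r + t) X"
proof -
  have 1: "eta C r 0 (sh C t X) = eta C (r + t) t X"
    using eta_shift[OF assms(1), of r 0 t] by simp
  have m: "eta C (r + t) t X \<in> mor C (- r) (sh C (r + t) X) (sh C t X)"
    using eta_closed[OF assms(1), of "r + t" t] by simp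
  have "cmp C 0 0 (sh C (r + t) X) (sh C t X) X (eta_map C r (sh C t X)) (eta_map C t X)
     = inc C (- r + - t) 0 (sh C (r + t) X) X (cmp C (- r) (- t) (sh C (r + t) X) (sh C t X) X (eta C (r + t) t X) (eta C t 0 X))"
    unfolding eta_map_def 1 using cmp_inc[OF sh_Ob[OF assms(1)] sh_Ob[OF assms(1)] assms(1) m eta_to[OF assms(1)], of 0 0] assms by (simp add: shift_add_ob)
  also have "cmp C (- r) (- t) (sh C (r + t) X) (sh C t X) X (eta C (r + t) t X) (eta C t 0 X) = eta C (r + t) 0 X"
    using eta_trans[OF assms(1), of t "r + t" 0] assms by (simp add: shift_0_ob)
  finally show ?thesis by (simp add: eta_map_def)
qed

end

text \<open>\<open>\<phi>\<close> is the commutation isomorphism of the triangulated functor \<open>\<Sigma>\<^sup>r\<close> with the translation and \<open>\<psi>\<close> is its inverse.\<close>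

definition translation_iso :: "('k, 'o, 'm) tpc \<Rightarrow> real \<Rightarrow> ('o \<Rightarrow> 'm) \<Rightarrow> ('o \<Rightarrow> 'm) \<Rightarrow> bool"
  where "translation_iso C r \<phi> \<psi> \<longleftrightarrow>
    (\<forall>X\<in>Ob C. \<phi> X \<in> mor C 0 (sh C r (Tr C X)) (Tr C (sh C r X)) \<and> \<psi> X \<in> mor C 0 (Tr C (sh C r X)) (sh C r (Tr C X)) \<and>
      cmp C 0 0 (sh C r (Tr C X)) (Tr C (sh C r X)) (sh C r (Tr C X)) (\<phi> X) (\<psi> X) = idn C (sh C r (Tr C X)) \<and>
      cmp C 0 0 (Tr C (sh C r X)) (sh C r (Tr C X)) (Tr C (sh C r X)) (\<psi> X) (\<phi> X) = idn C (Tr C (sh C r X))) \<and>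
    (\<forall>X\<in>Ob C. \<forall>Y\<in>Ob C. \<forall>f\<in>mor C 0 X Y.
       cmp C 0 0 (sh C r (Tr C X)) (sh C r (Tr C Y)) (Tr C (sh C r Y)) (fmor (shift C r) 0 (Tr C X) (Tr C Y) (Trm C X Y f)) (\<phi> Y)
       = cmp C 0 0 (sh C r (Tr C X)) (Tr C (sh C r X)) (Tr C (sh C r Y)) (\<phi> X) (Trm C (sh C r X) (sh C r Y) (fmor (shift C r) 0 X Y f))) \<and>
    (\<forall>X Y Z f g h. (X, Y, Z, f, g, h) \<in> Tri C \<longrightarrow>
       (sh C r X, sh C r Y, sh C r Z, fmor (shift C r) 0 X Y f, fmor (shift C r) 0 Y Z g,
        cmp C 0 0 (sh C r Z) (sh C r (Tr C X)) (Tr C (sh C r X)) (fmor (shift C r) 0 Z (Tr C X) h) (\<phi> X)) \<in> Tri C)"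

context triangulated_persistence_category
begin

sublocale C0: triangulated_category "C_zero C"
  by (rule C_zero_triangulated)

lemma Tr_Ob: "X \<in> Ob C \<Longrightarrow> Tr C X \<in> Ob C"
  using C0.Tob_closed[of X] by simp

lemma Trm_mor: "X \<in> Ob C \<Longrightarrow> Y \<in> Ob C \<Longrightarrow> f \<in> mor C 0 X Y \<Longrightarrow> Trm C X Y f \<in> mor C 0 (Tr C X) (Tr C Y)"
  using C0.Tmor_closed[of X Y f] by simp

lemma Trm_cmp: "X \<in> Ob C \<Longrightarrow> Y \<in> Ob C \<Longrightarrow> Z \<in> Ob C \<Longrightarrow> f \<in> mor C 0 X Y \<Longrightarrow> g \<in> mor C 0 Y Z \<Longrightarrow>
    Trm C X Z (cmp C 0 0 X Y Z f g) = cmp C 0 0 (Tr C X) (Tr C Y) (Tr C Z) (Trm C X Y f) (Trm C Y Z g)"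
  using C0.T_cmp[of X Y Z f g] by simp

lemma Trm_idn: "X \<in> Ob C \<Longrightarrow> Trm C X X (idn C X) = idn C (Tr C X)"
  using C0.T_idn[of X] by simp

lemma Trm_zr: "X \<in> Ob C \<Longrightarrow> Y \<in> Ob C \<Longrightarrow> Trm C X Y (zr 0 X Y) = zr 0 (Tr C X) (Tr C Y)"
  using C0.Tmor_zero[of X Y] by simp

lemma Trm_inj: "X \<in> Ob C \<Longrightarrow> Y \<in> Ob C \<Longrightarrow> f \<in> mor C 0 X Y \<Longrightarrow> g \<in> mor C 0 X Y \<Longrightarrow>
    Trm C X Y f = Trm C X Y g \<longleftrightarrow> f = g"
  using C0.Tmor_inj[of X Y f g] by simp

lemma Trm_surj: "X \<in> Ob C \<Longrightarrow> Y \<in> Ob C \<Longrightarrow> f \<in> mor C 0 (Tr C X) (Tr C Y) \<Longrightarrow> \<exists>g\<in>mor C 0 X Y. f = Trm C X Y g"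
  using C0.Tmor_surj[of X Y f] by simp

lemma Tri_typed: "(X, Y, Z, f, g, h) \<in> Tri C \<Longrightarrow> X \<in> Ob C \<and> Y \<in> Ob C \<and> Z \<in> Ob C \<and>
    f \<in> mor C 0 X Y \<and> g \<in> mor C 0 Y Z \<and> h \<in> mor C 0 Z (Tr C X)"
  using C0.tri_typed[of X Y Z f g h] by simp

lemma Tri_rotate: "(X, Y, Z, f, g, h) \<in> Tri C \<Longrightarrow> \<exists>k. (Y, Z, Tr C X, g, h, k) \<in> Tri C"
  using C0.tri_rotate_right[of X Y Z f g h] by auto

subsection \<open>Exactness in all degrees\<close>

text \<open>Since \<open>hom\<^sup>s(Y, W) = hom\<^sup>0(Y, \<Sigma>\<^sup>-\<^sup>sW)\<close> the exactness of \<open>hom\<^sup>0\<close> on triangles holds for every \<open>hom\<^sup>s\<close>.\<close>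

lemma factor_out:
  assumes tri: "(X, Y, Z, f, g, h) \<in> Tri C" and W: "W \<in> Ob C"
    and t: "t \<in> mor C s Y W" "cmp C 0 s X Y W f t = zr s X W"
  shows "\<exists>u\<in>mor C s Z W. t = cmp C 0 s Y Z W g u"
proof -
  have X: "X \<in> Ob C" and Y: "Y \<in> Ob C" and Z: "Z \<in> Ob C" and f: "f \<in> mor C 0 X Y" and g: "g \<in> mor C 0 Y Z"
    using Tri_typed[OF tri] by auto
  let ?W = "sh C (- s) W"
  have W': "?W \<in> Ob C" using sh_Ob[OF W] .
  have e: "eta C 0 (- s) W \<in> mor C (- s) W ?W" "eta C (- s) 0 W \<in> mor C s ?W W"
    using eta_from[OF W, of "- s"] eta_to[OF W, of "- s"] by auto
  let ?t = "cmp C s (- s) Y W ?W t (eta C 0 (- s) W)"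
  have t': "?t \<in> mor C 0 Y ?W" by (rule cmp_mor[OF Y W W' t(1) e(1)]) simp
  have "cmp C 0 0 X Y ?W f ?t = zr 0 X ?W"
    using cmp_assoc[OF X Y W W' f t(1) e(1)] t(2) cmp_zr_left[OF X W W' e(1), of s] by simp
  then obtain u where u: "u \<in> mor C 0 Z ?W" "?t = cmp C 0 0 Y Z ?W g u"
    using C0.tri_factor_out[of X Y Z f g h ?W ?t] tri W' t' by auto
  have "t = cmp C 0 s Y ?W W ?t (eta C (- s) 0 W)"
    using cmp_eta_from_to[OF Y W t(1), of "- s"] by simp
  also have "\<dots> = cmp C 0 s Y Z W g (cmp C 0 s Z ?W W u (eta C (- s) 0 W))"
    unfolding u(2) using cmp_assoc[OF Y Z W' W g u(1) e(2)] by simp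
  finally show ?thesis
    using cmp_mor[OF Z W' W u(1) e(2), of s] by auto
qed

lemma factor_in:
  assumes tri: "(X, Y, Z, f, g, h) \<in> Tri C" and W: "W \<in> Ob C"
    and t: "t \<in> mor C s W Y" "cmp C s 0 W Y Z t g = zr s W Z"
  shows "\<exists>u\<in>mor C s W X. t = cmp C s 0 W X Y u f"
proof -
  have X: "X \<in> Ob C" and Y: "Y \<in> Ob C" and Z: "Z \<in> Ob C" and f: "f \<in> mor C 0 X Y" and g: "g \<in> mor C 0 Y Z"
    using Tri_typed[OF tri] by auto
  let ?W = "sh C s W"
  have W': "?W \<in> Ob C" using sh_Ob[OF W] .
  have e: "eta C 0 s W \<in> mor C s W ?W" "eta C s 0 W \<in> mor C (- s) ?W W"
    using eta_from[OF W] eta_to[OF W] by auto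
  let ?t = "cmp C (- s) s ?W W Y (eta C s 0 W) t"
  have t': "?t \<in> mor C 0 ?W Y" by (rule cmp_mor[OF W' W Y e(2) t(1)]) simp
  have "cmp C 0 0 ?W Y Z ?t g = zr 0 ?W Z"
    using cmp_assoc[OF W' W Y Z e(2) t(1) g] t(2) cmp_zr_right[OF W' W Z e(2), of s] by simp
  then obtain u where u: "u \<in> mor C 0 ?W X" "?t = cmp C 0 0 ?W X Y u f"
    using C0.tri_factor_in[of X Y Z f g h ?W ?t] tri W' t' by auto
  have "t = cmp C s 0 W ?W Y (eta C 0 s W) ?t"
    using eta_from_to_cmp[OF Y W t(1), of s] by simp
  also have "\<dots> = cmp C s 0 W X Y (cmp C s 0 W ?W X (eta C 0 s W) u) f"
    unfolding u(2) using cmp_assoc[OF W W' X Y e(1) u(1) f] by simp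
  finally show ?thesis
    using cmp_mor[OF W W' X e(1) u(1), of s] by auto
qed

lemma factor_out2:
  assumes "(X, Y, Z, f, g, h) \<in> Tri C" "W \<in> Ob C" "t \<in> mor C s Z W" "cmp C 0 s Y Z W g t = zr s Y W"
  shows "\<exists>u\<in>mor C s (Tr C X) W. t = cmp C 0 s Z (Tr C X) W h u"
  using Tri_rotate[OF assms(1)] factor_out[OF _ assms(2-4)] by blast

lemma neg_zero:
  assumes "X \<in> Ob C" "Y \<in> Ob C" "Z \<in> Ob C" "t \<in> mor C s X Y" "f \<in> mor C 0 Y Z" "cmp C s 0 X Y Z t f = zr s X Z"
  shows "cmp C s 0 X Y Z t (\<ominus>\<^bsub>Hom C 0 Y Z\<^esub> f) = zr s X Z"
proof -
  interpret A: abelian_group "Hom C 0 Y Z" by (rule hom_abelian[OF assms(2,3)])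
  interpret B: abelian_group "Hom C s X Z" by (rule hom_abelian[OF assms(1,3)])
  have "\<ominus>\<^bsub>Hom C 0 Y Z\<^esub> f = zr 0 Y Z \<ominus>\<^bsub>Hom C 0 Y Z\<^esub> f"
    using assms(5) by (simp add: A.minus_eq mor_def)
  then show ?thesis
    using cmp_diff_right[OF assms(1-4) zero_mor[OF assms(2,3)] assms(5)] cmp_zr_right[OF assms(1-4)] assms(6)
    by (simp add: B.minus_eq B.r_neg)
qed

lemma factor_in3:
  assumes tri: "(X, Y, Z, f, g, h) \<in> Tri C" and W: "W \<in> Ob C"
    and t: "t \<in> mor C s W (Tr C X)" "cmp C s 0 W (Tr C X) (Tr C Y) t (Trm C X Y f) = zr s W (Tr C Y)"
  shows "\<exists>u\<in>mor C s W Z. t = cmp C s 0 W Z (Tr C X) u h"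
proof -
  note ty = Tri_typed[OF tri]
  have r: "(Z, Tr C X, Tr C Y, h, \<ominus>\<^bsub>Hom C 0 (Tr C X) (Tr C Y)\<^esub> Trm C X Y f,
      \<ominus>\<^bsub>Hom C 0 (Tr C Y) (Tr C Z)\<^esub> Trm C Y Z g) \<in> Tri C"
    using C0.tri_rotate_right[OF C0.tri_rotate_right, of X Y Z f g h] tri by simp
  show ?thesis
    using factor_in[OF r W t(1) neg_zero[OF W Tr_Ob Tr_Ob t(1) Trm_mor t(2)]] ty by blast
qed

subsection \<open>Acyclic objects and the translation\<close>

text \<open>Under \<open>hom\<^sup>0(\<Sigma>\<^sup>tX, Y) = hom\<^sup>t(X, Y)\<close> composition with \<open>\<eta>\<^sub>t\<^sup>X\<close> becomes \<open>i\<^sub>0\<^sub>,\<^sub>t\<close>, which semicontinuity makes bijective for small \<open>t\<close>.\<close>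

lemma small_bij:
  assumes X: "X \<in> Ob C" and Y: "Y \<in> Ob C"
  shows "\<forall>\<^sub>F t in at_right 0. bij_betw (\<lambda>f. cmp C 0 0 (sh C t X) X Y (eta_map C t X) f) (mor C 0 X Y) (mor C 0 (sh C t X) Y)"
proof -
  obtain \<epsilon> where \<epsilon>: "\<epsilon> > 0" "\<And>t. 0 \<le> t \<Longrightarrow> t < 0 + \<epsilon> \<Longrightarrow>
      bij_betw (inc C 0 t X Y) (carrier (Hom C 0 X Y)) (carrier (Hom C t X Y))"
    using hom_semicontinuous[OF X Y] unfolding lower_semicontinuous_def by metis
  have "bij_betw (\<lambda>f. cmp C 0 0 (sh C t X) X Y (eta_map C t X) f) (mor C 0 X Y) (mor C 0 (sh C t X) Y)"
    if t: "0 < t" "t < \<epsilon>" for t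
  proof -
    let ?g = "\<lambda>f. cmp C (- t) t (sh C t X) X Y (eta C t 0 X) f"
    have X': "sh C t X \<in> Ob C" using sh_Ob[OF X] .
    have "bij_betw ?g (mor C t X Y) (mor C 0 (sh C t X) Y)"
    proof (rule bij_betw_byWitness[where f' = "\<lambda>f. cmp C t 0 X (sh C t X) Y (eta C 0 t X) f"])
      show "\<forall>f\<in>mor C t X Y. cmp C t 0 X (sh C t X) Y (eta C 0 t X) (?g f) = f"
        using eta_from_to_cmp[OF Y X, of _ t t] by simp
      show "\<forall>f\<in>mor C 0 (sh C t X) Y. ?g (cmp C t 0 X (sh C t X) Y (eta C 0 t X) f) = f"
        using eta_to_from_cmp[OF Y X, of _ 0 t] by simp
      show "?g ` mor C t X Y \<subseteq> mor C 0 (sh C t X) Y"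
        using cmp_mor[OF X' X Y eta_to[OF X, of t], of _ t 0] by auto
      show "(\<lambda>f. cmp C t 0 X (sh C t X) Y (eta C 0 t X) f) ` mor C 0 (sh C t X) Y \<subseteq> mor C t X Y"
        using cmp_mor[OF X X' Y eta_from[OF X, of t], of _ 0 t] by auto
    qed
    moreover have "bij_betw (inc C 0 t X Y) (mor C 0 X Y) (mor C t X Y)"
      using \<epsilon>(2)[of t] t by (simp add: mor_def)
    ultimately have "bij_betw (?g \<circ> inc C 0 t X Y) (mor C 0 X Y) (mor C 0 (sh C t X) Y)"
      by (rule bij_betw_trans[rotated])
    moreover have "(?g \<circ> inc C 0 t X Y) f = cmp C 0 0 (sh C t X) X Y (eta_map C t X) f" if "f \<in> mor C 0 X Y" for f
      using eta_map_cmp[OF X Y that, of t] t by simp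
    ultimately show ?thesis by (simp cong: bij_betw_cong)
  qed
  then show ?thesis
    unfolding eventually_at_right_field using \<epsilon>(1) by blast
qed

lemma translation_iso_exists: "\<exists>\<phi> \<psi>. translation_iso C r \<phi> \<psi>"
proof -
  obtain \<phi> where iso: "\<forall>X\<in>Ob C. is_iso_in (C_zero C) (sh C r (Tr C X)) (Tr C (sh C r X)) (\<phi> X)"
    and rest: "\<forall>X\<in>Ob C. \<forall>Y\<in>Ob C. \<forall>f\<in>mor C 0 X Y.
       cmp C 0 0 (sh C r (Tr C X)) (sh C r (Tr C Y)) (Tr C (sh C r Y)) (fmor (shift C r) 0 (Tr C X) (Tr C Y) (Trm C X Y f)) (\<phi> Y)
       = cmp C 0 0 (sh C r (Tr C X)) (Tr C (sh C r X)) (Tr C (sh C r Y)) (\<phi> X) (Trm C (sh C r X) (sh C r Y) (fmor (shift C r) 0 X Y f))"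
    "\<forall>X Y Z f g h. (X, Y, Z, f, g, h) \<in> Tri C \<longrightarrow>
       (sh C r X, sh C r Y, sh C r Z, fmor (shift C r) 0 X Y f, fmor (shift C r) 0 Y Z g,
        cmp C 0 0 (sh C r Z) (sh C r (Tr C X)) (Tr C (sh C r X)) (fmor (shift C r) 0 Z (Tr C X) h) (\<phi> X)) \<in> Tri C"
    using shift_triangulated[of r] unfolding triangulated_functor_def C_zero_simps by blast
  from iso have "\<forall>X\<in>Ob C. \<exists>\<psi>. \<psi> \<in> mor C 0 (Tr C (sh C r X)) (sh C r (Tr C X)) \<and>
      cmp C 0 0 (sh C r (Tr C X)) (Tr C (sh C r X)) (sh C r (Tr C X)) (\<phi> X) \<psi> = idn C (sh C r (Tr C X)) \<and>
      cmp C 0 0 (Tr C (sh C r X)) (sh C r (Tr C X)) (Tr C (sh C r X)) \<psi> (\<phi> X) = idn C (Tr C (sh C r X))"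
    unfolding is_iso_in_def C_zero_simps by blast
  then obtain \<psi> where "\<forall>X\<in>Ob C. \<psi> X \<in> mor C 0 (Tr C (sh C r X)) (sh C r (Tr C X)) \<and>
      cmp C 0 0 (sh C r (Tr C X)) (Tr C (sh C r X)) (sh C r (Tr C X)) (\<phi> X) (\<psi> X) = idn C (sh C r (Tr C X)) \<and>
      cmp C 0 0 (Tr C (sh C r X)) (sh C r (Tr C X)) (Tr C (sh C r X)) (\<psi> X) (\<phi> X) = idn C (Tr C (sh C r X))"
    by metis
  moreover have "\<forall>X\<in>Ob C. \<phi> X \<in> mor C 0 (sh C r (Tr C X)) (Tr C (sh C r X))"
    using iso by (auto simp: is_iso_in_def)
  ultimately show ?thesis unfolding translation_iso_def using rest by blast
qed

context
  fixes r \<phi> \<psi> assumes tr: "translation_iso C r \<phi> \<psi>"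
begin

lemma translation_iso_mor: "X \<in> Ob C \<Longrightarrow> \<phi> X \<in> mor C 0 (sh C r (Tr C X)) (Tr C (sh C r X))"
  and translation_iso_mor_inv: "X \<in> Ob C \<Longrightarrow> \<psi> X \<in> mor C 0 (Tr C (sh C r X)) (sh C r (Tr C X))"
  and translation_iso_right: "X \<in> Ob C \<Longrightarrow>
      cmp C 0 0 (sh C r (Tr C X)) (Tr C (sh C r X)) (sh C r (Tr C X)) (\<phi> X) (\<psi> X) = idn C (sh C r (Tr C X))"
  and translation_iso_left: "X \<in> Ob C \<Longrightarrow>
      cmp C 0 0 (Tr C (sh C r X)) (sh C r (Tr C X)) (Tr C (sh C r X)) (\<psi> X) (\<phi> X) = idn C (Tr C (sh C r X))"
  using tr unfolding translation_iso_def by blast+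

lemma translation_iso_natural: "X \<in> Ob C \<Longrightarrow> Y \<in> Ob C \<Longrightarrow> f \<in> mor C 0 X Y \<Longrightarrow>
    cmp C 0 0 (sh C r (Tr C X)) (sh C r (Tr C Y)) (Tr C (sh C r Y)) (fmor (shift C r) 0 (Tr C X) (Tr C Y) (Trm C X Y f)) (\<phi> Y)
    = cmp C 0 0 (sh C r (Tr C X)) (Tr C (sh C r X)) (Tr C (sh C r Y)) (\<phi> X) (Trm C (sh C r X) (sh C r Y) (fmor (shift C r) 0 X Y f))"
  using tr unfolding translation_iso_def by blast

lemma translation_iso_Tri: "(X, Y, Z, f, g, h) \<in> Tri C \<Longrightarrow>
    (sh C r X, sh C r Y, sh C r Z, fmor (shift C r) 0 X Y f, fmor (shift C r) 0 Y Z g,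
     cmp C 0 0 (sh C r Z) (sh C r (Tr C X)) (Tr C (sh C r X)) (fmor (shift C r) 0 Z (Tr C X) h) (\<phi> X)) \<in> Tri C"
  using tr unfolding translation_iso_def by blast

end

lemma acyclic_iff_eta_map:
  assumes "X \<in> Ob C" "r \<ge> 0"
  shows "eta_map C r X = zr 0 (sh C r X) X \<longleftrightarrow> acyclic_of C r X"
  using eta_map_cmp_zero_iff[OF assms(1,1) idn_closed[OF assms(1)] assms(2)]
    idn_right[OF sh_Ob[OF assms(1)] assms(1) eta_map_mor[OF assms]] assms(1)
  by (simp add: acyclic_of_def)

lemma acyclic_of_mono:
  assumes "acyclic_of C r X" "0 \<le> r" "r \<le> t" shows "acyclic_of C t X"
proof -
  have X: "X \<in> Ob C" using assms by (simp add: acyclic_of_def)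
  show ?thesis
    using inc_trans[OF X X assms(2,3) idn_closed[OF X]] inc_zr[OF X X assms(3)] assms(1)
    by (simp add: acyclic_of_def)
qed

end

context triangulated_persistence_category
begin

lemma assoc0: "W \<in> Ob C \<Longrightarrow> X \<in> Ob C \<Longrightarrow> Y \<in> Ob C \<Longrightarrow> Z \<in> Ob C \<Longrightarrow>
    f \<in> mor C 0 W X \<Longrightarrow> g \<in> mor C 0 X Y \<Longrightarrow> h \<in> mor C 0 Y Z \<Longrightarrow>
    cmp C 0 0 W Y Z (cmp C 0 0 W X Y f g) h = cmp C 0 0 W X Z f (cmp C 0 0 X Y Z g h)"
  using cmp_assoc[of W X Y Z f 0 g 0 h 0] by simp

lemma cmp0: "X \<in> Ob C \<Longrightarrow> Y \<in> Ob C \<Longrightarrow> Z \<in> Ob C \<Longrightarrow> f \<in> mor C 0 X Y \<Longrightarrow> g \<in> mor C 0 Y Z \<Longrightarrow>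
    cmp C 0 0 X Y Z f g \<in> mor C 0 X Z"
  by (rule cmp_mor) auto

lemma acyclic_retract:
  assumes "X \<in> Ob C" "Q \<in> acyclics C" "f \<in> mor C r X Q" "g \<in> mor C s Q X"
    "cmp C r s X Q X f g = inc C 0 (r + s) X X (idn C X)" "0 \<le> r + s"
  shows "X \<in> acyclics C"
  using null_cmp_left[OF assms(1) acyclics_Ob[OF assms(2)] assms(1) null_to_acyclic[OF assms(2,1,3)] assms(4)]
    null_inc_iff[OF assms(1,1) idn_closed[OF assms(1)] assms(6)] assms(1,5)
  by (simp add: acyclics_iff)

lemma acyclic_iso:
  assumes "isomorphic_in (C_zero C) X Y" "Y \<in> acyclics C" shows "X \<in> acyclics C"
proof -
  obtain f g where X: "X \<in> Ob C" and "f \<in> mor C 0 X Y" "g \<in> mor C 0 Y X" "cmp C 0 0 X Y X f g = idn C X"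
    using assms(1) by (auto simp: isomorphic_in_def is_iso_in_def)
  then show ?thesis
    using acyclic_retract[OF X assms(2), of f 0 g 0] inc_refl[OF X X idn_closed[OF X]] by simp
qed

lemma acyclic_shift: assumes "X \<in> acyclics C" shows "sh C r X \<in> acyclics C"
proof -
  have X: "X \<in> Ob C" using assms acyclics_Ob by blast
  show ?thesis
    using acyclic_retract[OF sh_Ob[OF X] assms eta_to[OF X, of r] eta_from[OF X, of r]]
      eta_to_from[OF X, of r] inc_refl[OF sh_Ob[OF X] sh_Ob[OF X] idn_closed[OF sh_Ob[OF X]], of r] by simp
qed

lemma acyclic_shift_iff: "X \<in> Ob C \<Longrightarrow> sh C r X \<in> acyclics C \<longleftrightarrow> X \<in> acyclics C"
  using acyclic_shift[of X r] acyclic_shift[of "sh C r X" "- r"] by (auto simp: shift_add_ob shift_0_ob)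

lemma cone_eta_acyclic: "is_cone_eta C r X Q \<Longrightarrow> r \<ge> 0 \<Longrightarrow> Q \<in> acyclics C"
  by (auto simp: is_cone_eta_def acyclics_def acyclic_of_def)

text \<open>In a high degree \<open>r\<close> the identity of \<open>B\<close> dies in \<open>E\<close>, so it factors through the acyclic \<open>A\<close>.\<close>

lemma acyclic_extension:
  assumes tri: "(A, B, E, f, g, h) \<in> Tri C" and ac: "A \<in> acyclics C" "E \<in> acyclics C"
  shows "B \<in> acyclics C"
proof -
  note ty = Tri_typed[OF tri]
  then have B: "B \<in> Ob C" and E: "E \<in> Ob C" and g: "g \<in> mor C 0 B E" by auto
  obtain r where r: "0 \<le> r" "inc C 0 r B E g = zr r B E"
    using null_to_acyclic[OF ac(2) B g] by (auto simp: null_def)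
  let ?i = "inc C 0 r B B (idn C B)"
  have i: "?i \<in> mor C r B B" using inc_mor[OF B B r(1) idn_closed[OF B]] .
  have "cmp C r 0 B B E ?i g = zr r B E"
    using inc_cmp_left[OF B B E idn_closed[OF B] g r(1)] idn_left[OF B E g] r(2) by simp
  then obtain u where "u \<in> mor C r B A" "?i = cmp C r 0 B A B u f"
    using factor_in[OF tri B i] by blast
  then show ?thesis
    using acyclic_retract[OF B ac(1), of u r f 0] ty r(1) by auto
qed

text \<open>If \<open>\<eta>\<^sub>r\<^sup>Q = 0\<close>, the map from its acyclic cone to \<open>T\<Sigma>\<^sup>rQ\<close> is split, so \<open>T\<Sigma>\<^sup>rQ\<close> is a retract of an acyclic object.\<close>

lemma acyclic_translate:
  assumes "Q \<in> acyclics C" shows "Tr C Q \<in> acyclics C"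
proof -
  have Q: "Q \<in> Ob C" using assms acyclics_Ob by blast
  obtain r where r: "0 \<le> r" "acyclic_of C r Q" using assms by (auto simp: acyclics_def)
  obtain Z where Z: "is_cone_eta C r Q Z" using cone_eta[OF Q r(1)] by blast
  then obtain g h where tri: "(sh C r Q, Q, Z, eta_map C r Q, g, h) \<in> Tri C" by (auto simp: is_cone_eta_def)
  let ?W = "Tr C (sh C r Q)"
  have W: "?W \<in> Ob C" using Tr_Ob sh_Ob Q by blast
  have "cmp C 0 0 ?W ?W (Tr C Q) (idn C ?W) (Trm C (sh C r Q) Q (eta_map C r Q)) = zr 0 ?W (Tr C Q)"
    using acyclic_iff_eta_map[OF Q r(1)] r(2) Trm_zr[OF sh_Ob[OF Q] Q]
      idn_left[OF W Tr_Ob[OF Q] zero_mor[OF W Tr_Ob[OF Q]]] by simp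
  then obtain u where u: "u \<in> mor C 0 ?W Z" "idn C ?W = cmp C 0 0 ?W Z ?W u h"
    using factor_in3[OF tri W idn_closed[OF W]] by blast
  have "?W \<in> acyclics C"
    using acyclic_retract[OF W cone_eta_acyclic[OF Z r(1)] u(1), of h 0] Tri_typed[OF tri] u(2)
      inc_refl[OF W W idn_closed[OF W]] by simp
  moreover have "isomorphic_in (C_zero C) (sh C r (Tr C Q)) ?W"
    using shift_triangulated[of r] Q unfolding triangulated_functor_def isomorphic_in_def by auto
  ultimately show ?thesis
    using acyclic_iso acyclic_shift_iff[OF Tr_Ob[OF Q]] by blast
qed

text \<open>For small \<open>t\<close> the morphisms \<open>\<eta>\<^sub>t\<^sup>T\<^sup>X\<close> and
  \<open>T\<eta>\<^sub>t\<^sup>X\<close> both generate, by semicontinuity, all morphisms \<open>\<Sigma>\<^sup>tTX \<cong> T\<Sigma>\<^sup>tX \<rightarrow> TX\<close>, so each is a multiple of the other.\<close>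

lemma eta_translate_small:
  assumes X: "X \<in> Ob C"
  shows "\<forall>\<^sub>F t in at_right 0. \<forall>\<phi>\<in>mor C 0 (sh C t (Tr C X)) (Tr C (sh C t X)). \<forall>\<psi>\<in>mor C 0 (Tr C (sh C t X)) (sh C t (Tr C X)).
    cmp C 0 0 (sh C t (Tr C X)) (Tr C (sh C t X)) (sh C t (Tr C X)) \<phi> \<psi> = idn C (sh C t (Tr C X)) \<longrightarrow>
    (\<exists>y\<in>mor C 0 X X. eta_map C t (Tr C X) = cmp C 0 0 (sh C t (Tr C X)) (Tr C (sh C t X)) (Tr C X) \<phi>
        (Trm C (sh C t X) X (cmp C 0 0 (sh C t X) X X (eta_map C t X) y))) \<and>
    (\<exists>w\<in>mor C 0 (Tr C X) (Tr C X). cmp C 0 0 (sh C t (Tr C X)) (Tr C (sh C t X)) (Tr C X) \<phi> (Trm C (sh C t X) X (eta_map C t X))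
        = cmp C 0 0 (sh C t (Tr C X)) (Tr C X) (Tr C X) (eta_map C t (Tr C X)) w)"
  using small_bij[OF X X] small_bij[OF Tr_Ob[OF X] Tr_Ob[OF X]] eventually_at_right_less
proof eventually_elim
  case (elim t)
  note T = Tr_Ob[OF X]
  note S = sh_Ob[OF X, of t] sh_Ob[OF T, of t] Tr_Ob[OF sh_Ob[OF X, of t]]
  have t: "t \<ge> 0" using elim by simp
  have e: "eta_map C t X \<in> mor C 0 (sh C t X) X" "eta_map C t (Tr C X) \<in> mor C 0 (sh C t (Tr C X)) (Tr C X)"
    using eta_map_mor[OF X t] eta_map_mor[OF T t] .
  show ?case
  proof (intro ballI impI conjI)
    fix \<phi> \<psi> assume \<phi>: "\<phi> \<in> mor C 0 (sh C t (Tr C X)) (Tr C (sh C t X))" and \<psi>: "\<psi> \<in> mor C 0 (Tr C (sh C t X)) (sh C t (Tr C X))"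
      and inv: "cmp C 0 0 (sh C t (Tr C X)) (Tr C (sh C t X)) (sh C t (Tr C X)) \<phi> \<psi> = idn C (sh C t (Tr C X))"
    obtain z where z: "z \<in> mor C 0 (sh C t X) X"
      "cmp C 0 0 (Tr C (sh C t X)) (sh C t (Tr C X)) (Tr C X) \<psi> (eta_map C t (Tr C X)) = Trm C (sh C t X) X z"
      using Trm_surj[OF S(1) X cmp0[OF S(3,2) T \<psi> e(2)]] by blast
    obtain y where y: "y \<in> mor C 0 X X" "z = cmp C 0 0 (sh C t X) X X (eta_map C t X) y"
      using elim(1) z(1) by (auto simp: bij_betw_def)
    have "eta_map C t (Tr C X) = cmp C 0 0 (sh C t (Tr C X)) (Tr C (sh C t X)) (Tr C X) \<phi> (Trm C (sh C t X) X z)"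
      using assoc0[OF S(2,3,2) T \<phi> \<psi> e(2)] inv idn_left[OF S(2) T e(2)] z(2) by simp
    then show "\<exists>y\<in>mor C 0 X X. eta_map C t (Tr C X) = cmp C 0 0 (sh C t (Tr C X)) (Tr C (sh C t X)) (Tr C X) \<phi>
        (Trm C (sh C t X) X (cmp C 0 0 (sh C t X) X X (eta_map C t X) y))"
      using y by blast
    show "\<exists>w\<in>mor C 0 (Tr C X) (Tr C X). cmp C 0 0 (sh C t (Tr C X)) (Tr C (sh C t X)) (Tr C X) \<phi> (Trm C (sh C t X) X (eta_map C t X))
        = cmp C 0 0 (sh C t (Tr C X)) (Tr C X) (Tr C X) (eta_map C t (Tr C X)) w"
      using elim(2) cmp0[OF S(2,3) T \<phi> Trm_mor[OF S(1) X e(1)]] by (auto simp: bij_betw_def image_def)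
  qed
qed

lemma eta_map_0: "X \<in> Ob C \<Longrightarrow> eta_map C 0 X = idn C X"
  unfolding eta_map_def using eta_refl[of X 0] inc_refl[OF _ _ idn_closed] by (simp add: shift_0_ob)

text \<open>Subdivide: \<open>\<eta>\<^sub>n\<^sub>t\<close> is a composite of \<open>n\<close> shifts of \<open>\<eta>\<^sub>t\<close>, so for small \<open>t\<close> and all \<open>n\<close> the morphism \<open>T\<eta>\<^sub>n\<^sub>t\<^sup>X\<close> factors through
  \<open>\<eta>\<^sub>n\<^sub>t\<^sup>T\<^sup>X\<close>. The latter vanishes for large \<open>n\<close>.\<close>

lemma acyclic_untranslate:
  assumes X: "X \<in> Ob C" and ac: "Tr C X \<in> acyclics C" shows "X \<in> acyclics C"
proof -
  let ?c = "cmp C 0 0" and ?T = "Tr C" and ?M = "Trm C" and ?e = "eta_map C"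
  let ?K = "?T X"
  note T = Tr_Ob[OF X]
  have "\<forall>\<^sub>F t in at_right (0::real). t > 0"
    by (rule eventually_at_right_less)
  with eta_translate_small[OF X] obtain t where t: "t > 0" and small:
    "\<And>\<phi> \<psi>. \<phi> \<in> mor C 0 (sh C t ?K) (?T (sh C t X)) \<Longrightarrow> \<psi> \<in> mor C 0 (?T (sh C t X)) (sh C t ?K) \<Longrightarrow>
      ?c (sh C t ?K) (?T (sh C t X)) (sh C t ?K) \<phi> \<psi> = idn C (sh C t ?K) \<Longrightarrow>
      \<exists>w\<in>mor C 0 ?K ?K. ?c (sh C t ?K) (?T (sh C t X)) ?K \<phi> (?M (sh C t X) X (?e t X))
        = ?c (sh C t ?K) ?K ?K (?e t ?K) w"
    using eventually_happens'[OF _ eventually_conj[OF eta_translate_small[OF X] eventually_at_right_less]]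
    by (metis (no_types, lifting) trivial_limit_at_right_real)
  let ?S = "sh C t" and ?F = "fmor (shift C t) 0"
  obtain \<phi> \<psi> where iso: "translation_iso C t \<phi> \<psi>"
    using translation_iso_exists by blast
  note phi = translation_iso_mor[OF iso] and psi = translation_iso_mor_inv[OF iso]
    and inv = translation_iso_right[OF iso] translation_iso_left[OF iso] and nat = translation_iso_natural[OF iso]
  obtain w where w: "w \<in> mor C 0 ?K ?K"
    "?c (?S ?K) (?T (?S X)) ?K (\<phi> X) (?M (?S X) X (?e t X))
        = ?c (?S ?K) ?K ?K (?e t ?K) w"
    using small[OF phi psi inv(1)] X by blast
  \<comment> \<open>the induction step moves \<open>\<Sigma>\<^sup>t\<close> past \<open>T\<close> by naturality of \<open>\<phi>\<close>, uses \<open>w\<close> once, and then moves \<open>\<eta>\<^sub>t\<close> to the left by naturality\<close>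
  have step: "\<exists>b\<in>mor C 0 (?T (sh C (real n * t) X)) (sh C (real n * t) ?K). \<exists>v\<in>mor C 0 ?K ?K.
     ?M (sh C (real n * t) X) X (?e (real n * t) X) = ?c (?T (sh C (real n * t) X)) ?K ?K
       (?c (?T (sh C (real n * t) X)) (sh C (real n * t) ?K) ?K b (?e (real n * t) ?K)) v" for n
  proof (induction n)
    case 0
    show ?case
      by (rule bexI[of _ "idn C ?K"], rule bexI[of _ "idn C ?K"])
        (use X T in \<open>simp_all add: shift_0_ob eta_map_0 Trm_idn idn_left idn_closed\<close>)
  next
    case (Suc n)
    let ?r = "real n * t" let ?Xr = "sh C ?r X" let ?Xt = "?S X"
    have r: "?r \<ge> 0" using t by simp
    from Suc obtain b v where b: "b \<in> mor C 0 (?T ?Xr) (sh C ?r ?K)" and v: "v \<in> mor C 0 ?K ?K"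
      and eq: "?M ?Xr X (?e ?r X) = ?c (?T ?Xr) ?K ?K
        (?c (?T ?Xr) (sh C ?r ?K) ?K b (?e ?r ?K)) v" by blast
    have Xr: "?Xr \<in> Ob C" and Xt: "?Xt \<in> Ob C" and Xrt: "?S ?Xr \<in> Ob C" using sh_Ob X by auto
    note TXr = Tr_Ob[OF Xr] and TXt = Tr_Ob[OF Xt] and TXrt = Tr_Ob[OF Xrt]
    note sTX = sh_Ob[OF T] and sTXr = sh_Ob[OF TXr]
    have e: "?e ?r X \<in> mor C 0 ?Xr X" "?e t X \<in> mor C 0 ?Xt X"
      "?e t ?K \<in> mor C 0 (?S ?K) ?K" "?e ?r ?K \<in> mor C 0 (sh C ?r ?K) ?K"
      using eta_map_mor X T r t by auto
    have Se: "?F ?Xr X (?e ?r X) \<in> mor C 0 (?S ?Xr) ?Xt"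
      using shift_mor[OF Xr X e(1)] .
    note Te = Trm_mor[OF Xr X e(1)]
    note STe = shift_mor[OF TXr T Te, of t]
    have sum: "?e (real (Suc n) * t) Y = ?c (?S (sh C ?r Y)) (?S Y) Y
        (?F (sh C ?r Y) Y (?e ?r Y)) (?e t Y)" if "Y \<in> Ob C" for Y
      using eta_map_add[OF that r, of t] t eta_map_shift[OF that r] that by (simp add: shift_add_ob algebra_simps)
    have sh: "sh C (real (Suc n) * t) Y = ?S (sh C ?r Y)" if "Y \<in> Ob C" for Y
      using that by (simp add: shift_add_ob algebra_simps)
    have "?c (?S (?T ?Xr)) (?T (?S ?Xr)) ?K (\<phi> ?Xr) (?M (?S ?Xr) X (?e (real (Suc n) * t) X))
      = ?c (?S (?T ?Xr)) (?T ?Xt) ?K (?c (?S (?T ?Xr)) (?T (?S ?Xr)) (?T ?Xt)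
          (\<phi> ?Xr) (?M (?S ?Xr) ?Xt (?F ?Xr X (?e ?r X)))) (?M ?Xt X (?e t X))"
      unfolding sum[OF X] Trm_cmp[OF Xrt Xt X Se e(2)]
      using assoc0[OF sTXr TXrt TXt T phi[OF Xr] Trm_mor[OF Xrt Xt Se] Trm_mor[OF Xt X e(2)]] by simp
    also have "\<dots> = ?c (?S (?T ?Xr)) (?S ?K) ?K (?F (?T ?Xr) ?K (?M ?Xr X (?e ?r X)))
          (?c (?S ?K) ?K ?K (?e t ?K) w)"
      unfolding nat[OF Xr X e(1), symmetric] w(2)[symmetric]
      using assoc0[OF sTXr sTX TXt T STe phi[OF X] Trm_mor[OF Xt X e(2)]] by simp
    also have "\<dots> = ?c (?S (?T ?Xr)) ?K ?K (?c (?S (?T ?Xr)) (?T ?Xr) ?K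
        (?e t (?T ?Xr)) (?M ?Xr X (?e ?r X))) w"
      using assoc0[OF sTXr sTX T T STe e(3) w(1)] eta_map_natural[OF TXr T Te, of t] t by simp
    also have "\<dots> = ?c (?S (?T ?Xr)) ?K ?K (?c (?S (?T ?Xr)) (?S (sh C ?r ?K)) ?K
        (?F (?T ?Xr) (sh C ?r ?K) b) (?e (real (Suc n) * t) ?K)) (?c ?K ?K ?K v w)"
      (is "?l = ?rr")
    proof -
      let ?Y = "?T ?Xr" let ?Kr = "sh C ?r ?K"
      have Kr: "?Kr \<in> Ob C" and Krt: "?S ?Kr \<in> Ob C" and Yt: "?S ?Y \<in> Ob C" using sh_Ob T TXr by auto
      have n: "?e t ?Y \<in> mor C 0 (?S ?Y) ?Y" "?e t ?Kr \<in> mor C 0 (?S ?Kr) ?Kr"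
        using eta_map_mor TXr Kr t by auto
      note Sb = shift_mor[OF TXr Kr b, of t]
      have be: "?c ?Y ?Kr ?K b (?e ?r ?K) \<in> mor C 0 ?Y ?K" using cmp0[OF TXr Kr T b e(4)] .
      have "?c (?S ?Y) ?Y ?K (?e t ?Y) (?c ?Y ?Kr ?K b (?e ?r ?K))
        = ?c (?S ?Y) ?Kr ?K (?c (?S ?Y) (?S ?Kr) ?Kr (?F ?Y ?Kr b) (?e t ?Kr)) (?e ?r ?K)"
        using assoc0[OF Yt TXr Kr T n(1) b e(4)] eta_map_natural[OF TXr Kr b, of t] t by simp
      also have "\<dots> = ?c (?S ?Y) (?S ?Kr) ?K (?F ?Y ?Kr b) (?c (?S ?Kr) ?Kr ?K (?e t ?Kr) (?e ?r ?K))"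
        using assoc0[OF Yt Krt Kr T Sb n(2) e(4)] .
      also have "?c (?S ?Kr) ?Kr ?K (?e t ?Kr) (?e ?r ?K) = ?e (real (Suc n) * t) ?K"
        using eta_map_add[OF T _ r, of t] t T by (simp add: shift_add_ob algebra_simps)
      finally have 1: "?c (?S ?Y) ?Y ?K (?e t ?Y) (?c ?Y ?Kr ?K b (?e ?r ?K))
        = ?c (?S ?Y) (?S ?Kr) ?K (?F ?Y ?Kr b) (?e (real (Suc n) * t) ?K)" .
      have "?c (?S ?Y) ?Y ?K (?e t ?Y) (?M ?Xr X (?e ?r X))
        = ?c (?S ?Y) ?K ?K (?c (?S ?Y) (?S ?Kr) ?K (?F ?Y ?Kr b) (?e (real (Suc n) * t) ?K)) v"
        unfolding eq 1[symmetric] using assoc0[OF Yt TXr T T n(1) be v] by simp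
      then show "?l = ?rr"
        using assoc0[OF Yt T T T _ v w(1)] cmp0[OF Yt TXr T n(1) be] 1 by simp
    qed
    finally have eq': "?c (?S (?T ?Xr)) (?T (?S ?Xr)) ?K (\<phi> ?Xr) (?M (?S ?Xr) X (?e (real (Suc n) * t) X))
      = ?c (?S (?T ?Xr)) ?K ?K (?c (?S (?T ?Xr)) (?S (sh C ?r ?K)) ?K
        (?F (?T ?Xr) (sh C ?r ?K) b) (?e (real (Suc n) * t) ?K)) (?c ?K ?K ?K v w)" .
    let ?b = "?F (?T ?Xr) (sh C ?r ?K) b"
    let ?N = "real (Suc n) * t"
    have Kr: "sh C ?r ?K \<in> Ob C" "?S (sh C ?r ?K) \<in> Ob C" using sh_Ob T by auto
    note Sb = shift_mor[OF TXr Kr(1) b, of t]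
    have N: "?e ?N X \<in> mor C 0 (?S ?Xr) X" "?e ?N ?K \<in> mor C 0 (?S (sh C ?r ?K)) ?K"
      using eta_map_mor[OF X, of ?N] eta_map_mor[OF T, of ?N] t sh[OF X] sh[OF T] by auto
    note TN = Trm_mor[OF Xrt X N(1)]
    note vw = cmp0[OF T T T v w(1)]
    have "?M (?S ?Xr) X (?e ?N X) = ?c (?T (?S ?Xr)) (?S (?T ?Xr)) ?K (\<psi> ?Xr)
       (?c (?S (?T ?Xr)) (?T (?S ?Xr)) ?K (\<phi> ?Xr) (?M (?S ?Xr) X (?e ?N X)))"
      using assoc0[OF TXrt sTXr TXrt T psi[OF Xr] phi[OF Xr] TN] inv(2)[OF Xr] idn_left[OF TXrt T TN] by simp
    also have "\<dots> = ?c (?T (?S ?Xr)) ?K ?K (?c (?T (?S ?Xr)) (?S (sh C ?r ?K)) ?K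
        (?c (?T (?S ?Xr)) (?S (?T ?Xr)) (?S (sh C ?r ?K)) (\<psi> ?Xr) ?b) (?e ?N ?K)) (?c ?K ?K ?K v w)"
      unfolding eq' using assoc0[OF TXrt sTXr T T psi[OF Xr] cmp0[OF sTXr Kr(2) T Sb N(2)] vw]
        assoc0[OF TXrt sTXr Kr(2) T psi[OF Xr] Sb N(2)] by simp
    finally show ?case
      unfolding sh[OF X] sh[OF T] using cmp0[OF TXrt sTXr Kr(2) psi[OF Xr] Sb] vw by blast
  qed
  obtain r where r: "0 \<le> r" "acyclic_of C r ?K" using ac by (auto simp: acyclics_def)
  obtain n where n: "r \<le> real n * t" using t ex_less_of_nat_mult[OF t, of r] by (auto intro: less_imp_le)
  let ?N = "real n * t"
  have N: "?N \<ge> 0" using t by simp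
  have z: "?e ?N ?K = zr 0 (sh C ?N ?K) ?K"
    using acyclic_iff_eta_map[OF T N] acyclic_of_mono[OF r(2,1) n] by simp
  obtain b v where b: "b\<in>mor C 0 (?T (sh C ?N X)) (sh C ?N ?K)" and v: "v\<in>mor C 0 ?K ?K"
    and eq: "?M (sh C ?N X) X (?e ?N X) = ?c (?T (sh C ?N X)) ?K ?K
       (?c (?T (sh C ?N X)) (sh C ?N ?K) ?K b (?e ?N ?K)) v"
    using step by blast
  have "?M (sh C ?N X) X (?e ?N X) = zr 0 (?T (sh C ?N X)) ?K"
    unfolding eq z using cmp_zr_right[OF Tr_Ob[OF sh_Ob[OF X]] sh_Ob[OF T] T b, of 0]
      cmp_zr_left[OF Tr_Ob[OF sh_Ob[OF X]] T T v, of 0] by simp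
  then have "?e ?N X = zr 0 (sh C ?N X) X"
    using Trm_inj[OF sh_Ob[OF X] X eta_map_mor[OF X N] zero_mor[OF sh_Ob[OF X] X]] Trm_zr[OF sh_Ob[OF X] X] by simp
  then show ?thesis
    using acyclic_iff_eta_map[OF X N] N X by (auto simp: acyclics_def)
qed

end

context triangulated_persistence_category
begin

subsection \<open>Null morphisms and acyclic cones\<close>

text \<open>A null morphism is killed by some \<open>\<eta>\<^sub>r\<^sup>A\<close>, hence factors through the acyclic cone \<open>Q\<^sub>r\<^sub>,\<^sub>A\<close>. In this form nullity can be moved along \<open>T\<close>.\<close>

lemma null_factor:
  assumes A: "A \<in> Ob C" and B: "B \<in> Ob C" and f: "null C 0 A B f"
  shows "\<exists>Q\<in>acyclics C. \<exists>g\<in>mor C 0 A Q. \<exists>s\<in>mor C 0 Q B. f = cmp C 0 0 A Q B g s"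
proof -
  obtain r where r: "0 \<le> r" "inc C 0 r A B f = zr r A B" and m: "f \<in> mor C 0 A B" using f by (auto simp: null_def)
  obtain Q where Q: "is_cone_eta C r A Q" using cone_eta[OF A r(1)] by blast
  then obtain g h where tri: "(sh C r A, A, Q, eta_map C r A, g, h) \<in> Tri C" by (auto simp: is_cone_eta_def)
  have "cmp C 0 0 (sh C r A) A B (eta_map C r A) f = zr 0 (sh C r A) B"
    using eta_map_cmp_zero_iff[OF A B m r(1)] r(2) by simp
  then show ?thesis
    using factor_out[OF tri B m] cone_eta_acyclic[OF Q r(1)] Tri_typed[OF tri] by blast
qed

lemma null_translate:
  assumes A: "A \<in> Ob C" and B: "B \<in> Ob C" and f: "null C 0 A B f"
  shows "null C 0 (Tr C A) (Tr C B) (Trm C A B f)"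
proof -
  obtain Q g s where Q: "Q \<in> acyclics C" and g: "g \<in> mor C 0 A Q" and s: "s \<in> mor C 0 Q B" and f: "f = cmp C 0 0 A Q B g s"
    using null_factor[OF assms] by blast
  note Ob = acyclics_Ob[OF Q] acyclics_Ob[OF acyclic_translate[OF Q]]
  show ?thesis
    unfolding f Trm_cmp[OF A Ob(1) B g s]
    using null_cmp_left[OF Tr_Ob[OF A] Ob(2) Tr_Ob[OF B] null_to_acyclic[OF acyclic_translate[OF Q] Tr_Ob[OF A] Trm_mor[OF A Ob(1) g]]
        Trm_mor[OF Ob(1) B s]] by simp
qed

lemma null_untranslate:
  assumes A: "A \<in> Ob C" and B: "B \<in> Ob C" and m: "f \<in> mor C 0 A B" and f: "null C 0 (Tr C A) (Tr C B) (Trm C A B f)"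
  shows "null C 0 A B f"
proof -
  obtain Q' g' s' where Q': "Q' \<in> acyclics C" and g': "g' \<in> mor C 0 (Tr C A) Q'" and s': "s' \<in> mor C 0 Q' (Tr C B)"
    and f': "Trm C A B f = cmp C 0 0 (Tr C A) Q' (Tr C B) g' s'"
    using null_factor[OF Tr_Ob[OF A] Tr_Ob[OF B] f] by blast
  obtain Q where Q: "Q \<in> Ob C" "Q' = Tr C Q" using C0.Tob_surj[of Q'] acyclics_Ob[OF Q'] by auto
  have ac: "Q \<in> acyclics C" using acyclic_untranslate Q Q' by blast
  obtain g s where g: "g \<in> mor C 0 A Q" "g' = Trm C A Q g" and s: "s \<in> mor C 0 Q B" "s' = Trm C Q B s"
    using Trm_surj[OF A Q(1), of g'] Trm_surj[OF Q(1) B, of s'] g' s' Q(2) by blast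
  have "Trm C A B f = Trm C A B (cmp C 0 0 A Q B g s)"
    unfolding f' Q(2) g(2) s(2) Trm_cmp[OF A Q(1) B g(1) s(1)] ..
  then have "f = cmp C 0 0 A Q B g s" using Trm_inj[OF A B m cmp0[OF A Q(1) B g(1) s(1)]] by simp
  then show ?thesis
    using null_cmp_left[OF A Q(1) B null_to_acyclic[OF ac A g(1)] s(1)] by simp
qed

text \<open>A morphism with acyclic cone is an epimorphism of \<open>C\<^sub>\<infinity>\<close>, and one with acyclic fibre is a monomorphism.\<close>

lemma null_of_cmp_zero:
  assumes "(A, B, Z, f, g, h) \<in> Tri C" "Z \<in> acyclics C" "W \<in> Ob C" "d \<in> mor C s B W" "cmp C 0 s A B W f d = zr s A W"
  shows "null C s B W d"
proof -
  have B: "B \<in> Ob C" and Z: "Z \<in> Ob C" and g: "g \<in> mor C 0 B Z" using Tri_typed[OF assms(1)] by auto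
  obtain u where u: "u \<in> mor C s Z W" "d = cmp C 0 s B Z W g u"
    using factor_out[OF assms(1,3-5)] by blast
  show ?thesis
    using null_cmp_right[OF B Z assms(3) g null_from_acyclic[OF assms(2,3) u(1)]] u(2) by simp
qed

lemma null_of_cmp_zero2:
  assumes "(X, Y, Z, f, g, h) \<in> Tri C" "X \<in> acyclics C" "W \<in> Ob C" "d \<in> mor C s W Y" "cmp C s 0 W Y Z d g = zr s W Z"
  shows "null C s W Y d"
proof -
  have X: "X \<in> Ob C" and Y: "Y \<in> Ob C" and f: "f \<in> mor C 0 X Y" using Tri_typed[OF assms(1)] by auto
  obtain u where u: "u \<in> mor C s W X" "d = cmp C s 0 W X Y u f"
    using factor_in[OF assms(1,3-5)] by blast
  show ?thesis
    using null_cmp_left[OF assms(3) X Y null_to_acyclic[OF assms(2,3) u(1)] f] u(2) by simp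
qed

subsection \<open>Isomorphisms of the colimit category\<close>

lemma inc_idn_cmp:
  assumes "X \<in> Ob C" "Y \<in> Ob C" "f \<in> mor C s X Y" "r \<ge> 0"
  shows "cmp C r s X X Y (inc C 0 r X X (idn C X)) f = inc C s (r + s) X Y f"
  using inc_cmp_left[OF assms(1,1,2) idn_closed[OF assms(1)] assms(3,4)] idn_left[OF assms(1-3)] by simp

lemma inc_cmp_idn:
  assumes "X \<in> Ob C" "Y \<in> Ob C" "f \<in> mor C s X Y" "r \<ge> 0"
  shows "cmp C s r X Y Y f (inc C 0 r Y Y (idn C Y)) = inc C s (s + r) X Y f"
  using inc_cmp_right[OF assms(1,2,2,3) idn_closed[OF assms(2)] assms(4)] idn_right[OF assms(1-3)] by simp

text \<open>Let \<open>p : B \<rightarrow> Z\<close> and \<open>q : Z \<rightarrow> T\<Sigma>\<^sup>\<alpha>A\<close> be the maps next to the cone. Since \<open>f\<close> is invertible in \<open>C\<^sub>\<infinity>\<close>, both are null. Hence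
  in a high degree the identity of \<open>Z\<close> dies on \<open>B\<close>, so it factors through \<open>q\<close> and is null.\<close>

lemma iso_cone_acyclic:
  assumes A: "A \<in> Ob C" and B: "B \<in> Ob C" and f: "f \<in> mor C \<alpha> A B" and g: "g \<in> mor C \<beta> B A"
    and c1: "\<alpha> + \<beta> \<le> \<gamma>" "0 \<le> \<gamma>" "inc C (\<alpha> + \<beta>) \<gamma> A A (cmp C \<alpha> \<beta> A B A f g) = inc C 0 \<gamma> A A (idn C A)"
    and c2: "\<beta> + \<alpha> \<le> \<delta>" "0 \<le> \<delta>" "inc C (\<beta> + \<alpha>) \<delta> B B (cmp C \<beta> \<alpha> B A B g f) = inc C 0 \<delta> B B (idn C B)"
    and tri: "(sh C \<alpha> A, B, Z, cmp C (- \<alpha>) \<alpha> (sh C \<alpha> A) A B (eta C \<alpha> 0 A) f, p, q) \<in> Tri C"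
  shows "Z \<in> acyclics C"
proof -
  let ?S = "sh C \<alpha> A"
  let ?f = "cmp C (- \<alpha>) \<alpha> ?S A B (eta C \<alpha> 0 A) f"
  have S: "?S \<in> Ob C" using sh_Ob[OF A] .
  have Z: "Z \<in> Ob C" and p: "p \<in> mor C 0 B Z" and q: "q \<in> mor C 0 Z (Tr C ?S)" and f': "?f \<in> mor C 0 ?S B"
    using Tri_typed[OF tri] by auto
  note e = eta_to[OF A, of \<alpha>]
  have fp: "cmp C 0 0 ?S B Z ?f p = zr 0 ?S Z" using C0.tri_cmp_zero[of ?S B Z ?f p q] tri by simp
  have "cmp C \<alpha> 0 A B Z f p = zr \<alpha> A Z"
  proof -
    have m: "cmp C \<alpha> 0 A B Z f p \<in> mor C \<alpha> A Z" using cmp_mor[OF A B Z f p] by simp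
    have "cmp C (- \<alpha>) \<alpha> ?S A Z (eta C \<alpha> 0 A) (cmp C \<alpha> 0 A B Z f p) = zr 0 ?S Z"
      using cmp_assoc[OF S A B Z e f p] fp by simp
    then have "cmp C \<alpha> 0 A ?S Z (eta C 0 \<alpha> A) (zr 0 ?S Z) = cmp C \<alpha> 0 A B Z f p"
      using eta_from_to_cmp[OF Z A m, of \<alpha>] by simp
    then show ?thesis using cmp_zr_right[OF A S Z eta_from[OF A], of 0] by simp
  qed
  then have "cmp C (\<beta> + \<alpha>) 0 B B Z (cmp C \<beta> \<alpha> B A B g f) p = zr (\<beta> + \<alpha>) B Z"
    using cmp_assoc[OF B A B Z g f p] cmp_zr_right[OF B A Z g, of \<alpha>] by simp
  then have p0: "inc C 0 \<delta> B Z p = zr \<delta> B Z"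
    using inc_cmp_left[OF B B Z cmp_mor[OF B A B g f refl] p c2(1)] c2(3) inc_idn_cmp[OF B Z p c2(2)]
      inc_zr[OF B Z c2(1)] by simp
  \<comment> \<open>an inverse of \<open>f\<close>, moved to degree 0, turns \<open>f\<close> into \<open>\<eta>\<^sub>\<gamma>\<close> at \<open>\<Sigma>\<^sup>\<alpha>\<^sup>-\<^sup>\<gamma>A\<close>; then \<open>q\<close> is killed by its translate and factors through \<open>Q\<^sub>\<gamma>\<close>\<close>
  have qn: "null C 0 Z (Tr C ?S) q"
  proof -
    let ?V = "sh C (\<alpha> - \<gamma>) A"
    let ?g = "inc C \<beta> (\<gamma> - \<alpha>) B A g"
    have V: "?V \<in> Ob C" using sh_Ob[OF A] .
    have g1: "?g \<in> mor C (\<gamma> - \<alpha>) B A" using inc_mor[OF B A _ g] c1(1) by simp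
    have e2: "eta C 0 (\<alpha> - \<gamma>) A \<in> mor C (\<alpha> - \<gamma>) A ?V" using eta_from[OF A] .
    let ?g' = "cmp C (\<gamma> - \<alpha>) (\<alpha> - \<gamma>) B A ?V ?g (eta C 0 (\<alpha> - \<gamma>) A)"
    have g': "?g' \<in> mor C 0 B ?V" using cmp_mor[OF B A V g1 e2] by simp
    have fg: "cmp C \<alpha> (\<gamma> - \<alpha>) A B A f ?g = inc C 0 \<gamma> A A (idn C A)"
      using inc_cmp_right[OF A B A f g, of "\<gamma> - \<alpha>"] c1 by simp
    have i: "inc C 0 \<gamma> A A (idn C A) \<in> mor C \<gamma> A A" using inc_mor[OF A A c1(2) idn_closed[OF A]] .
    have "cmp C 0 0 ?S B ?V ?f ?g' = cmp C (- \<alpha>) \<alpha> ?S A ?V (eta C \<alpha> 0 A) (cmp C \<alpha> 0 A B ?V f ?g')"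
      using cmp_assoc[OF S A B V e f g'] by simp
    also have "cmp C \<alpha> 0 A B ?V f ?g' = cmp C \<gamma> (\<alpha> - \<gamma>) A A ?V (inc C 0 \<gamma> A A (idn C A)) (eta C 0 (\<alpha> - \<gamma>) A)"
      using cmp_assoc[OF A B A V f g1 e2] fg by simp
    also have "\<dots> = inc C (\<alpha> - \<gamma>) \<alpha> A ?V (eta C 0 (\<alpha> - \<gamma>) A)"
      using inc_idn_cmp[OF A V e2 c1(2)] by simp
    also have "cmp C (- \<alpha>) \<alpha> ?S A ?V (eta C \<alpha> 0 A) \<dots> = inc C (- \<gamma>) 0 ?S ?V (eta C \<alpha> (\<alpha> - \<gamma>) A)"
      using inc_cmp_right[OF S A V e e2, of \<alpha>] eta_trans[OF A, of 0 \<alpha> "\<alpha> - \<gamma>"] c1(2) A by (simp add: shift_0_ob)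
    also have "\<dots> = eta_map C \<gamma> ?V"
      unfolding eta_map_def using eta_shift[OF A, of \<gamma> 0 "\<alpha> - \<gamma>"] A by (simp add: shift_add_ob)
    finally have fg': "cmp C 0 0 ?S B ?V ?f ?g' = eta_map C \<gamma> ?V" .
    obtain Q where Q: "is_cone_eta C \<gamma> ?V Q" using cone_eta[OF V c1(2)] by blast
    then obtain u v where tri': "(?S, ?V, Q, eta_map C \<gamma> ?V, u, v) \<in> Tri C"
      using A by (auto simp: is_cone_eta_def shift_add_ob)
    have ty': "Q \<in> Ob C" "v \<in> mor C 0 Q (Tr C ?S)" using Tri_typed[OF tri'] by auto
    have "cmp C 0 0 Z (Tr C ?S) (Tr C B) q (Trm C ?S B ?f) = zr 0 Z (Tr C B)"
      using C0.tri_cmp_zero3[of ?S B Z ?f p q] tri by simp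
    then have "cmp C 0 0 Z (Tr C ?S) (Tr C ?V) q (Trm C ?S ?V (eta_map C \<gamma> ?V)) = zr 0 Z (Tr C ?V)"
      unfolding fg'[symmetric] Trm_cmp[OF S B V f' g']
      using assoc0[OF Z Tr_Ob[OF S] Tr_Ob[OF B] Tr_Ob[OF V] q Trm_mor[OF S B f'] Trm_mor[OF B V g']]
        cmp_zr_left[OF Z Tr_Ob[OF B] Tr_Ob[OF V] Trm_mor[OF B V g'], of 0] by simp
    then obtain w where w: "w \<in> mor C 0 Z Q" "q = cmp C 0 0 Z Q (Tr C ?S) w v"
      using factor_in3[OF tri' Z q] by blast
    show ?thesis
      using null_cmp_left[OF Z ty'(1) Tr_Ob[OF S] null_to_acyclic[OF cone_eta_acyclic[OF Q c1(2)] Z w(1)] ty'(2)] w(2) by simp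
  qed
  let ?i = "inc C 0 \<delta> Z Z (idn C Z)"
  have i: "?i \<in> mor C \<delta> Z Z" using inc_mor[OF Z Z c2(2) idn_closed[OF Z]] .
  have "cmp C 0 \<delta> B Z Z p ?i = zr \<delta> B Z" using inc_cmp_idn[OF B Z p c2(2)] p0 by simp
  then obtain w where w: "w \<in> mor C \<delta> (Tr C ?S) Z" "?i = cmp C 0 \<delta> Z (Tr C ?S) Z q w"
    using factor_out2[OF tri Z i] by blast
  have "null C \<delta> Z Z ?i"
    using null_cmp_left[OF Z Tr_Ob[OF S] Z qn w(1)] w(2) by simp
  then show ?thesis
    using null_inc_iff[OF Z Z idn_closed[OF Z] c2(2)] Z by (simp add: acyclics_iff)
qed

end

subsection \<open>The relations of the K-groups\<close>

text \<open>The relations of \<open>K\<^sub>\<infinity>\<close>: those of \<open>K(C\<^sub>0)\<close> together with the vanishing of acyclic objects.\<close>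

definition R_acyclic :: "('k, 'o, 'm) tpc \<Rightarrow> ('o \<Rightarrow>\<^sub>0 int) set"
  where "R_acyclic C = {x + y | x y. x \<in> R_tri (C_zero C) \<and> Poly_Mapping.keys y \<subseteq> acyclics C}"

context triangulated_persistence_category
begin

lemma sub_R0: "is_subgroup (R_tri (C_zero C))"
  by (rule R_tri_subgroup[OF C0.tri_objects])

lemma tri_objects_AC: "tri_objects (AC_zero C)"
  by (simp add: AC_zero_def tri_objects_full)

lemma sub_RA: "is_subgroup (R_tri (AC_zero C))"
  by (rule R_tri_subgroup[OF tri_objects_AC])

lemma AC_tri_iff: "(A, B, E, f, g, h) \<in> ttri (AC_zero C) \<longleftrightarrow>
    (A, B, E, f, g, h) \<in> Tri C \<and> A \<in> acyclics C \<and> B \<in> acyclics C \<and> E \<in> acyclics C"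
  by (simp add: AC_zero_def full_tri_sub_def)

lemma tob_AC [simp]: "tob (AC_zero C) = acyclics C"
  by (simp add: AC_zero_def full_tri_sub_def)

lemma R0_rel: "(A, B, E, f, g, h) \<in> Tri C \<Longrightarrow> frag_of B - (frag_of A + frag_of E) \<in> R_tri (C_zero C)"
  using R_tri_rel[of A B E f g h "C_zero C"] by simp

lemma RA_rel: "(A, B, E, f, g, h) \<in> Tri C \<Longrightarrow> A \<in> acyclics C \<Longrightarrow> B \<in> acyclics C \<Longrightarrow> E \<in> acyclics C \<Longrightarrow>
    frag_of B - (frag_of A + frag_of E) \<in> R_tri (AC_zero C)"
  using R_tri_rel[of A B E f g h "AC_zero C"] AC_tri_iff by blast

lemma RA_R0: "R_tri (AC_zero C) \<subseteq> R_tri (C_zero C)"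
  by (rule R_tri_least[OF tri_objects_AC sub_R0]) (auto simp: AC_tri_iff intro: R0_rel)

lemma sub_Rac: "is_subgroup (R_acyclic C)"
proof -
  have "\<exists>u v. x + y - (x' + y') = u + v \<and> u \<in> R_tri (C_zero C) \<and> Poly_Mapping.keys v \<subseteq> acyclics C"
    if "x \<in> R_tri (C_zero C)" "x' \<in> R_tri (C_zero C)" "Poly_Mapping.keys y \<subseteq> acyclics C" "Poly_Mapping.keys y' \<subseteq> acyclics C"
    for x y x' y'
    using that subgroup_diff[OF sub_R0 that(1,2)] subgroup_diff[OF subgroup_keys, of y "acyclics C" y']
    by (intro exI[of _ "x - x'"] exI[of _ "y - y'"]) simp
  moreover have "(0 :: 'o \<Rightarrow>\<^sub>0 int) = 0 + 0" "Poly_Mapping.keys (0 :: 'o \<Rightarrow>\<^sub>0 int) \<subseteq> acyclics C" by auto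
  ultimately show ?thesis
    unfolding is_subgroup_def R_acyclic_def using subgroup_zero[OF sub_R0] by blast
qed

lemma R0_Rac: "x \<in> R_tri (C_zero C) \<Longrightarrow> x \<in> R_acyclic C"
  unfolding R_acyclic_def by (intro CollectI exI[of _ x] exI[of _ 0]) simp

lemma acyclic_Rac: "Poly_Mapping.keys y \<subseteq> acyclics C \<Longrightarrow> y \<in> R_acyclic C"
  unfolding R_acyclic_def using subgroup_zero[OF sub_R0] by (intro CollectI exI[of _ 0] exI[of _ y]) simp

lemma Rac_least:
  assumes "is_subgroup H" "R_tri (C_zero C) \<subseteq> H" "\<And>A. A \<in> acyclics C \<Longrightarrow> frag_of A \<in> H"
  shows "R_acyclic C \<subseteq> H"
  unfolding R_acyclic_def using subgroup_add[OF assms(1)] frag_span[OF assms(1,3)] assms(2) by auto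

lemma Rac_Ob: "x \<in> R_acyclic C \<Longrightarrow> Poly_Mapping.keys x \<subseteq> Ob C"
  using Rac_least[OF subgroup_keys[of "Ob C"]] R_tri_carrier[OF C0.tri_objects] acyclics_Ob by auto

text \<open>Zero objects are acyclic, so all relations among acyclic objects below take place inside \<open>AC\<^sub>0\<close>.\<close>

lemma zero_object_acyclic: "is_zero_object (C_zero C) Z \<Longrightarrow> Z \<in> acyclics C"
  using null_zr[of Z Z 0] by (auto simp: is_zero_object_def acyclics_iff)

lemma obtain_zero: obtains Z where "is_zero_object (C_zero C) Z" "Z \<in> acyclics C" "Z \<in> Ob C"
  using C0.zero_object zero_object_acyclic acyclics_Ob by blast

lemma zero_rel_RA: assumes "is_zero_object (C_zero C) Z" shows "frag_of Z \<in> R_tri (AC_zero C)"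
proof -
  have Z: "Z \<in> acyclics C" "Z \<in> Ob C" using zero_object_acyclic[OF assms] acyclics_Ob by auto
  have "frag_of Z - (frag_of Z + frag_of Z) \<in> R_tri (AC_zero C)"
    using C0.tri_idn[of Z Z] assms Z RA_rel[of Z Z Z "idn C Z" "zr 0 Z Z" "zr 0 Z (Tr C Z)"] by simp
  then show ?thesis using subgroup_uminus_iff[OF sub_RA] by simp
qed

lemma iso_rel_tri:
  assumes "isomorphic_in (C_zero C) X Y"
  shows "frag_of X - frag_of Y \<in> R_tri (C_zero C)"
    and "X \<in> acyclics C \<Longrightarrow> Y \<in> acyclics C \<Longrightarrow> frag_of X - frag_of Y \<in> R_tri (AC_zero C)"
proof -
  obtain Z where Z: "is_zero_object (C_zero C) Z" "Z \<in> acyclics C" by (rule obtain_zero)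
  obtain f where f: "is_iso_in (C_zero C) X Y f" using assms by (auto simp: isomorphic_in_def)
  obtain g h where tri: "(X, Y, Z, f, g, h) \<in> Tri C" using C0.tri_of_iso[OF f Z(1)] that by simp
  have *: "frag_of X - frag_of Y \<in> H" if "is_subgroup H" "frag_of Y - (frag_of X + frag_of Z) \<in> H" "frag_of Z \<in> H"
    for H :: "('o \<Rightarrow>\<^sub>0 int) set"
    using subgroup_uminus[OF that(1) subgroup_add[OF that]] by simp
  show "frag_of X - frag_of Y \<in> R_tri (C_zero C)"
    using * [OF sub_R0 R0_rel[OF tri]] zero_rel_RA[OF Z(1)] RA_R0 by blast
  show "frag_of X - frag_of Y \<in> R_tri (AC_zero C)" if "X \<in> acyclics C" "Y \<in> acyclics C"
    using * [OF sub_RA RA_rel[OF tri that(1,2) Z(2)] zero_rel_RA[OF Z(1)]] .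
qed

text \<open>By the octahedron two cones of the same morphism differ by a zero object.\<close>

lemma cones_rel_RA:
  assumes "(X, Y, Z, f, g, h) \<in> Tri C" "(X, Y, Z', f, g', h') \<in> Tri C" "Z \<in> acyclics C" "Z' \<in> acyclics C"
  shows "frag_of Z' - frag_of Z \<in> R_tri (AC_zero C)"
proof -
  obtain Q where Q: "is_zero_object (C_zero C) Q" "Q \<in> acyclics C" by (rule obtain_zero)
  obtain a b c where "(Z, Z', Q, a, b, c) \<in> Tri C"
    using C0.cones_triangle[OF _ _ Q(1), of X Y Z f g h Z' g' h'] assms by auto
  then have "frag_of Z' - (frag_of Z + frag_of Q) \<in> R_tri (AC_zero C)" using RA_rel assms Q by blast
  then show ?thesis using subgroup_add[OF sub_RA _ zero_rel_RA[OF Q(1)]] by fastforce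
qed

lemma translate_rel_RA:
  assumes "X \<in> acyclics C" shows "frag_of (Tr C X) + frag_of X \<in> R_tri (AC_zero C)"
proof -
  obtain Z where Z: "is_zero_object (C_zero C) Z" "Z \<in> acyclics C" by (rule obtain_zero)
  obtain h where "(X, Z, Tr C X, zr 0 X Z, zr 0 Z (Tr C X), h) \<in> Tri C"
    using C0.tri_zero_middle[OF Z(1), of X] acyclics_Ob[OF assms] by auto
  then have "frag_of Z - (frag_of X + frag_of (Tr C X)) \<in> R_tri (AC_zero C)"
    using RA_rel assms Z acyclic_translate by blast
  then have "frag_of Z - (frag_of X + frag_of (Tr C X)) - frag_of Z \<in> R_tri (AC_zero C)"
    using subgroup_diff[OF sub_RA] zero_rel_RA[OF Z(1)] by blast
  then show ?thesis using subgroup_uminus_iff[OF sub_RA, of "frag_of X + frag_of (Tr C X)"] by (simp add: add.commute)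
qed

text \<open>For \<open>r \<ge> 0\<close> the two objects differ by the acyclic cone of \<open>\<eta>\<^sub>r\<^sup>X\<close>; a negative shift is undone by a positive one.\<close>

lemma shift_rel_Rac: assumes X: "X \<in> Ob C" shows "frag_of (sh C r X) - frag_of X \<in> R_acyclic C"
proof -
  have pos: "frag_of (sh C r X) - frag_of X \<in> R_acyclic C" if X: "X \<in> Ob C" and r: "r \<ge> 0" for X r
  proof -
    obtain Q where Q: "is_cone_eta C r X Q" using cone_eta[OF X r] by blast
    then obtain g h where "(sh C r X, X, Q, eta_map C r X, g, h) \<in> Tri C" by (auto simp: is_cone_eta_def)
    then have 1: "frag_of X - (frag_of (sh C r X) + frag_of Q) \<in> R_acyclic C" using R0_rel R0_Rac by blast
    have 2: "frag_of Q \<in> R_acyclic C" using cone_eta_acyclic[OF Q r] by (intro acyclic_Rac) simp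
    show ?thesis using subgroup_uminus[OF sub_Rac subgroup_add[OF sub_Rac 1 2]] by simp
  qed
  show ?thesis
  proof (cases "r \<ge> 0")
    case True
    then show ?thesis using pos X by blast
  next
    case False
    then have "frag_of X - frag_of (sh C r X) \<in> R_acyclic C"
      using pos[of "sh C r X" "- r"] X by (simp add: sh_Ob shift_add_ob shift_0_ob)
    then show ?thesis using subgroup_minus_commute[OF sub_Rac] by blast
  qed
qed

lemma colim_iso_rel_Rac:
  assumes "A \<in> Ob C" "B \<in> Ob C" "f \<in> mor C \<alpha> A B" "g \<in> mor C \<beta> B A"
    "\<alpha> + \<beta> \<le> \<gamma>" "0 \<le> \<gamma>" "inc C (\<alpha> + \<beta>) \<gamma> A A (cmp C \<alpha> \<beta> A B A f g) = inc C 0 \<gamma> A A (idn C A)"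
    "\<beta> + \<alpha> \<le> \<delta>" "0 \<le> \<delta>" "inc C (\<beta> + \<alpha>) \<delta> B B (cmp C \<beta> \<alpha> B A B g f) = inc C 0 \<delta> B B (idn C B)"
  shows "frag_of B - frag_of A \<in> R_acyclic C"
proof -
  let ?f = "cmp C (- \<alpha>) \<alpha> (sh C \<alpha> A) A B (eta C \<alpha> 0 A) f"
  have "?f \<in> mor C 0 (sh C \<alpha> A) B" by (rule cmp_mor[OF sh_Ob[OF assms(1)] assms(1,2) eta_to[OF assms(1)] assms(3)]) simp
  then obtain Z p q where tri: "(sh C \<alpha> A, B, Z, ?f, p, q) \<in> Tri C"
    using C0.tri_cone[of "sh C \<alpha> A" B ?f] sh_Ob assms(1,2) by auto
  have "Z \<in> acyclics C" by (rule iso_cone_acyclic[OF assms tri])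
  then have Z: "frag_of Z \<in> R_acyclic C" by (intro acyclic_Rac) simp
  have 1: "frag_of B - (frag_of (sh C \<alpha> A) + frag_of Z) \<in> R_acyclic C" using R0_rel[OF tri] R0_Rac by blast
  show ?thesis
    using subgroup_add[OF sub_Rac subgroup_add[OF sub_Rac 1 Z] shift_rel_Rac[OF assms(1), of \<alpha>]] by simp
qed

end

subsection \<open>Triangles of the colimit category\<close>

lemma C_inf_simps [simp]: "tob (C_inf C) = Ob C"
  by (simp add: C_inf_def C_inf_cat_def Let_def)

lemma C_inf_cat_simps [simp]:
  "tob (C_inf_cat C) = Ob C" "tcmp (C_inf_cat C) = colim_cmp C" "Tmor (C_inf_cat C) = colim_T C"
  "tmor (C_inf_cat C) A B = carrier (colim_hom C A B)"
  by (simp_all add: C_inf_cat_def tmor_def)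

lemma C_inf_triI:
  assumes "(X', Y', Z', f', g', h') \<in> Tri C"
    "is_iso_in (C_inf_cat C) X' X a" "is_iso_in (C_inf_cat C) Y' Y b" "is_iso_in (C_inf_cat C) Z' Z c"
    "f \<in> carrier (colim_hom C X Y)" "g \<in> carrier (colim_hom C Y Z)" "h \<in> carrier (colim_hom C Z (Tr C X))"
    "colim_cmp C X' Y' Y (colim_class C X' Y' 0 f') b = colim_cmp C X' X Y a f"
    "colim_cmp C Y' Z' Z (colim_class C Y' Z' 0 g') c = colim_cmp C Y' Y Z b g"
    "colim_cmp C Z' (Tr C X') (Tr C X) (colim_class C Z' (Tr C X') 0 h') (colim_T C X' X a) = colim_cmp C Z' Z (Tr C X) c h"
  shows "(X, Y, Z, f, g, h) \<in> ttri (C_inf C)"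
  using assms unfolding C_inf_def Let_def by simp blast

lemma C_inf_triE:
  assumes "(X, Y, Z, f, g, h) \<in> ttri (C_inf C)"
  obtains X' Y' Z' f' g' h' a b c where "(X', Y', Z', f', g', h') \<in> Tri C"
    "is_iso_in (C_inf_cat C) X' X a" "is_iso_in (C_inf_cat C) Y' Y b" "is_iso_in (C_inf_cat C) Z' Z c"
  using assms unfolding C_inf_def Let_def by auto

lemma tri_objects_C_inf: "tri_objects (C_inf C)"
  unfolding tri_objects_def
  by (auto elim!: C_inf_triE simp: is_iso_in_def C_inf_cat_def)

context persistence_category
begin

lemma colim_cmp_assoc:
  assumes "W \<in> Ob C" "X \<in> Ob C" "Y \<in> Ob C" "Z \<in> Ob C"
    "x \<in> carrier (colim_hom C W X)" "y \<in> carrier (colim_hom C X Y)" "z \<in> carrier (colim_hom C Y Z)"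
  shows "colim_cmp C W Y Z (colim_cmp C W X Y x y) z = colim_cmp C W X Z x (colim_cmp C X Y Z y z)"
  using assms(5-7) unfolding colim_carrier
  by (clarsimp simp: assms colim_cmp_class cmp_mor cmp_assoc add.assoc)

lemma colim_cmp_carrier:
  assumes "X \<in> Ob C" "Y \<in> Ob C" "Z \<in> Ob C" "x \<in> carrier (colim_hom C X Y)" "y \<in> carrier (colim_hom C Y Z)"
  shows "colim_cmp C X Y Z x y \<in> carrier (colim_hom C X Z)"
proof -
  obtain \<alpha> f \<beta> g where f: "f \<in> mor C \<alpha> X Y" "x = colim_class C X Y \<alpha> f" and g: "g \<in> mor C \<beta> Y Z" "y = colim_class C Y Z \<beta> g"
    using assms(4,5) unfolding colim_carrier by blast
  show ?thesis
    unfolding f(2) g(2) colim_cmp_class[OF assms(1-3) f(1) g(1)] colim_carrier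
    using cmp_mor[OF assms(1-3) f(1) g(1) refl] by blast
qed

lemma colim_idn_left: "A \<in> Ob C \<Longrightarrow> B \<in> Ob C \<Longrightarrow> x \<in> carrier (colim_hom C A B) \<Longrightarrow>
    colim_cmp C A A B (colim_class C A A 0 (idn C A)) x = x"
  unfolding colim_carrier by (auto simp: colim_cmp_class idn_closed idn_left)

lemma colim_idn_right: "A \<in> Ob C \<Longrightarrow> B \<in> Ob C \<Longrightarrow> x \<in> carrier (colim_hom C A B) \<Longrightarrow>
    colim_cmp C A B B x (colim_class C B B 0 (idn C B)) = x"
  unfolding colim_carrier by (auto simp: colim_cmp_class idn_closed idn_right)

lemma colim_class_carrier: "f \<in> mor C \<alpha> A B \<Longrightarrow> colim_class C A B \<alpha> f \<in> carrier (colim_hom C A B)"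
  unfolding colim_carrier by blast

text \<open>The translation of \<open>C\<^sub>\<infinity>\<close> is defined through a fraction presenting a morphism; it is well defined on identities as soon
  as translating respects equality in the colimit and the translate of \<open>\<eta>\<^sub>r\<close> is an epimorphism there.\<close>

lemma colim_T_idn:
  assumes X: "X \<in> Ob C" and T: "Tr C X \<in> Ob C"
    and Ob: "\<And>r. r \<ge> 0 \<Longrightarrow> sh C r X \<in> Ob C" "\<And>r. r \<ge> 0 \<Longrightarrow> Tr C (sh C r X) \<in> Ob C"
    and eta: "\<And>r. r \<ge> 0 \<Longrightarrow> eta_map C r X \<in> mor C 0 (sh C r X) X"
    and Tm: "\<And>r f. r \<ge> 0 \<Longrightarrow> f \<in> mor C 0 (sh C r X) X \<Longrightarrow> Trm C (sh C r X) X f \<in> mor C 0 (Tr C (sh C r X)) (Tr C X)"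
    and wd: "\<And>r f. r \<ge> 0 \<Longrightarrow> f \<in> mor C 0 (sh C r X) X \<Longrightarrow>
       colim_class C (sh C r X) X 0 (eta_map C r X) = colim_class C (sh C r X) X 0 f \<Longrightarrow>
       colim_class C (Tr C (sh C r X)) (Tr C X) 0 (Trm C (sh C r X) X (eta_map C r X))
       = colim_class C (Tr C (sh C r X)) (Tr C X) 0 (Trm C (sh C r X) X f)"
    and epi: "\<And>r s d. r \<ge> 0 \<Longrightarrow> d \<in> mor C s (Tr C X) (Tr C X) \<Longrightarrow>
       cmp C 0 s (Tr C (sh C r X)) (Tr C X) (Tr C X) (Trm C (sh C r X) X (eta_map C r X)) d = zr s (Tr C (sh C r X)) (Tr C X) \<Longrightarrow>
       null C s (Tr C X) (Tr C X) d"
  shows "colim_T C X X (colim_class C X X 0 (idn C X)) = colim_class C (Tr C X) (Tr C X) 0 (idn C (Tr C X))"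
  unfolding colim_T_def
proof (rule the_equality)
  have z: "(0::real) \<ge> 0" by simp
  show "colim_class C (Tr C X) (Tr C X) 0 (idn C (Tr C X)) \<in> carrier (colim_hom C (Tr C X) (Tr C X)) \<and>
    (\<exists>r\<ge>0. \<exists>f\<in>mor C 0 (sh C r X) X.
       colim_cmp C (sh C r X) X X (colim_class C (sh C r X) X 0 (eta_map C r X)) (colim_class C X X 0 (idn C X)) =
         colim_class C (sh C r X) X 0 f \<and>
       colim_cmp C (Tr C (sh C r X)) (Tr C X) (Tr C X)
           (colim_class C (Tr C (sh C r X)) (Tr C X) 0 (Trm C (sh C r X) X (eta_map C r X))) (colim_class C (Tr C X) (Tr C X) 0 (idn C (Tr C X))) =
         colim_class C (Tr C (sh C r X)) (Tr C X) 0 (Trm C (sh C r X) X f))"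
    using colim_class_carrier[OF idn_closed[OF T]]
      colim_idn_right[OF Ob(1)[OF z] X colim_class_carrier[OF eta[OF z]]]
      colim_idn_right[OF Ob(2)[OF z] T colim_class_carrier[OF Tm[OF z eta[OF z]]]] eta[OF z]
    by (intro conjI exI[of _ "0::real"] bexI[of _ "eta_map C 0 X"]) auto
next
  fix b assume "b \<in> carrier (colim_hom C (Tr C X) (Tr C X)) \<and>
    (\<exists>r\<ge>0. \<exists>f\<in>mor C 0 (sh C r X) X.
       colim_cmp C (sh C r X) X X (colim_class C (sh C r X) X 0 (eta_map C r X)) (colim_class C X X 0 (idn C X)) =
         colim_class C (sh C r X) X 0 f \<and>
       colim_cmp C (Tr C (sh C r X)) (Tr C X) (Tr C X)
           (colim_class C (Tr C (sh C r X)) (Tr C X) 0 (Trm C (sh C r X) X (eta_map C r X))) b =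
         colim_class C (Tr C (sh C r X)) (Tr C X) 0 (Trm C (sh C r X) X f))"
  then obtain r f where b: "b \<in> carrier (colim_hom C (Tr C X) (Tr C X))" and r: "r \<ge> 0" and f: "f \<in> mor C 0 (sh C r X) X"
    and 1: "colim_cmp C (sh C r X) X X (colim_class C (sh C r X) X 0 (eta_map C r X)) (colim_class C X X 0 (idn C X)) =
         colim_class C (sh C r X) X 0 f"
    and 2: "colim_cmp C (Tr C (sh C r X)) (Tr C X) (Tr C X)
           (colim_class C (Tr C (sh C r X)) (Tr C X) 0 (Trm C (sh C r X) X (eta_map C r X))) b =
         colim_class C (Tr C (sh C r X)) (Tr C X) 0 (Trm C (sh C r X) X f)"
    by blast
  let ?S = "Tr C (sh C r X)" let ?T = "Tr C X" let ?e = "Trm C (sh C r X) X (eta_map C r X)"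
  have S: "?S \<in> Ob C" and e: "?e \<in> mor C 0 ?S ?T" using Ob(2)[OF r] Tm[OF r eta[OF r]] .
  obtain \<beta> b0 where b0: "b0 \<in> mor C \<beta> ?T ?T" "b = colim_class C ?T ?T \<beta> b0" using b unfolding colim_carrier by blast
  have "colim_class C (sh C r X) X 0 (eta_map C r X) = colim_class C (sh C r X) X 0 f"
    using 1 colim_idn_right[OF Ob(1)[OF r] X colim_class_carrier[OF eta[OF r]]] by simp
  then have "colim_class C ?S ?T \<beta> (cmp C 0 \<beta> ?S ?T ?T ?e b0) = colim_class C ?S ?T 0 ?e"
    using 2 wd[OF r f] colim_cmp_class[OF S T T e b0(1)] b0(2) by simp
  then obtain \<gamma> where \<gamma>: "\<beta> \<le> \<gamma>" "0 \<le> \<gamma>" "inc C \<beta> \<gamma> ?S ?T (cmp C 0 \<beta> ?S ?T ?T ?e b0) = inc C 0 \<gamma> ?S ?T ?e"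
    using colim_class_eq_iff[OF S T _ e] cmp_mor[OF S T T e b0(1), of \<beta>] by auto
  let ?b = "inc C \<beta> \<gamma> ?T ?T b0" let ?i = "inc C 0 \<gamma> ?T ?T (idn C ?T)"
  have m: "?b \<in> mor C \<gamma> ?T ?T" "?i \<in> mor C \<gamma> ?T ?T" using inc_mor[OF T T \<gamma>(1) b0(1)] inc_mor[OF T T \<gamma>(2) idn_closed[OF T]] .
  have "cmp C 0 \<gamma> ?S ?T ?T ?e ?b = cmp C 0 \<gamma> ?S ?T ?T ?e ?i"
    using inc_cmp_right[OF S T T e b0(1) \<gamma>(1)] inc_cmp_right[OF S T T e idn_closed[OF T] \<gamma>(2)] \<gamma>(3) idn_right[OF S T e] by simp
  then have "cmp C 0 \<gamma> ?S ?T ?T ?e (?b \<ominus>\<^bsub>Hom C \<gamma> ?T ?T\<^esub> ?i) = zr \<gamma> ?S ?T"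
    using cmp_diff_right[OF S T T e m] diff_mor_zero[OF S T, of _ \<gamma>] cmp_mor[OF S T T e m(2), of \<gamma>] by simp
  then have "colim_class C ?T ?T \<gamma> ?b = colim_class C ?T ?T \<gamma> ?i"
    using epi[OF r diff_mor[OF T T m]] colim_class_eq_null[OF T T m] by blast
  then show "b = colim_class C ?T ?T 0 (idn C ?T)"
    using colim_class_inc[OF T T b0(1) \<gamma>(1)] colim_class_inc[OF T T idn_closed[OF T] \<gamma>(2)] b0(2) by simp
qed

text \<open>Taking \<open>W = Z\<close> turns triangles of \<open>C\<^sub>0\<close> into triangles of \<open>C\<^sub>\<infinity>\<close>; replacing a zero object \<open>Z\<close> by an acyclic object \<open>W\<close> shows that
  the class of \<open>W\<close> vanishes.\<close>

lemma C_inf_tri: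
  assumes tri: "(X, Y, Z, f, g, h) \<in> Tri C" and Ob: "X \<in> Ob C" "Y \<in> Ob C" "Z \<in> Ob C" "Tr C X \<in> Ob C"
    and m: "f \<in> mor C 0 X Y" "g \<in> mor C 0 Y Z" "h \<in> mor C 0 Z (Tr C X)"
    and Tid: "colim_T C X X (colim_class C X X 0 (idn C X)) = colim_class C (Tr C X) (Tr C X) 0 (idn C (Tr C X))"
    and c: "is_iso_in (C_inf_cat C) Z W c"
  shows "\<exists>f g h. (X, Y, W, f, g, h) \<in> ttri (C_inf C)"
proof -
  let ?c = "\<lambda>A B f. colim_class C A B 0 f"
  obtain d where W: "W \<in> Ob C" and cd: "c \<in> carrier (colim_hom C Z W)" "d \<in> carrier (colim_hom C W Z)"
     "colim_cmp C Z W Z c d = ?c Z Z (idn C Z)"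
    using c unfolding is_iso_in_def C_inf_cat_def tmor_def by auto
  note car = colim_class_carrier[OF m(1)] colim_class_carrier[OF m(2)] colim_class_carrier[OF m(3)]
  let ?g = "colim_cmp C Y Z W (?c Y Z g) c" let ?h = "colim_cmp C W Z (Tr C X) d (?c Z (Tr C X) h)"
  have gh: "?g \<in> carrier (colim_hom C Y W)" "?h \<in> carrier (colim_hom C W (Tr C X))"
    using colim_cmp_carrier Ob W cd car by auto
  have "colim_cmp C Z W (Tr C X) c ?h = ?c Z (Tr C X) h"
    using colim_cmp_assoc[OF Ob(3) W Ob(3,4) cd(1,2) car(3)] cd(3) colim_idn_left[OF Ob(3,4) car(3)] by simp
  moreover have "colim_cmp C Y Y W (?c Y Y (idn C Y)) ?g = ?g" "colim_cmp C X X Y (?c X X (idn C X)) (?c X Y f) = ?c X Y f"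
    "colim_cmp C X Y Y (?c X Y f) (?c Y Y (idn C Y)) = ?c X Y f"
    "colim_cmp C Z (Tr C X) (Tr C X) (?c Z (Tr C X) h) (?c (Tr C X) (Tr C X) (idn C (Tr C X))) = ?c Z (Tr C X) h"
    using colim_idn_left colim_idn_right Ob W gh car by auto
  ultimately have "(X, Y, W, ?c X Y f, ?g, ?h) \<in> ttri (C_inf C)"
    by (intro C_inf_triI[OF tri colim_iso_idn[OF Ob(1)] colim_iso_idn[OF Ob(2)] c car(1) gh]) (simp_all add: Tid)
  then show ?thesis by blast
qed

end

text \<open>Stated for data that need not be triangulated, so that it applies to opposite categories too.\<close>

lemma R_tri_C_inf_superset:
  assumes pc: "persistence_category k C"
    and typed: "\<And>X Y Z f g h. (X, Y, Z, f, g, h) \<in> Tri C \<Longrightarrow> X \<in> Ob C \<and> Y \<in> Ob C \<and> Z \<in> Ob C \<and> Tr C X \<in> Ob C \<and>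
       f \<in> mor C 0 X Y \<and> g \<in> mor C 0 Y Z \<and> h \<in> mor C 0 Z (Tr C X)"
    and Tid: "\<And>X. X \<in> Ob C \<Longrightarrow> colim_T C X X (colim_class C X X 0 (idn C X)) = colim_class C (Tr C X) (Tr C X) 0 (idn C (Tr C X))"
    and Z: "(X, X, Z, f, g, h) \<in> Tri C" "Z \<in> acyclics C"
  shows "(A, B, E, f', g', h') \<in> Tri C \<Longrightarrow> frag_of B - (frag_of A + frag_of E) \<in> R_tri (C_inf C)"
    and "A \<in> acyclics C \<Longrightarrow> frag_of A \<in> R_tri (C_inf C)"
proof -
  interpret persistence_category k C by fact
  show "frag_of B - (frag_of A + frag_of E) \<in> R_tri (C_inf C)" if "(A, B, E, f', g', h') \<in> Tri C"
  proof -
    have "\<exists>f g h. (A, B, E, f, g, h) \<in> ttri (C_inf C)"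
      using C_inf_tri[OF that _ _ _ _ _ _ _ Tid colim_iso_idn] typed[OF that] by simp
    then show ?thesis by (elim exE) (rule R_tri_rel)
  qed
  show "frag_of A \<in> R_tri (C_inf C)" if "A \<in> acyclics C"
  proof -
    have "\<exists>f g h. (X, X, A, f, g, h) \<in> ttri (C_inf C)"
      using C_inf_tri[OF Z(1) _ _ _ _ _ _ _ Tid colim_iso_acyclic[OF Z(2) that]] typed[OF Z(1)] by simp
    then have "frag_of X - (frag_of X + frag_of A) \<in> R_tri (C_inf C)"
      by (elim exE) (rule R_tri_rel)
    then show ?thesis
      using subgroup_uminus_iff[OF R_tri_subgroup[OF tri_objects_C_inf[of C]], of "frag_of A"] by simp
  qed
qed

context triangulated_category
begin

lemma tri_negate:
  assumes "(X, Y, Z, f, g, h) \<in> ttri D"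
  shows "(X, Y, Z, \<ominus>\<^bsub>thom D X Y\<^esub> f, \<ominus>\<^bsub>thom D Y Z\<^esub> g, h) \<in> ttri D"
proof -
  note ty = tri_typed[OF assms]
  then have X: "X \<in> tob D" and Y: "Y \<in> tob D" and Z: "Z \<in> tob D" and f: "f \<in> tmor D X Y" and g: "g \<in> tmor D Y Z"
    and h: "h \<in> tmor D Z (Tob D X)" by auto
  let ?n = "\<ominus>\<^bsub>thom D Y Y\<^esub> tidn D Y"
  note n = minus_closed[OF Y Y idn_closed[OF Y]]
  have mm: "\<ominus>\<^bsub>thom D A B\<^esub> (\<ominus>\<^bsub>thom D A B\<^esub> x) = x" if "A \<in> tob D" "B \<in> tob D" "x \<in> tmor D A B" for A B x
    using abelian_group.minus_minus[OF hom_group] that by (simp add: tmor_def)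
  have "tcmp D Y Y Y ?n ?n = tidn D Y"
    using cmp_minus_left[OF Y Y Y idn_closed[OF Y] n] idn_left[OF Y Y n] mm[OF Y Y idn_closed[OF Y]] by simp
  then have iso: "is_iso_in D Y Y ?n" unfolding is_iso_in_def using Y n by blast
  show ?thesis
  proof (rule tri_iso[OF assms is_iso_idn[OF X] iso is_iso_idn[OF Z] minus_closed[OF X Y f] minus_closed[OF Y Z g] h])
    show "tcmp D X Y Y f ?n = tcmp D X X Y (tidn D X) (\<ominus>\<^bsub>thom D X Y\<^esub> f)"
      using cmp_minus_right[OF X Y Y f idn_closed[OF Y]] idn_right[OF X Y f] idn_left[OF X Y minus_closed[OF X Y f]] by simp
    show "tcmp D Y Z Z g (tidn D Z) = tcmp D Y Y Z ?n (\<ominus>\<^bsub>thom D Y Z\<^esub> g)"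
      using cmp_minus_left[OF Y Y Z idn_closed[OF Y] minus_closed[OF Y Z g]] idn_left[OF Y Z minus_closed[OF Y Z g]]
        idn_right[OF Y Z g] mm[OF Y Z g] by simp
    show "tcmp D Z (Tob D X) (Tob D X) h (Tmor D X X (tidn D X)) = tcmp D Z Z (Tob D X) (tidn D Z) h"
      using T_idn[OF X] idn_right[OF Z Tob_closed[OF X] h] idn_left[OF Z Tob_closed[OF X] h] by simp
  qed
qed

lemma tri_rotate_left:
  assumes "(X, Y, Tob D Z, f, g, h) \<in> ttri D" "Z \<in> tob D"
  shows "\<exists>k. (Z, X, Y, k, f, g) \<in> ttri D"
proof -
  note ty = tri_typed[OF assms(1)]
  then have X: "X \<in> tob D" and h: "h \<in> tmor D (Tob D Z) (Tob D X)" by auto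
  note T = Tob_closed[OF assms(2)] Tob_closed[OF X]
  obtain k where k: "k \<in> tmor D Z X" "\<ominus>\<^bsub>thom D (Tob D Z) (Tob D X)\<^esub> h = Tmor D Z X k"
    using Tmor_surj[OF assms(2) X minus_closed[OF T h]] by blast
  have "h = \<ominus>\<^bsub>thom D (Tob D Z) (Tob D X)\<^esub> Tmor D Z X k"
    using abelian_group.minus_minus[OF hom_group[OF T]] h unfolding k(2)[symmetric] by (simp add: tmor_def)
  then show ?thesis
    using tri_rotate[of Z X Y k f g] assms ty k(1) by auto
qed

lemma Tmor_diff:
  assumes "X \<in> tob D" "Y \<in> tob D" "f \<in> tmor D X Y" "g \<in> tmor D X Y"
  shows "Tmor D X Y (f \<ominus>\<^bsub>thom D X Y\<^esub> g) = Tmor D X Y f \<ominus>\<^bsub>thom D (Tob D X) (Tob D Y)\<^esub> Tmor D X Y g"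
  by (simp add: a_minus_def T_add Tmor_minus minus_closed assms)

end

context triangulated_persistence_category
begin

text \<open>The difference of \<open>f\<close> and \<open>g\<close> is null exactly if its translate is, because acyclic objects correspond under \<open>T\<close>.\<close>

lemma colim_class_translate:
  assumes A: "A \<in> Ob C" and B: "B \<in> Ob C" and f: "f \<in> mor C 0 A B" and g: "g \<in> mor C 0 A B"
  shows "colim_class C (Tr C A) (Tr C B) 0 (Trm C A B f) = colim_class C (Tr C A) (Tr C B) 0 (Trm C A B g)
    \<longleftrightarrow> colim_class C A B 0 f = colim_class C A B 0 g"
proof -
  have "Trm C A B (f \<ominus>\<^bsub>Hom C 0 A B\<^esub> g) = Trm C A B f \<ominus>\<^bsub>Hom C 0 (Tr C A) (Tr C B)\<^esub> Trm C A B g"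
    using C0.Tmor_diff[of A B f g] assms by simp
  then show ?thesis
    using colim_class_eq_null[OF A B f g] null_translate[OF A B, of "f \<ominus>\<^bsub>Hom C 0 A B\<^esub> g"]
      colim_class_eq_null[OF Tr_Ob[OF A] Tr_Ob[OF B] Trm_mor[OF A B f] Trm_mor[OF A B g]]
      null_untranslate[OF A B diff_mor[OF A B f g]] by auto
qed

lemma translate_cone:
  assumes tri: "(X, Y, Z, f, g, h) \<in> Tri C"
  shows "\<exists>g' h'. (Tr C X, Tr C Y, Tr C Z, Trm C X Y f, g', h') \<in> Tri C"
proof -
  have ty: "X \<in> Ob C" "Y \<in> Ob C" "f \<in> mor C 0 X Y" using Tri_typed[OF tri] by auto
  obtain g' h' where "(Tr C X, Tr C Y, Tr C Z, \<ominus>\<^bsub>Hom C 0 (Tr C X) (Tr C Y)\<^esub> Trm C X Y f, g', h') \<in> Tri C"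
    using C0.tri_rotate_right[OF C0.tri_rotate_right[OF C0.tri_rotate_right], of X Y Z f g h] tri by auto
  moreover have "\<ominus>\<^bsub>Hom C 0 (Tr C X) (Tr C Y)\<^esub> (\<ominus>\<^bsub>Hom C 0 (Tr C X) (Tr C Y)\<^esub> Trm C X Y f) = Trm C X Y f"
    using abelian_group.minus_minus[OF hom_abelian[OF Tr_Ob Tr_Ob]] Trm_mor[OF ty] ty by (simp add: mor_def)
  ultimately show ?thesis
    using C0.tri_negate[of "Tr C X" "Tr C Y" "Tr C Z" "\<ominus>\<^bsub>Hom C 0 (Tr C X) (Tr C Y)\<^esub> Trm C X Y f" g' h'] by auto
qed

lemma colim_T_idn_tpc:
  assumes X: "X \<in> Ob C"
  shows "colim_T C X X (colim_class C X X 0 (idn C X)) = colim_class C (Tr C X) (Tr C X) 0 (idn C (Tr C X))"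
proof (rule colim_T_idn[OF X Tr_Ob[OF X] sh_Ob[OF X] Tr_Ob[OF sh_Ob[OF X]] eta_map_mor[OF X]])
  fix r :: real and f assume r: "r \<ge> 0" and f: "f \<in> mor C 0 (sh C r X) X"
  show "Trm C (sh C r X) X f \<in> mor C 0 (Tr C (sh C r X)) (Tr C X)" using Trm_mor[OF sh_Ob[OF X] X f] .
  assume "colim_class C (sh C r X) X 0 (eta_map C r X) = colim_class C (sh C r X) X 0 f"
  then show "colim_class C (Tr C (sh C r X)) (Tr C X) 0 (Trm C (sh C r X) X (eta_map C r X))
       = colim_class C (Tr C (sh C r X)) (Tr C X) 0 (Trm C (sh C r X) X f)"
    using colim_class_translate[OF sh_Ob[OF X] X eta_map_mor[OF X r] f] by blast
next
  fix r s :: real and d assume r: "r \<ge> 0" and d: "d \<in> mor C s (Tr C X) (Tr C X)"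
    and z: "cmp C 0 s (Tr C (sh C r X)) (Tr C X) (Tr C X) (Trm C (sh C r X) X (eta_map C r X)) d = zr s (Tr C (sh C r X)) (Tr C X)"
  obtain Q where Q: "is_cone_eta C r X Q" using cone_eta[OF X r] by blast
  then obtain g h where "(sh C r X, X, Q, eta_map C r X, g, h) \<in> Tri C" by (auto simp: is_cone_eta_def)
  then obtain g' h' where "(Tr C (sh C r X), Tr C X, Tr C Q, Trm C (sh C r X) X (eta_map C r X), g', h') \<in> Tri C"
    using translate_cone by blast
  then show "null C s (Tr C X) (Tr C X) d"
    by (rule null_of_cmp_zero[OF _ acyclic_translate[OF cone_eta_acyclic[OF Q r]] Tr_Ob[OF X] d z])
qed auto

lemma zero_triangle: "\<exists>Z\<in>acyclics C. \<exists>f g h. (Z, Z, Z, f, g, h) \<in> Tri C"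
proof -
  obtain Z where Z: "is_zero_object (C_zero C) Z" "Z \<in> acyclics C" "Z \<in> Ob C" by (rule obtain_zero)
  then show ?thesis using C0.tri_idn[of Z Z] by auto
qed

lemma relation_mod_Rac:
  assumes "(X', Y', Z', f, g, h) \<in> Tri C" "frag_of X - frag_of X' \<in> R_acyclic C" "frag_of Y - frag_of Y' \<in> R_acyclic C"
    "frag_of Z - frag_of Z' \<in> R_acyclic C"
  shows "frag_of Y - (frag_of X + frag_of Z) \<in> R_acyclic C"
proof -
  have "(frag_of Y' - (frag_of X' + frag_of Z')) + (frag_of Y - frag_of Y') - ((frag_of X - frag_of X') + (frag_of Z - frag_of Z')) \<in> R_acyclic C"
    by (intro subgroup_add[OF sub_Rac] subgroup_diff[OF sub_Rac] assms R0_Rac[OF R0_rel[OF assms(1)]])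
  then show ?thesis by (simp add: algebra_simps)
qed

text \<open>The inclusion from left to right holds because isomorphic objects of \<open>C\<^sub>\<infinity>\<close> agree modulo acyclic objects, the other one because
  triangles of \<open>C\<^sub>0\<close> are triangles of \<open>C\<^sub>\<infinity>\<close> and acyclic objects are zero there.\<close>

theorem R_tri_C_inf: "R_tri (C_inf C) = R_acyclic C"
proof
  show "R_tri (C_inf C) \<subseteq> R_acyclic C"
  proof (rule R_tri_least[OF tri_objects_C_inf sub_Rac])
    fix X Y Z f g h assume "(X, Y, Z, f, g, h) \<in> ttri (C_inf C)"
    then obtain X' Y' Z' f' g' h' a b c where tri: "(X', Y', Z', f', g', h') \<in> Tri C"
      and iso: "is_iso_in (C_inf_cat C) X' X a" "is_iso_in (C_inf_cat C) Y' Y b" "is_iso_in (C_inf_cat C) Z' Z c"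
      by (rule C_inf_triE)
    have "frag_of W - frag_of W' \<in> R_acyclic C" if "is_iso_in (C_inf_cat C) W' W a" for W W' a
      using colim_iso_data[OF that] colim_iso_rel_Rac[of W' W] by blast
    then show "frag_of Y - (frag_of X + frag_of Z) \<in> R_acyclic C"
      using relation_mod_Rac[OF tri] iso by blast
  qed
  obtain Z f g h where Z: "Z \<in> acyclics C" "(Z, Z, Z, f, g, h) \<in> Tri C" using zero_triangle by blast
  note sup = R_tri_C_inf_superset[OF persistence_category_axioms _ colim_T_idn_tpc Z(2,1)]
  show "R_acyclic C \<subseteq> R_tri (C_inf C)"
  proof (rule Rac_least[OF R_tri_subgroup[OF tri_objects_C_inf]])
    show "R_tri (C_zero C) \<subseteq> R_tri (C_inf C)"
      by (rule R_tri_least[OF C0.tri_objects R_tri_subgroup[OF tri_objects_C_inf]])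
        (use sup(1) Tri_typed Tr_Ob in auto)
    show "frag_of A \<in> R_tri (C_inf C)" if "A \<in> acyclics C" for A
      using sup(2) that Tri_typed Tr_Ob by auto
  qed
qed

end

section \<open>Opposites\<close>

lemma op_simps [simp]:
  "Ob (op_tpc C) = Ob C" "Hom (op_tpc C) s A B = Hom C s B A" "inc (op_tpc C) s t A B = inc C s t B A"
  "cmp (op_tpc C) r s A B E f g = cmp C s r E B A g f" "idn (op_tpc C) = idn C" "sh (op_tpc C) r = sh C (- r)"
  "eta (op_tpc C) r s = eta C (- s) (- r)" "Tr (op_tpc C) = Tr_inv C" "Trm (op_tpc C) A B = Trm_inv C B A"
  "mor (op_tpc C) s A B = mor C s B A"
  by (simp_all add: op_tpc_def op_pfun_def mor_def)

lemma null_op [simp]: "null (op_tpc C) s A B f \<longleftrightarrow> null C s B A f"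
  by (simp add: null_def)

lemma acyclic_of_op [simp]: "acyclic_of (op_tpc C) = acyclic_of C"
  by (simp add: acyclic_of_def fun_eq_iff)

lemma acyclics_op [simp]: "acyclics (op_tpc C) = acyclics C"
  by (simp add: acyclics_def)

lemma colim_class_op [simp]: "colim_class (op_tpc C) A B s f = colim_class C B A s f"
  by (simp add: colim_class_def colim_rel_def)

lemma Tri_op: "(\<exists>f g h. (A, B, E, f, g, h) \<in> Tri (op_tpc C)) \<longleftrightarrow> (\<exists>f g h. (E, B, A, f, g, h) \<in> Tri C)"
  by (auto simp: op_tpc_def)

lemma tri_relation_op: "tri_relation (C_zero (op_tpc C)) = tri_relation (C_zero C)"
proof -
  have "tri_relation (C_zero (op_tpc C)) = {frag_of B - (frag_of A + frag_of E) | A B E. \<exists>f g h. (E, B, A, f, g, h) \<in> Tri C}"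
    by (simp add: tri_relation_def Tri_op)
  also have "\<dots> = tri_relation (C_zero C)"
    unfolding tri_relation_def C_zero_simps by (metis (no_types, opaque_lifting) add.commute)
  finally show ?thesis .
qed

lemma R_tri_zero_op: "R_tri (C_zero (op_tpc C)) = R_tri (C_zero C)"
  by (rule R_tri_cong) (simp_all add: tri_relation_op)

lemma R_tri_AC_op: "R_tri (AC_zero (op_tpc C)) = R_tri (AC_zero C)"
proof (rule R_tri_cong)
  have *: "(\<exists>f g h. (A, B, E, f, g, h) \<in> ttri (AC_zero C)) \<longleftrightarrow>
      (\<exists>f g h. (A, B, E, f, g, h) \<in> Tri C) \<and> A \<in> acyclics C \<and> B \<in> acyclics C \<and> E \<in> acyclics C" for A B E and C :: "('k, 'o, 'm) tpc"
    by (auto simp: AC_zero_def full_tri_sub_def)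
  have "tri_relation (AC_zero (op_tpc C)) = {frag_of B - (frag_of A + frag_of E) | A B E.
      (\<exists>f g h. (E, B, A, f, g, h) \<in> Tri C) \<and> E \<in> acyclics C \<and> B \<in> acyclics C \<and> A \<in> acyclics C}"
    unfolding tri_relation_def * Tri_op acyclics_op by (simp only: conj_ac)
  also have "\<dots> = tri_relation (AC_zero C)"
    unfolding tri_relation_def * by (metis (no_types, opaque_lifting) add.commute)
  finally show "tri_relation (AC_zero (op_tpc C)) = tri_relation (AC_zero C)" .
qed (simp add: AC_zero_def full_tri_sub_def)

lemma (in persistence_category) persistence_category_op: "persistence_category k (op_tpc C)"
proof (rule persistence_category.intro)
  fix A B E F f g h r s t r' s'
  show "persistence_module k (\<lambda>s. Hom (op_tpc C) s A B) (\<lambda>s t. inc (op_tpc C) s t A B)"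
    if "A \<in> Ob (op_tpc C)" "B \<in> Ob (op_tpc C)"
    using hom_persistence[of B A] that by simp
  show "lower_semicontinuous (\<lambda>s. Hom (op_tpc C) s A B) (\<lambda>s t. inc (op_tpc C) s t A B)"
    if "A \<in> Ob (op_tpc C)" "B \<in> Ob (op_tpc C)"
    using hom_semicontinuous[of B A] that by simp
  show "lower_bounded (\<lambda>s. Hom (op_tpc C) s A B)" if "A \<in> Ob (op_tpc C)" "B \<in> Ob (op_tpc C)"
    using hom_bounded[of B A] that by simp
  show "(\<lambda>f. cmp (op_tpc C) r s A B E f g) \<in> linear_maps k (Hom (op_tpc C) r A B) (Hom (op_tpc C) (r + s) A E)"
    if "A \<in> Ob (op_tpc C)" "B \<in> Ob (op_tpc C)" "E \<in> Ob (op_tpc C)" "g \<in> mor (op_tpc C) s B E"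
    using cmp_linear_right[of E B A g s r] that by (simp add: add.commute)
  show "(\<lambda>g. cmp (op_tpc C) r s A B E f g) \<in> linear_maps k (Hom (op_tpc C) s B E) (Hom (op_tpc C) (r + s) A E)"
    if "A \<in> Ob (op_tpc C)" "B \<in> Ob (op_tpc C)" "E \<in> Ob (op_tpc C)" "f \<in> mor (op_tpc C) r A B"
    using cmp_linear_left[of E B A f r s] that by (simp add: add.commute)
  show "cmp (op_tpc C) r' s' A B E (inc (op_tpc C) r r' A B f) (inc (op_tpc C) s s' B E g) =
      inc (op_tpc C) (r + s) (r' + s') A E (cmp (op_tpc C) r s A B E f g)"
    if "A \<in> Ob (op_tpc C)" "B \<in> Ob (op_tpc C)" "E \<in> Ob (op_tpc C)"
      "f \<in> mor (op_tpc C) r A B" "g \<in> mor (op_tpc C) s B E" "r \<le> r'" "s \<le> s'"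
    using cmp_inc[of E B A g s f r s' r'] that by (simp add: add.commute)
  show "cmp (op_tpc C) (r + s) t A E F (cmp (op_tpc C) r s A B E f g) h =
      cmp (op_tpc C) r (s + t) A B F f (cmp (op_tpc C) s t B E F g h)"
    if "A \<in> Ob (op_tpc C)" "B \<in> Ob (op_tpc C)" "E \<in> Ob (op_tpc C)" "F \<in> Ob (op_tpc C)"
      "f \<in> mor (op_tpc C) r A B" "g \<in> mor (op_tpc C) s B E" "h \<in> mor (op_tpc C) t E F"
    using cmp_assoc[of F E B A h t g s f r] that by (simp add: add.commute)
qed (simp_all add: idn_closed idn_left idn_right)

context triangulated_persistence_category
begin

lemma Tr_inv: assumes "X \<in> Ob C" shows "Tr_inv C X \<in> Ob C" "Tr C (Tr_inv C X) = X" "Tr_inv C (Tr C X) = X"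
proof -
  have b: "bij_betw (Tr C) (Ob C) (Ob C)" using C0.T_ob by simp
  show "Tr_inv C X \<in> Ob C" "Tr C (Tr_inv C X) = X" "Tr_inv C (Tr C X) = X"
    unfolding Tr_inv_def using bij_betw_the_inv_into[OF b] f_the_inv_into_f_bij_betw[OF b] the_inv_into_f_f[of "Tr C" "Ob C" X] b assms
    by (auto simp: bij_betw_def)
qed

lemma Trm_inv:
  assumes X: "X \<in> Ob C" and Y: "Y \<in> Ob C" and f: "f \<in> mor C 0 X Y"
  shows "Trm_inv C X Y f \<in> mor C 0 (Tr_inv C X) (Tr_inv C Y)" "Trm C (Tr_inv C X) (Tr_inv C Y) (Trm_inv C X Y f) = f"
proof -
  have b: "bij_betw (Trm C (Tr_inv C X) (Tr_inv C Y)) (mor C 0 (Tr_inv C X) (Tr_inv C Y)) (mor C 0 X Y)"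
    using C0.T_mor[of "Tr_inv C X" "Tr_inv C Y"] Tr_inv[OF X] Tr_inv[OF Y] by simp
  show "Trm_inv C X Y f \<in> mor C 0 (Tr_inv C X) (Tr_inv C Y)" "Trm C (Tr_inv C X) (Tr_inv C Y) (Trm_inv C X Y f) = f"
    unfolding Trm_inv_def using bij_betw_the_inv_into[OF b] f_the_inv_into_f_bij_betw[OF b] f
    by (auto simp: bij_betw_def)
qed

lemma Tri_op_typed:
  assumes "(X, Y, Z, f, g, h) \<in> Tri (op_tpc C)"
  shows "X \<in> Ob C \<and> Y \<in> Ob C \<and> Z \<in> Ob C \<and> Tr_inv C X \<in> Ob C \<and>
       f \<in> mor C 0 Y X \<and> g \<in> mor C 0 Z Y \<and> h \<in> mor C 0 (Tr_inv C X) Z"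
proof -
  obtain h0 where tri: "(Z, Y, X, g, f, h0) \<in> Tri C" and h: "h = \<ominus>\<^bsub>Hom C 0 (Tr_inv C X) Z\<^esub> Trm_inv C X (Tr C Z) h0"
    using assms by (auto simp: op_tpc_def)
  note ty = Tri_typed[OF tri]
  have "Trm_inv C X (Tr C Z) h0 \<in> mor C 0 (Tr_inv C X) Z"
    using Trm_inv[of X "Tr C Z" h0] Tr_inv[of Z] ty Tr_Ob by simp
  then show ?thesis
    using C0.minus_closed[of "Tr_inv C X" Z] Tr_inv[of X] ty h by simp
qed

lemma eta_map_op: "X \<in> Ob C \<Longrightarrow> eta_map (op_tpc C) r X = eta_map C r (sh C (- r) X)"
  using eta_shift[of X r 0 "- r"] by (simp add: eta_map_def shift_add_ob shift_0_ob)

text \<open>\<open>T\<^sup>-\<^sup>1\<eta>\<^sub>r\<close> is a monomorphism of \<open>C\<^sub>\<infinity>\<close>: its fibre is acyclic since acyclicity descends along the translation.\<close>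

lemma untranslated_eta_mono:
  assumes Ob: "Y \<in> Ob C" "Y' \<in> Ob C" "X \<in> Ob C" and f: "f \<in> mor C 0 Y Y'" and T: "Tr C Y = sh C r X" "Tr C Y' = X"
    "Trm C Y Y' f = eta_map C r X" and r: "r \<ge> 0"
    and d: "W \<in> Ob C" "d \<in> mor C s W Y" "cmp C s 0 W Y Y' d f = zr s W Y'"
  shows "null C s W Y d"
proof -
  obtain Z g h where tri: "(Y, Y', Z, f, g, h) \<in> Tri C" using C0.tri_cone[of Y Y' f] Ob f by auto
  have Z: "Z \<in> Ob C" using Tri_typed[OF tri] by blast
  obtain g' h' where tri': "(sh C r X, X, Tr C Z, eta_map C r X, g', h') \<in> Tri C"
    using translate_cone[OF tri] T by auto
  obtain Q where Q: "is_cone_eta C r X Q" using cone_eta[OF Ob(3) r] by blast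
  then obtain u v where triQ: "(sh C r X, X, Q, eta_map C r X, u, v) \<in> Tri C" by (auto simp: is_cone_eta_def)
  obtain O0 where O0: "is_zero_object (C_zero C) O0" "O0 \<in> acyclics C" by (rule obtain_zero)
  obtain a b c where "(Q, Tr C Z, O0, a, b, c) \<in> Tri C"
    using C0.cones_triangle[OF _ _ O0(1), of "sh C r X" X Q "eta_map C r X" u v "Tr C Z" g' h'] tri' triQ by auto
  then have "Tr C Z \<in> acyclics C" using acyclic_extension cone_eta_acyclic[OF Q r] O0(2) by blast
  then have acZ: "Z \<in> acyclics C" using acyclic_untranslate Z by blast
  have F: "Tr_inv C Z \<in> Ob C" "Tr C (Tr_inv C Z) = Z" using Tr_inv[OF Z] by auto
  then have acF: "Tr_inv C Z \<in> acyclics C" using acyclic_untranslate acZ by simp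
  obtain k where "(Tr_inv C Z, Y, Y', k, f, g) \<in> Tri C"
    using C0.tri_rotate_left[of Y Y' "Tr_inv C Z" f g h] F tri by auto
  then show ?thesis by (rule null_of_cmp_zero2[OF _ acF d])
qed

lemma colim_T_idn_op:
  assumes X: "X \<in> Ob C"
  shows "colim_T (op_tpc C) X X (colim_class (op_tpc C) X X 0 (idn (op_tpc C) X))
    = colim_class (op_tpc C) (Tr (op_tpc C) X) (Tr (op_tpc C) X) 0 (idn (op_tpc C) (Tr (op_tpc C) X))"
proof -
  interpret op: persistence_category k "op_tpc C" by (rule persistence_category_op)
  let ?S = "\<lambda>r. sh C (- r) X"
  have S: "?S r \<in> Ob C" "sh C r (?S r) = X" for r using sh_Ob[OF X] X by (auto simp: shift_add_ob shift_0_ob)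
  have e: "eta_map C r (?S r) \<in> mor C 0 X (?S r)" if "r \<ge> 0" for r using eta_map_mor[OF S(1)[of r] that] S(2)[of r] by simp
  show ?thesis
  proof (rule op.colim_T_idn)
    fix r :: real and f
    assume r: "r \<ge> 0" and f: "f \<in> mor (op_tpc C) 0 (sh (op_tpc C) r X) X"
    have f': "f \<in> mor C 0 X (?S r)" using f by simp
    show "Trm (op_tpc C) (sh (op_tpc C) r X) X f \<in> mor (op_tpc C) 0 (Tr (op_tpc C) (sh (op_tpc C) r X)) (Tr (op_tpc C) X)"
      using Trm_inv[OF X S(1) f'] by simp
    assume "colim_class (op_tpc C) (sh (op_tpc C) r X) X 0 (eta_map (op_tpc C) r X) = colim_class (op_tpc C) (sh (op_tpc C) r X) X 0 f"
    then show "colim_class (op_tpc C) (Tr (op_tpc C) (sh (op_tpc C) r X)) (Tr (op_tpc C) X) 0 (Trm (op_tpc C) (sh (op_tpc C) r X) X (eta_map (op_tpc C) r X))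
       = colim_class (op_tpc C) (Tr (op_tpc C) (sh (op_tpc C) r X)) (Tr (op_tpc C) X) 0 (Trm (op_tpc C) (sh (op_tpc C) r X) X f)"
      using colim_class_translate[OF Tr_inv(1)[OF X] Tr_inv(1)[OF S(1)] Trm_inv(1)[OF X S(1) e[OF r]] Trm_inv(1)[OF X S(1) f']]
        Trm_inv(2)[OF X S(1) e[OF r]] Trm_inv(2)[OF X S(1) f'] Tr_inv(2)[OF X] Tr_inv(2)[OF S(1)]
      by (simp add: eta_map_op[OF X])
  next
    fix r s :: real and d
    assume r: "r \<ge> 0" and d: "d \<in> mor (op_tpc C) s (Tr (op_tpc C) X) (Tr (op_tpc C) X)"
      "cmp (op_tpc C) 0 s (Tr (op_tpc C) (sh (op_tpc C) r X)) (Tr (op_tpc C) X) (Tr (op_tpc C) X)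
         (Trm (op_tpc C) (sh (op_tpc C) r X) X (eta_map (op_tpc C) r X)) d = op.zr s (Tr (op_tpc C) (sh (op_tpc C) r X)) (Tr (op_tpc C) X)"
    show "null (op_tpc C) s (Tr (op_tpc C) X) (Tr (op_tpc C) X) d"
      using untranslated_eta_mono[OF Tr_inv(1)[OF X] Tr_inv(1)[OF S(1)[of r]] S(1)[of r] Trm_inv(1)[OF X S(1)[of r] e[OF r]] _ _ _ r Tr_inv(1)[OF X], of d s]
        d Tr_inv(2)[OF X] Tr_inv(2)[OF S(1)] S(2) Trm_inv(2)[OF X S(1) e[OF r]]
      by (simp add: eta_map_op[OF X])
  qed (use X S Tr_inv(1) e in \<open>auto simp: eta_map_op\<close>)
qed

text \<open>An isomorphism of the colimit of the opposite category is one of \<open>C\<^sub>\<infinity>\<close> in the other direction, so the same two inclusions hold.\<close>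

theorem R_tri_C_inf_op: "R_tri (C_inf (op_tpc C)) = R_acyclic C"
proof
  interpret op: persistence_category k "op_tpc C" by (rule persistence_category_op)
  show "R_tri (C_inf (op_tpc C)) \<subseteq> R_acyclic C"
  proof (rule R_tri_least[OF tri_objects_C_inf sub_Rac])
    fix X Y Z f g h assume "(X, Y, Z, f, g, h) \<in> ttri (C_inf (op_tpc C))"
    then obtain X' Y' Z' f' g' h' a b c where tri: "(X', Y', Z', f', g', h') \<in> Tri (op_tpc C)"
      and iso: "is_iso_in (C_inf_cat (op_tpc C)) X' X a" "is_iso_in (C_inf_cat (op_tpc C)) Y' Y b" "is_iso_in (C_inf_cat (op_tpc C)) Z' Z c"
      by (rule C_inf_triE)
    have "frag_of W - frag_of W' \<in> R_acyclic C" if i: "is_iso_in (C_inf_cat (op_tpc C)) W' W a" for W W' a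
    proof -
      obtain \<alpha> \<beta> \<gamma> \<delta> f g where d: "W' \<in> Ob C" "W \<in> Ob C" "f \<in> mor C \<alpha> W W'" "g \<in> mor C \<beta> W' W"
        "\<alpha> + \<beta> \<le> \<gamma>" "0 \<le> \<gamma>" "inc C (\<alpha> + \<beta>) \<gamma> W' W' (cmp C \<beta> \<alpha> W' W W' g f) = inc C 0 \<gamma> W' W' (idn C W')"
        "\<beta> + \<alpha> \<le> \<delta>" "0 \<le> \<delta>" "inc C (\<beta> + \<alpha>) \<delta> W W (cmp C \<alpha> \<beta> W W' W f g) = inc C 0 \<delta> W W (idn C W)"
        using op.colim_iso_data[OF i] unfolding op_simps by blast
      show ?thesis
        using colim_iso_rel_Rac[OF d(1,2,4,3), of \<gamma> \<delta>] d(5-10) by (simp add: add.commute)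
    qed
    moreover obtain f'' g'' h'' where "(Z', Y', X', f'', g'', h'') \<in> Tri C" using tri Tri_op[of X' Y' Z' C] by blast
    ultimately have "frag_of Y - (frag_of Z + frag_of X) \<in> R_acyclic C"
      using relation_mod_Rac iso by blast
    then show "frag_of Y - (frag_of X + frag_of Z) \<in> R_acyclic C" by (simp add: add.commute)
  qed
  obtain Z where Z: "Z \<in> acyclics (op_tpc C)" "\<exists>f g h. (Z, Z, Z, f, g, h) \<in> Tri (op_tpc C)" using zero_triangle Tri_op acyclics_op by metis
  then obtain f g h where Z': "(Z, Z, Z, f, g, h) \<in> Tri (op_tpc C)" by blast
  have typed: "X \<in> Ob (op_tpc C) \<and> Y \<in> Ob (op_tpc C) \<and> Z \<in> Ob (op_tpc C) \<and> Tr (op_tpc C) X \<in> Ob (op_tpc C) \<and>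
       f \<in> mor (op_tpc C) 0 X Y \<and> g \<in> mor (op_tpc C) 0 Y Z \<and> h \<in> mor (op_tpc C) 0 Z (Tr (op_tpc C) X)"
    if "(X, Y, Z, f, g, h) \<in> Tri (op_tpc C)" for X Y Z f g h
    using Tri_op_typed[OF that] by simp
  have Tid: "colim_T (op_tpc C) X X (colim_class (op_tpc C) X X 0 (idn (op_tpc C) X))
    = colim_class (op_tpc C) (Tr (op_tpc C) X) (Tr (op_tpc C) X) 0 (idn (op_tpc C) (Tr (op_tpc C) X))" if "X \<in> Ob (op_tpc C)" for X
    using colim_T_idn_op that by simp
  note sup = R_tri_C_inf_superset[OF persistence_category_op typed Tid Z' Z(1)]
  show "R_acyclic C \<subseteq> R_tri (C_inf (op_tpc C))"
  proof (rule Rac_least[OF R_tri_subgroup[OF tri_objects_C_inf]])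
    have "R_tri (C_zero (op_tpc C)) \<subseteq> R_tri (C_inf (op_tpc C))"
    proof (rule R_tri_least[OF _ R_tri_subgroup[OF tri_objects_C_inf]])
      show "tri_objects (C_zero (op_tpc C))" unfolding tri_objects_def using Tri_op_typed by auto
      show "frag_of B - (frag_of A + frag_of E) \<in> R_tri (C_inf (op_tpc C))" if "(A, B, E, f, g, h) \<in> ttri (C_zero (op_tpc C))" for A B E f g h
        using sup(1) that by simp
    qed
    then show "R_tri (C_zero C) \<subseteq> R_tri (C_inf (op_tpc C))" by (simp add: R_tri_zero_op)
    show "frag_of A \<in> R_tri (C_inf (op_tpc C))" if "A \<in> acyclics C" for A
      using sup(2) that by simp
  qed
qed

end

section \<open>The cones of \<open>\<eta>\<^sub>r\<close>\<close>

lemma persistence_functor_acyclic: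
  assumes C: "persistence_category k C" and D: "persistence_category k D" and F: "persistence_functor k C D F"
    and ac: "acyclic_of C r X" and r: "r \<ge> 0"
  shows "acyclic_of D r (fob F X)"
proof -
  interpret C: persistence_category k C by fact
  interpret D: persistence_category k D by fact
  have X: "X \<in> Ob C" and z: "inc C 0 r X X (idn C X) = C.zr r X X" using ac by (auto simp: acyclic_of_def)
  have FX: "fob F X \<in> Ob D" "fmor F 0 X X (idn C X) = idn D (fob F X)" using F X by (auto simp: persistence_functor_def)
  have lin: "fmor F r X X \<in> linear_maps k (Hom C r X X) (Hom D r (fob F X) (fob F X))"
    using F X by (auto simp: persistence_functor_def)
  have "fmor F r X X (inc C 0 r X X (idn C X)) = inc D 0 r (fob F X) (fob F X) (fmor F 0 X X (idn C X))"
    using F X C.idn_closed[OF X] r unfolding persistence_functor_def by blast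
  then show ?thesis
    using FX linear_maps_zero[OF C.hom_module[OF X X] D.hom_module[OF FX(1) FX(1)] lin] z by (simp add: acyclic_of_def)
qed

lemma persistence_functor_acyclics:
  assumes "persistence_category k C" "persistence_category k D" "persistence_functor k C D F" "X \<in> acyclics C"
  shows "fob F X \<in> acyclics D"
  using assms(4) persistence_functor_acyclic[OF assms(1-3)] by (auto simp: acyclics_def acyclic_of_def)

lemma triangulated_functor_Tri:
  assumes "triangulated_functor (C_zero C) (C_zero D) Fo Fm" "(X, Y, Z, f, g, h) \<in> Tri C"
  shows "\<exists>h'. (Fo X, Fo Y, Fo Z, Fm X Y f, Fm Y Z g, h') \<in> Tri D"
  using assms unfolding triangulated_functor_def C_zero_simps by blast

lemma is_cone_eta_functor:
  assumes "persistence_category k C" "persistence_category k D" "persistence_functor k C D F"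
    "triangulated_functor (C_zero C) (C_zero D) (fob F) (fmor F 0)"
    and F: "fob F (sh C r X) = sh D r (fob F X)" "fmor F 0 (sh C r X) X (eta_map C r X) = eta_map D r (fob F X)"
    and cone: "is_cone_eta C r X Q" and r: "r \<ge> 0"
  shows "is_cone_eta D r (fob F X) (fob F Q)"
proof -
  obtain g h where tri: "(sh C r X, X, Q, eta_map C r X, g, h) \<in> Tri C" and ac: "acyclic_of C r Q"
    using cone by (auto simp: is_cone_eta_def)
  show ?thesis
    unfolding is_cone_eta_def
    using persistence_functor_acyclic[OF assms(1-3) ac r] triangulated_functor_Tri[OF assms(4) tri] F by auto
qed

context triangulated_category
begin

text \<open>The five lemma for an endomorphism \<open>e\<close> of the third object that is compatible with the identity of \<open>B\<close> and with an automorphism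
  \<open>w\<close> of \<open>TA\<close>. The last hypothesis lets \<open>v w'\<close> lift along \<open>v\<close>; it replaces the square over \<open>TA \<rightarrow> TB\<close>.\<close>

lemma five_lemma_endo:
  assumes tri: "(A, B, E, f, u, v) \<in> ttri D" and e: "e \<in> tmor D E E"
    and w: "w \<in> tmor D (Tob D A) (Tob D A)" "w' \<in> tmor D (Tob D A) (Tob D A)"
      "tcmp D (Tob D A) (Tob D A) (Tob D A) w w' = tidn D (Tob D A)" "tcmp D (Tob D A) (Tob D A) (Tob D A) w' w = tidn D (Tob D A)"
    and ue: "tcmp D B E E u e = u" and ev: "tcmp D E E (Tob D A) e v = tcmp D E (Tob D A) (Tob D A) v w"
    and vw: "tcmp D E (Tob D A) (Tob D B) v (tcmp D (Tob D A) (Tob D A) (Tob D B) w' (Tmor D A B f)) = zer E (Tob D B)"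
  shows "is_iso_in D E E e"
proof -
  note ty = tri_typed[OF tri]
  then have A: "A \<in> tob D" and B: "B \<in> tob D" and E: "E \<in> tob D" and f: "f \<in> tmor D A B" and u: "u \<in> tmor D B E"
    and v: "v \<in> tmor D E (Tob D A)" by auto
  note T = Tob_closed[OF A] and TB = Tob_closed[OF B] and Tf = Tmor_closed[OF A B f]
  let ?c = "tcmp D"
  let ?y = "?c E (Tob D A) (Tob D A) v w'"
  have y: "?y \<in> tmor D E (Tob D A)" using cmp_closed[OF E T T v w(2)] .
  have "?c E (Tob D A) (Tob D B) ?y (Tmor D A B f) = zer E (Tob D B)"
    using cmp_assoc[OF E T T TB v w(2) Tf] vw by simp
  then obtain s0 where s0: "s0 \<in> tmor D E E" "?y = ?c E E (Tob D A) s0 v"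
    using tri_factor_in3[OF tri E y] by blast
  have s0e: "?c E E E s0 e \<in> tmor D E E" using cmp_closed[OF E E E s0(1) e] .
  have "?c E E (Tob D A) (?c E E E s0 e) v = v"
  proof -
    have "?c E E (Tob D A) (?c E E E s0 e) v = ?c E (Tob D A) (Tob D A) ?y w"
      using cmp_assoc[OF E E E T s0(1) e v] cmp_assoc[OF E E T T s0(1) v w(1)] ev s0(2) by simp
    then show ?thesis using cmp_assoc[OF E T T T v w(2,1)] w(4) idn_right[OF E T v] by simp
  qed
  then have "?c E E (Tob D A) (tidn D E \<ominus>\<^bsub>thom D E E\<^esub> ?c E E E s0 e) v = zer E (Tob D A)"
    using cmp_diff_left[OF E E T idn_closed[OF E] s0e v] idn_left[OF E T v] diff_eq_zero_iff[OF E T v v] by simp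
  then obtain z where z: "z \<in> tmor D E B" "tidn D E \<ominus>\<^bsub>thom D E E\<^esub> ?c E E E s0 e = ?c E B E z u"
    using tri_factor_in2[OF tri E diff_closed[OF E E idn_closed[OF E] s0e]] by blast
  have zu: "?c E B E z u \<in> tmor D E E" using cmp_closed[OF E B E z(1) u] .
  let ?s = "s0 \<oplus>\<^bsub>thom D E E\<^esub> ?c E B E z u"
  have s: "?s \<in> tmor D E E" using add_closed[OF E E s0(1) zu] .
  have se: "?c E E E ?s e = tidn D E"
  proof -
    interpret H: abelian_group "thom D E E" by (rule hom_group[OF E E])
    have "?c E E E ?s e = ?c E E E s0 e \<oplus>\<^bsub>thom D E E\<^esub> ?c E B E z u"
      using cmp_add_left[OF E E E s0(1) zu e] cmp_assoc[OF E B E E z(1) u e] ue by simp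
    also have "\<dots> = ?c E E E s0 e \<oplus>\<^bsub>thom D E E\<^esub> (tidn D E \<ominus>\<^bsub>thom D E E\<^esub> ?c E E E s0 e)" using z(2) by simp
    also have "\<dots> = tidn D E"
      using s0e idn_closed[OF E] unfolding tmor_def by (simp add: H.minus_eq H.a_lcomm H.r_neg)
    finally show ?thesis .
  qed
  have inj: "x = zer E E" if x: "x \<in> tmor D E E" and xe: "?c E E E x e = zer E E" for x
  proof -
    have xv: "?c E E (Tob D A) x v \<in> tmor D E (Tob D A)" using cmp_closed[OF E E T x v] .
    have "?c E (Tob D A) (Tob D A) (?c E E (Tob D A) x v) w = zer E (Tob D A)"
      using cmp_assoc[OF E E T T x v w(1)] cmp_assoc[OF E E E T x e v] ev xe cmp_zero_left[OF E E T v] by simp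
    then have "?c E E (Tob D A) x v = zer E (Tob D A)"
      using cmp_assoc[OF E T T T xv w(1,2)] w(3) idn_right[OF E T xv] cmp_zero_left[OF E T T w(2)] by simp
    then obtain z where z: "z \<in> tmor D E B" "x = ?c E B E z u" using tri_factor_in2[OF tri E x] by blast
    then have "?c E E E x e = x" using cmp_assoc[OF E B E E z(1) u e] ue by simp
    then show ?thesis using xe by simp
  qed
  have es: "?c E E E e ?s \<in> tmor D E E" using cmp_closed[OF E E E e s] .
  have "?c E E E (?c E E E e ?s \<ominus>\<^bsub>thom D E E\<^esub> tidn D E) e = zer E E"
    using cmp_diff_left[OF E E E es idn_closed[OF E] e] cmp_assoc[OF E E E E e s e] se idn_left[OF E E e] idn_right[OF E E e]
      diff_eq_zero_iff[OF E E e e] by simp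
  then have "?c E E E e ?s = tidn D E"
    using inj[OF diff_closed[OF E E es idn_closed[OF E]]] diff_eq_zero_iff[OF E E es idn_closed[OF E]] by simp
  then show ?thesis unfolding is_iso_in_def using E e s se by blast
qed

end

definition eta_cone :: "('k, 'o, 'm) tpc \<Rightarrow> real \<Rightarrow> 'o \<Rightarrow> 'o"
  where "eta_cone C r X = (SOME Q. is_cone_eta C r X Q)"

context triangulated_persistence_category
begin

lemma eta_cone: "X \<in> Ob C \<Longrightarrow> r \<ge> 0 \<Longrightarrow> is_cone_eta C r X (eta_cone C r X)"
  unfolding eta_cone_def using someI_ex[OF cone_eta] .

lemma eta_cone_acyclic: "X \<in> Ob C \<Longrightarrow> r \<ge> 0 \<Longrightarrow> eta_cone C r X \<in> acyclics C"
  using cone_eta_acyclic[OF eta_cone] by blast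

lemma is_cone_eta_rel:
  assumes "is_cone_eta C r X Q" "is_cone_eta C r X Q'" "r \<ge> 0"
  shows "frag_of Q - frag_of Q' \<in> R_tri (AC_zero C)"
proof -
  obtain g h g' h' where "(sh C r X, X, Q, eta_map C r X, g, h) \<in> Tri C" "(sh C r X, X, Q', eta_map C r X, g', h') \<in> Tri C"
    using assms by (auto simp: is_cone_eta_def)
  then show ?thesis using cones_rel_RA cone_eta_acyclic[OF assms(1,3)] cone_eta_acyclic[OF assms(2,3)] by blast
qed

lemma is_cone_eta_shift:
  assumes "is_cone_eta C r X Q" "r \<ge> 0" "X \<in> Ob C" shows "is_cone_eta C r (sh C t X) (sh C t Q)"
  by (rule is_cone_eta_functor[OF persistence_category_axioms persistence_category_axioms shift_functor shift_triangulated])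
    (use assms eta_map_shift in \<open>auto simp: shift_add_ob add.commute\<close>)

lemma shift_RA: "x \<in> R_tri (AC_zero C) \<Longrightarrow> frag_extend (\<lambda>X. frag_of (sh C r X)) x \<in> R_tri (AC_zero C)"
proof (rule R_tri_map[OF tri_objects_AC sub_RA additive_map_extend])
  fix A B E f g h assume "(A, B, E, f, g, h) \<in> ttri (AC_zero C)"
  then have tri: "(A, B, E, f, g, h) \<in> Tri C" and ac: "A \<in> acyclics C" "B \<in> acyclics C" "E \<in> acyclics C"
    by (auto simp: AC_tri_iff)
  obtain h' where "(sh C r A, sh C r B, sh C r E, fmor (shift C r) 0 A B f, fmor (shift C r) 0 B E g, h') \<in> Tri C"
    using triangulated_functor_Tri[OF shift_triangulated tri] by blast
  from RA_rel[OF this acyclic_shift[OF ac(1)] acyclic_shift[OF ac(2)] acyclic_shift[OF ac(3)]]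
  show "frag_extend (\<lambda>X. frag_of (sh C r X)) (frag_of B) -
      (frag_extend (\<lambda>X. frag_of (sh C r X)) (frag_of A) + frag_extend (\<lambda>X. frag_of (sh C r X)) (frag_of E)) \<in> R_tri (AC_zero C)"
    by simp
qed auto

lemma eta_cone_shift:
  assumes "X \<in> Ob C" "r \<ge> 0"
  shows "frag_of (eta_cone C r (sh C t X)) - frag_of (sh C t (eta_cone C r X)) \<in> R_tri (AC_zero C)"
  using is_cone_eta_rel[OF eta_cone[OF sh_Ob] is_cone_eta_shift[OF eta_cone]] assms by blast

lemma octahedron:
  assumes "(X, Y, A, f, u, v) \<in> Tri C" "(Y, Z, B, g, s, t) \<in> Tri C" "(X, Z, E, cmp C 0 0 X Y Z f g, p, q) \<in> Tri C"
  shows "\<exists>a b c. (A, E, B, a, b, c) \<in> Tri C \<and> cmp C 0 0 Y A E u a = cmp C 0 0 Y Z E g p \<and>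
    cmp C 0 0 A E (Tr C X) a q = v \<and> cmp C 0 0 Z E B p b = s \<and>
    cmp C 0 0 E B (Tr C Y) b t = cmp C 0 0 E (Tr C X) (Tr C Y) q (Trm C X Y f)"
  using C0.octahedral[of X Y A f u v Z B g s t E p q] assms unfolding C_zero_simps by blast

text \<open>The octahedron on \<open>\<eta>\<^sub>r\<^sub>+\<^sub>t\<^sup>X\<close>, the composite of \<open>\<eta>\<^sub>r\<close> at \<open>\<Sigma>\<^sup>tX\<close> and \<open>\<eta>\<^sub>t\<^sup>X\<close>.\<close>

lemma eta_cone_add:
  assumes X: "X \<in> Ob C" and r: "r \<ge> 0" and t: "t \<ge> 0"
  shows "frag_of (eta_cone C (r + t) X) - (frag_of (eta_cone C r (sh C t X)) + frag_of (eta_cone C t X)) \<in> R_tri (AC_zero C)"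
proof -
  have rt: "r + t \<ge> 0" using r t by simp
  have S: "sh C t X \<in> Ob C" "sh C r (sh C t X) = sh C (r + t) X" using sh_Ob X shift_add_ob by auto
  obtain g1 h1 where 1: "(sh C (r + t) X, sh C t X, eta_cone C r (sh C t X), eta_map C r (sh C t X), g1, h1) \<in> Tri C"
    using eta_cone[OF S(1) r] S(2) by (auto simp: is_cone_eta_def)
  obtain g2 h2 where 2: "(sh C t X, X, eta_cone C t X, eta_map C t X, g2, h2) \<in> Tri C"
    using eta_cone[OF X t] by (auto simp: is_cone_eta_def)
  obtain g3 h3 where 3: "(sh C (r + t) X, X, eta_cone C (r + t) X, eta_map C (r + t) X, g3, h3) \<in> Tri C"
    using eta_cone[OF X rt] by (auto simp: is_cone_eta_def)
  obtain a b c where "(eta_cone C r (sh C t X), eta_cone C (r + t) X, eta_cone C t X, a, b, c) \<in> Tri C"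
    using octahedron[OF 1 2] 3 eta_map_add[OF X r t] by metis
  then show ?thesis using RA_rel eta_cone_acyclic S X r t rt by blast
qed

lemma eta_cone_zero:
  assumes X: "X \<in> Ob C" shows "frag_of (eta_cone C 0 X) \<in> R_tri (AC_zero C)"
proof -
  obtain Z where Z: "is_zero_object (C_zero C) Z" "Z \<in> acyclics C" by (rule obtain_zero)
  obtain g h where 1: "(X, X, eta_cone C 0 X, idn C X, g, h) \<in> Tri C"
    using eta_cone[OF X order_refl] X by (auto simp: is_cone_eta_def shift_0_ob eta_map_0)
  have "(X, X, Z, idn C X, zr 0 X Z, zr 0 Z (Tr C X)) \<in> Tri C" using C0.tri_idn[of X Z] X Z(1) by simp
  then have "frag_of (eta_cone C 0 X) - frag_of Z \<in> R_tri (AC_zero C)"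
    using cones_rel_RA[OF _ 1 Z(2) eta_cone_acyclic[OF X order_refl]] by blast
  then show ?thesis using subgroup_add[OF sub_RA _ zero_rel_RA[OF Z(1)]] by fastforce
qed

text \<open>The threshold for \<open>\<delta>\<close> is the one below which \<open>\<eta>\<^sub>\<delta>\<close> acts bijectively on the listed morphism groups. Let \<open>W\<close> be the cone of the diagonal
  \<open>\<Sigma>\<^sup>\<delta>A \<rightarrow> B\<close>. Its two factorisations give triangles \<open>Q\<^sub>A \<rightarrow> W \<rightarrow> E\<close> and \<open>\<Sigma>\<^sup>\<delta>E \<rightarrow> W \<rightarrow> Q\<^sub>B\<close>, and \<open>e'\<close> is the composite
  \<open>\<Sigma>\<^sup>\<delta>E \<rightarrow> W \<rightarrow> E\<close>.\<close>

lemma eta_cone_additive_small: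
  assumes tri: "(A, B, E, f, u, v) \<in> Tri C"
  shows "\<forall>\<^sub>F \<delta> in at_right 0. frag_of (eta_cone C \<delta> B) - (frag_of (eta_cone C \<delta> A) + frag_of (eta_cone C \<delta> E)) \<in> R_tri (AC_zero C)"
proof -
  have A: "A \<in> Ob C" and B: "B \<in> Ob C" and E: "E \<in> Ob C" and f: "f \<in> mor C 0 A B" and u: "u \<in> mor C 0 B E"
    and v: "v \<in> mor C 0 E (Tr C A)" using Tri_typed[OF tri] by auto
  note TA = Tr_Ob[OF A] and TB = Tr_Ob[OF B]
  show ?thesis
    using eventually_at_right_less small_bij[OF A A] small_bij[OF A B] small_bij[OF TA TA] small_bij[OF E E]
      small_bij[OF B E] small_bij[OF E TA] eta_translate_small[OF A] eta_translate_small[OF B]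
  proof eventually_elim
    case (elim \<delta>)
    let ?c = "cmp C 0 0" and ?S = "sh C \<delta>" and ?F = "fmor (shift C \<delta>) 0" and ?e = "eta_map C \<delta>" and ?T = "Tr C"
    have d: "\<delta> \<ge> 0" using elim(1) by simp
    have S: "?S A \<in> Ob C" "?S B \<in> Ob C" "?S E \<in> Ob C" "?S (?T A) \<in> Ob C" "?S (?T B) \<in> Ob C" using sh_Ob A B E TA TB by auto
    note TS = Tr_Ob[OF S(1)] Tr_Ob[OF S(2)]
    have e: "?e A \<in> mor C 0 (?S A) A" "?e B \<in> mor C 0 (?S B) B" "?e E \<in> mor C 0 (?S E) E"
      "?e (?T A) \<in> mor C 0 (?S (?T A)) (?T A)" "?e (?T B) \<in> mor C 0 (?S (?T B)) (?T B)" using eta_map_mor d A B E TA TB by auto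
    have cancel: "x = x'" if "bij_betw (\<lambda>f. ?c (?S X) X Y (?e X) f) (mor C 0 X Y) (mor C 0 (?S X) Y)"
      "x \<in> mor C 0 X Y" "x' \<in> mor C 0 X Y" "?c (?S X) X Y (?e X) x = ?c (?S X) X Y (?e X) x'" for X Y x x'
      using that by (auto simp: bij_betw_def inj_on_def)
    obtain \<phi> \<psi> where iso: "translation_iso C \<delta> \<phi> \<psi>" using translation_iso_exists by blast
    note phi = translation_iso_mor[OF iso] and psi = translation_iso_mor_inv[OF iso]
    have phi_cancel: "x = x'" if "X \<in> Ob C" "Y \<in> Ob C" "x \<in> mor C 0 (?T (?S X)) Y" "x' \<in> mor C 0 (?T (?S X)) Y"
      "?c (?S (?T X)) (?T (?S X)) Y (\<phi> X) x = ?c (?S (?T X)) (?T (?S X)) Y (\<phi> X) x'" for X Y x x'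
    proof -
      note O1 = Tr_Ob[OF sh_Ob[OF that(1)], of \<delta>] sh_Ob[OF Tr_Ob[OF that(1)], of \<delta>]
      show ?thesis
        using assoc0[OF O1(1,2,1) that(2) psi[OF that(1)] phi[OF that(1)] that(3)]
          assoc0[OF O1(1,2,1) that(2) psi[OF that(1)] phi[OF that(1)] that(4)]
          translation_iso_left[OF iso that(1)] idn_left[OF O1(1) that(2,3)] idn_left[OF O1(1) that(2,4)] that(5) by simp
    qed
    obtain y where y: "y \<in> mor C 0 A A" "?e (?T A) = ?c (?S (?T A)) (?T (?S A)) (?T A) (\<phi> A) (Trm C (?S A) A (?c (?S A) A A (?e A) y))"
      using elim(8) phi[OF A] psi[OF A] translation_iso_right[OF iso A] by blast
    obtain w where w: "w \<in> mor C 0 (?T A) (?T A)" "?c (?S (?T A)) (?T (?S A)) (?T A) (\<phi> A) (Trm C (?S A) A (?e A)) = ?c (?S (?T A)) (?T A) (?T A) (?e (?T A)) w"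
      using elim(8) phi[OF A] psi[OF A] translation_iso_right[OF iso A] by blast
    obtain yB where yB: "yB \<in> mor C 0 B B" "?e (?T B) = ?c (?S (?T B)) (?T (?S B)) (?T B) (\<phi> B) (Trm C (?S B) B (?c (?S B) B B (?e B) yB))"
      using elim(9) phi[OF B] psi[OF B] translation_iso_right[OF iso B] by blast
    let ?w = "Trm C A A y"
    note w' = Trm_mor[OF A A y(1)]
    note Te = Trm_mor[OF S(1) A e(1)] Trm_mor[OF S(2) B e(2)] and Tf = Trm_mor[OF A B f]
    have eTA: "?e (?T A) = ?c (?S (?T A)) (?T A) (?T A) (?c (?S (?T A)) (?T (?S A)) (?T A) (\<phi> A) (Trm C (?S A) A (?e A))) ?w"
      by (rule trans[OF y(2)[unfolded Trm_cmp[OF S(1) A A e(1) y(1)]] assoc0[OF S(4) TS(1) TA TA phi[OF A] Te(1) w', symmetric]])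
    \<comment> \<open>\<open>w\<close> and \<open>Ty\<close> compare \<open>T\<eta>\<^sub>\<delta>\<^sup>A\<close> with \<open>\<eta>\<^sub>\<delta>\<^sup>T\<^sup>A\<close> in the two directions, so they are mutually inverse\<close>
    have ww': "?c (?T A) (?T A) (?T A) w ?w = idn C (?T A)"
    proof (rule cancel[OF elim(4) cmp0[OF TA TA TA w(1) w'] idn_closed[OF TA]])
      show "?c (?S (?T A)) (?T A) (?T A) (?e (?T A)) (?c (?T A) (?T A) (?T A) w ?w) = ?c (?S (?T A)) (?T A) (?T A) (?e (?T A)) (idn C (?T A))"
        unfolding assoc0[OF S(4) TA TA TA e(4) w(1) w', symmetric] w(2)[symmetric] eTA[symmetric] idn_right[OF S(4) TA e(4)] ..
    qed
    have w'w: "?c (?T A) (?T A) (?T A) ?w w = idn C (?T A)"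
    proof -
      have m: "?c (?T A) (?T A) (?T A) ?w w \<in> mor C 0 (?T A) (?T A)" using cmp0[OF TA TA TA w' w(1)] .
      obtain z where z: "z \<in> mor C 0 A A" "?c (?T A) (?T A) (?T A) ?w w = Trm C A A z" using Trm_surj[OF A A m] by blast
      have ez: "?c (?S A) A A (?e A) z \<in> mor C 0 (?S A) A" using cmp0[OF S(1) A A e(1) z(1)] .
      have phe: "?c (?S (?T A)) (?T (?S A)) (?T A) (\<phi> A) (Trm C (?S A) A (?e A)) \<in> mor C 0 (?S (?T A)) (?T A)"
        using cmp0[OF S(4) TS(1) TA phi[OF A] Te(1)] .
      have "?c (?S (?T A)) (?T (?S A)) (?T A) (\<phi> A) (Trm C (?S A) A (?c (?S A) A A (?e A) z))
          = ?c (?S (?T A)) (?T A) (?T A) (?c (?S (?T A)) (?T (?S A)) (?T A) (\<phi> A) (Trm C (?S A) A (?e A))) (?c (?T A) (?T A) (?T A) ?w w)"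
        unfolding Trm_cmp[OF S(1) A A e(1) z(1)] z(2) using assoc0[OF S(4) TS(1) TA TA phi[OF A] Te(1) Trm_mor[OF A A z(1)]] by simp
      also have "\<dots> = ?c (?S (?T A)) (?T A) (?T A) (?e (?T A)) w"
        using assoc0[OF S(4) TA TA TA phe w' w(1)] eTA by simp
      finally have "Trm C (?S A) A (?c (?S A) A A (?e A) z) = Trm C (?S A) A (?e A)"
        using phi_cancel[OF A TA Trm_mor[OF S(1) A ez] Te(1)] w(2) by simp
      then have "?c (?S A) A A (?e A) z = ?e A" using Trm_inj[OF S(1) A ez e(1)] by blast
      then have "z = idn C A" using cancel[OF elim(2) z(1) idn_closed[OF A]] idn_right[OF S(1) A e(1)] by simp
      then show ?thesis using z(2) Trm_idn[OF A] by simp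
    qed
    \<comment> \<open>the comparison is natural: both sides become equal after \<open>\<eta>\<^sub>\<delta>\<^sup>A\<close>, \<open>T\<close> and \<open>\<phi>\<close>\<close>
    have yf: "?c A A B y f = ?c A B B f yB"
    proof -
      have m: "?c A A B y f \<in> mor C 0 A B" "?c A B B f yB \<in> mor C 0 A B" using cmp0[OF A A B y(1) f] cmp0[OF A B B f yB(1)] .
      have em: "?c (?S A) A A (?e A) y \<in> mor C 0 (?S A) A" "?c (?S B) B B (?e B) yB \<in> mor C 0 (?S B) B"
        "?c (?S A) A B (?e A) (?c A A B y f) \<in> mor C 0 (?S A) B" "?c (?S A) A B (?e A) (?c A B B f yB) \<in> mor C 0 (?S A) B"
        using cmp0[OF S(1) A A e(1) y(1)] cmp0[OF S(2) B B e(2) yB(1)] cmp0[OF S(1) A B e(1) m(1)] cmp0[OF S(1) A B e(1) m(2)] .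
      note Sf = shift_mor[OF A B f, of \<delta>] and STf = shift_mor[OF TA TB Tf, of \<delta>]
      have "?c (?S (?T A)) (?T (?S A)) (?T B) (\<phi> A) (Trm C (?S A) B (?c (?S A) A B (?e A) (?c A A B y f)))
          = ?c (?S (?T A)) (?T A) (?T B) (?e (?T A)) (Trm C A B f)"
      proof -
        have "Trm C (?S A) B (?c (?S A) A B (?e A) (?c A A B y f)) = ?c (?T (?S A)) (?T A) (?T B) (Trm C (?S A) A (?c (?S A) A A (?e A) y)) (Trm C A B f)"
          using Trm_cmp[OF S(1) A B em(1) f] assoc0[OF S(1) A A B e(1) y(1) f] by simp
        then show ?thesis
          using assoc0[OF S(4) TS(1) TA TB phi[OF A] Trm_mor[OF S(1) A em(1)] Tf] y(2) by simp
      qed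
      also have "\<dots> = ?c (?S (?T A)) (?S (?T B)) (?T B) (?F (?T A) (?T B) (Trm C A B f)) (?e (?T B))"
        using eta_map_natural[OF TA TB Tf d] by simp
      also have "\<dots> = ?c (?S (?T A)) (?T (?S B)) (?T B) (?c (?S (?T A)) (?T (?S A)) (?T (?S B)) (\<phi> A) (Trm C (?S A) (?S B) (?F A B f)))
          (Trm C (?S B) B (?c (?S B) B B (?e B) yB))"
        unfolding yB(2) using assoc0[OF S(4,5) TS(2) TB STf phi[OF B] Trm_mor[OF S(2) B em(2)]] translation_iso_natural[OF iso A B f] by simp
      also have "\<dots> = ?c (?S (?T A)) (?T (?S A)) (?T B) (\<phi> A) (Trm C (?S A) B (?c (?S A) (?S B) B (?F A B f) (?c (?S B) B B (?e B) yB)))"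
        using assoc0[OF S(4) TS(1,2) TB phi[OF A] Trm_mor[OF S(1,2) Sf] Trm_mor[OF S(2) B em(2)]] Trm_cmp[OF S(1,2) B Sf em(2)] by simp
      also have "?c (?S A) (?S B) B (?F A B f) (?c (?S B) B B (?e B) yB) = ?c (?S A) A B (?e A) (?c A B B f yB)"
        using assoc0[OF S(1,2) B B Sf e(2) yB(1)] assoc0[OF S(1) A B B e(1) f yB(1)] eta_map_natural[OF A B f d] by simp
      finally have "Trm C (?S A) B (?c (?S A) A B (?e A) (?c A A B y f)) = Trm C (?S A) B (?c (?S A) A B (?e A) (?c A B B f yB))"
        using phi_cancel[OF A TB Trm_mor[OF S(1) B em(3)] Trm_mor[OF S(1) B em(4)]] by blast
      then show ?thesis
        using cancel[OF elim(3) m] Trm_inj[OF S(1) B em(3,4)] by blast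
    qed
    have vwf: "?c E (?T A) (?T B) v (?c (?T A) (?T A) (?T B) ?w (Trm C A B f)) = zr 0 E (?T B)"
    proof -
      have "?c (?T A) (?T A) (?T B) ?w (Trm C A B f) = ?c (?T A) (?T B) (?T B) (Trm C A B f) (Trm C B B yB)"
        using Trm_cmp[OF A A B y(1) f] Trm_cmp[OF A B B f yB(1)] yf by simp
      moreover have "?c E (?T A) (?T B) v (Trm C A B f) = zr 0 E (?T B)" using C0.tri_cmp_zero3[of A B E f u v] tri by simp
      ultimately show ?thesis
        using assoc0[OF E TA TB TB v Tf Trm_mor[OF B B yB(1)]] cmp_zr_left[OF E TB TB Trm_mor[OF B B yB(1)], of 0] by simp
    qed
    obtain gA hA where QA: "(?S A, A, eta_cone C \<delta> A, ?e A, gA, hA) \<in> Tri C" using eta_cone[OF A d] by (auto simp: is_cone_eta_def)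
    obtain gB hB where QB: "(?S B, B, eta_cone C \<delta> B, ?e B, gB, hB) \<in> Tri C" using eta_cone[OF B d] by (auto simp: is_cone_eta_def)
    obtain gE hE where QE: "(?S E, E, eta_cone C \<delta> E, ?e E, gE, hE) \<in> Tri C" using eta_cone[OF E d] by (auto simp: is_cone_eta_def)
    note ac = eta_cone_acyclic[OF A d] eta_cone_acyclic[OF B d] eta_cone_acyclic[OF E d]
    let ?v = "?c (?S E) (?S (?T A)) (?T (?S A)) (?F E (?T A) v) (\<phi> A)"
    have tri': "(?S A, ?S B, ?S E, ?F A B f, ?F B E u, ?v) \<in> Tri C" using translation_iso_Tri[OF iso tri] .
    note Sf = shift_mor[OF A B f, of \<delta>] and Su = shift_mor[OF B E u, of \<delta>] and Sv = shift_mor[OF E TA v, of \<delta>]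
    obtain W p q where W: "(?S A, B, W, ?c (?S A) A B (?e A) f, p, q) \<in> Tri C"
      using C0.tri_cone[of "?S A" B "?c (?S A) A B (?e A) f"] cmp0[OF S(1) A B e(1) f] S(1) B by auto
    have Wt: "W \<in> Ob C" "p \<in> mor C 0 B W" "q \<in> mor C 0 W (?T (?S A))" using Tri_typed[OF W] by auto
    \<comment> \<open>the octahedra over the two factorisations of the diagonal\<close>
    obtain a b c where O1: "(eta_cone C \<delta> A, W, E, a, b, c) \<in> Tri C" "?c B W E p b = u"
      "?c W E (?T A) b v = ?c W (?T (?S A)) (?T A) q (Trm C (?S A) A (?e A))"
      using octahedron[OF QA tri W] by blast
    have W': "(?S A, B, W, ?c (?S A) (?S B) B (?F A B f) (?e B), p, q) \<in> Tri C" using W eta_map_natural[OF A B f d] by simp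
    obtain a' b' c' where O2: "(?S E, W, eta_cone C \<delta> B, a', b', c') \<in> Tri C" "?c (?S B) (?S E) W (?F B E u) a' = ?c (?S B) B W (?e B) p"
      "?c (?S E) W (?T (?S A)) a' q = ?v"
      using octahedron[OF tri' QB W'] by blast
    have b: "b \<in> mor C 0 W E" and a': "a' \<in> mor C 0 (?S E) W" using Tri_typed[OF O1(1)] Tri_typed[OF O2(1)] by auto
    let ?e' = "?c (?S E) W E a' b"
    have e': "?e' \<in> mor C 0 (?S E) E" using cmp0[OF S(3) Wt(1) E a' b] .
    have Sue: "?c (?S B) (?S E) E (?F B E u) ?e' = ?c (?S B) B E (?e B) u"
      using assoc0[OF S(2,3) Wt(1) E Su a' b] assoc0[OF S(2) B Wt(1) E e(2) Wt(2) b] O1(2) O2(2) by simp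
    have ev: "?c (?S E) E (?T A) ?e' v = ?c (?S E) E (?T A) (?e E) (?c E (?T A) (?T A) v w)"
    proof -
      have "?c (?S E) E (?T A) ?e' v = ?c (?S E) (?T (?S A)) (?T A) ?v (Trm C (?S A) A (?e A))"
        using assoc0[OF S(3) Wt(1) E TA a' b v] assoc0[OF S(3) Wt(1) TS(1) TA a' Wt(3) Te(1)] O1(3) O2(3) by simp
      also have "\<dots> = ?c (?S E) (?S (?T A)) (?T A) (?F E (?T A) v) (?c (?S (?T A)) (?T A) (?T A) (?e (?T A)) w)"
        using assoc0[OF S(3,4) TS(1) TA Sv phi[OF A] Te(1)] w(2) by simp
      also have "\<dots> = ?c (?S E) E (?T A) (?e E) (?c E (?T A) (?T A) v w)"
        using assoc0[OF S(3,4) TA TA Sv e(4) w(1)] assoc0[OF S(3) E TA TA e(3) v w(1)] eta_map_natural[OF E TA v d] by simp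
      finally show ?thesis .
    qed
    obtain x where x: "x \<in> mor C 0 E E" "?e' = ?c (?S E) E E (?e E) x" using elim(5) e' by (auto simp: bij_betw_def)
    have ux: "?c B E E u x = u"
    proof (rule cancel[OF elim(6) cmp0[OF B E E u x(1)] u])
      show "?c (?S B) B E (?e B) (?c B E E u x) = ?c (?S B) B E (?e B) u"
        using assoc0[OF S(2) B E E e(2) u x(1)] assoc0[OF S(2,3) E E Su e(3) x(1)] eta_map_natural[OF B E u d] Sue x(2) by simp
    qed
    have xv: "?c E E (?T A) x v = ?c E (?T A) (?T A) v w"
    proof (rule cancel[OF elim(7) cmp0[OF E E TA x(1) v] cmp0[OF E TA TA v w(1)]])
      show "?c (?S E) E (?T A) (?e E) (?c E E (?T A) x v) = ?c (?S E) E (?T A) (?e E) (?c E (?T A) (?T A) v w)"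
        using assoc0[OF S(3) E E TA e(3) x(1) v] ev x(2) by simp
    qed
    have xiso: "is_iso_in (C_zero C) E E x"
      using C0.five_lemma_endo[of A B E f u v x w ?w] tri x(1) w(1) w' ww' w'w ux xv vwf by simp
    obtain Z where Z: "is_zero_object (C_zero C) Z" "Z \<in> acyclics C" by (rule obtain_zero)
    obtain g1 h1 where xtri: "(E, E, Z, x, g1, h1) \<in> Tri C" using C0.tri_of_iso[OF xiso Z(1)] that by simp
    obtain Q p' q' where Q: "(?S E, E, Q, ?e', p', q') \<in> Tri C"
      using C0.tri_cone[of "?S E" E ?e'] e' S(3) E by auto
    obtain g2 h2 where btri: "(W, E, ?T (eta_cone C \<delta> A), b, g2, h2) \<in> Tri C" using Tri_rotate[OF O1(1)] by blast
    \<comment> \<open>the octahedra on \<open>e' = a' b\<close> and on \<open>e' = \<eta>\<^sub>\<delta>\<^sup>E x\<close> compute the class of the cone of \<open>e'\<close> twice\<close>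
    obtain a1 b1 c1 where O3: "(eta_cone C \<delta> B, Q, ?T (eta_cone C \<delta> A), a1, b1, c1) \<in> Tri C"
      using octahedron[OF O2(1) btri Q] by blast
    obtain a2 b2 c2 where O4: "(eta_cone C \<delta> E, Q, Z, a2, b2, c2) \<in> Tri C"
      using octahedron[OF QE xtri Q[unfolded x(2)]] by blast
    have Qac: "Q \<in> acyclics C" using acyclic_extension[OF O4 ac(3) Z(2)] .
    note TQA = acyclic_translate[OF ac(1)]
    let ?R = "R_tri (AC_zero C)"
    have "(frag_of Q - (frag_of (eta_cone C \<delta> E) + frag_of Z)) + frag_of Z - (frag_of Q - (frag_of (eta_cone C \<delta> B) + frag_of (?T (eta_cone C \<delta> A))))
        - (frag_of (?T (eta_cone C \<delta> A)) + frag_of (eta_cone C \<delta> A)) \<in> ?R"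
      by (intro subgroup_diff[OF sub_RA] subgroup_add[OF sub_RA] RA_rel[OF O3 ac(2) Qac TQA] RA_rel[OF O4 ac(3) Qac Z(2)]
          translate_rel_RA[OF ac(1)] zero_rel_RA[OF Z(1)])
    then show ?case by (simp add: algebra_simps)
  qed
qed

text \<open>Additivity at \<open>s\<close> and at \<open>t\<close> gives additivity at \<open>s + t\<close>, so it spreads from small values to all multiples.\<close>

theorem eta_cone_additive:
  assumes tri: "(A, B, E, f, g, h) \<in> Tri C" and r: "r \<ge> 0"
  shows "frag_of (eta_cone C r B) - (frag_of (eta_cone C r A) + frag_of (eta_cone C r E)) \<in> R_tri (AC_zero C)"
proof -
  let ?q = "\<lambda>r X. frag_of (eta_cone C r X)" and ?R = "R_tri (AC_zero C)" and ?s = "\<lambda>t. frag_extend (\<lambda>X. frag_of (sh C t X))"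
  let ?D = "\<lambda>r. ?q r B - (?q r A + ?q r E) \<in> ?R"
  have Ob: "A \<in> Ob C" "B \<in> Ob C" "E \<in> Ob C" using Tri_typed[OF tri] by auto
  have step: "?D (s + t)" if D: "?D s" "?D t" and s: "s \<ge> 0" and t: "t \<ge> 0" for s t
  proof -
    have 1: "?q (s + t) X - (?s t (?q s X) + ?q t X) \<in> ?R" if "X \<in> Ob C" for X
      using subgroup_add[OF sub_RA eta_cone_add[OF that s t] eta_cone_shift[OF that s, of t]] by (simp add: algebra_simps)
    have "(?q (s + t) B - (?s t (?q s B) + ?q t B)) - (?q (s + t) A - (?s t (?q s A) + ?q t A)) - (?q (s + t) E - (?s t (?q s E) + ?q t E))
       + ?s t (?q s B - (?q s A + ?q s E)) + (?q t B - (?q t A + ?q t E)) \<in> ?R"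
      by (intro subgroup_diff[OF sub_RA] subgroup_add[OF sub_RA] 1 Ob D shift_RA)
    then show ?thesis by (simp add: frag_extend_diff frag_extend_add algebra_simps)
  qed
  have zero: "?D 0"
    by (intro subgroup_diff[OF sub_RA] subgroup_add[OF sub_RA] eta_cone_zero Ob)
  show ?thesis
  proof (cases "r = 0")
    case False
    then have r0: "r > 0" using r by simp
    obtain \<epsilon> where \<epsilon>: "\<epsilon> > 0" "\<And>\<delta>. 0 < \<delta> \<Longrightarrow> \<delta> < \<epsilon> \<Longrightarrow> ?D \<delta>"
      using eta_cone_additive_small[OF tri] unfolding eventually_at_right_field by blast
    obtain n :: nat where n: "r < real n * \<epsilon>" using ex_less_of_nat_mult[OF \<epsilon>(1)] by blast
    then have n0: "n > 0" using r by (cases n) auto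
    let ?\<delta> = "r / real n"
    have d: "?\<delta> > 0" "?\<delta> < \<epsilon>" using n n0 r0 by (auto simp: field_simps)
    have "?D (real m * ?\<delta>)" for m
    proof (induction m)
      case (Suc m)
      have "real (Suc m) * ?\<delta> = real m * ?\<delta> + ?\<delta>" by (simp add: algebra_simps add_divide_distrib)
      moreover have "real m * ?\<delta> \<ge> 0" "?\<delta> \<ge> 0" using d(1) r by auto
      ultimately show ?case using step[OF Suc \<epsilon>(2)[OF d]] by metis
    qed (use zero in simp)
    from this[of n] show ?thesis using n0 by simp
  qed (use zero in simp)
qed

end

section \<open>The four functors\<close>

abbreviation chains :: "'o set \<Rightarrow> ('o \<Rightarrow>\<^sub>0 int) set"
  where "chains S \<equiv> {c. Poly_Mapping.keys c \<subseteq> S}"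

abbreviation shift_ext :: "('k, 'o, 'm) tpc \<Rightarrow> real \<Rightarrow> ('o \<Rightarrow>\<^sub>0 int) \<Rightarrow> ('o \<Rightarrow>\<^sub>0 int)"
  where "shift_ext C r \<equiv> frag_extend (\<lambda>X. frag_of (sh C r X))"

lemma chains_extend:
  assumes "\<And>X. X \<in> S \<Longrightarrow> Poly_Mapping.keys (f X) \<subseteq> T" "c \<in> chains S" shows "frag_extend f c \<in> chains T"
  using keys_frag_extend[of f c] assms by blast

text \<open>The shifts \<open>\<Sigma>\<^sup>r\<close>, the functors of \<open>TPC\<close> and the functors \<open>(-) \<otimes> A\<close> are all of this kind. Such a functor preserves acyclic objects, because
  acyclicity is an equation on the identity, and therefore all relations.\<close>

locale exact_functor = C: triangulated_persistence_category k C + D: triangulated_persistence_category k D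
  for k :: "('k, 'x) ring_scheme" and C :: "('k, 'o, 'm) tpc" and D :: "('k, 'p, 'n) tpc" +
  fixes F :: "('o, 'm, 'p, 'n) pfun"
  assumes pers: "persistence_functor k C D F"
    and tri: "triangulated_functor (C_zero C) (C_zero D) (fob F) (fmor F 0)"
begin

lemma F_Ob: "X \<in> Ob C \<Longrightarrow> fob F X \<in> Ob D"
  using pers by (auto simp: persistence_functor_def)

lemma F_acyclic: "X \<in> acyclics C \<Longrightarrow> fob F X \<in> acyclics D"
  using persistence_functor_acyclics[OF C.persistence_category_axioms D.persistence_category_axioms pers] .

lemma F_Tri: "(X, Y, Z, f, g, h) \<in> Tri C \<Longrightarrow> \<exists>f' g' h'. (fob F X, fob F Y, fob F Z, f', g', h') \<in> Tri D"
  using triangulated_functor_Tri[OF tri] by blast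

lemma F_iso: "isomorphic_in (C_zero C) X Y \<Longrightarrow> isomorphic_in (C_zero D) (fob F X) (fob F Y)"
proof -
  assume "isomorphic_in (C_zero C) X Y"
  then obtain f g where X: "X \<in> Ob C" "Y \<in> Ob C" and f: "f \<in> mor C 0 X Y" and g: "g \<in> mor C 0 Y X"
    and fg: "cmp C 0 0 X Y X f g = idn C X" "cmp C 0 0 Y X Y g f = idn C Y"
    by (auto simp: isomorphic_in_def is_iso_in_def)
  have fn: "fmor F 0 X X (idn C X) = idn D (fob F X)" "fmor F 0 Y Y (idn C Y) = idn D (fob F Y)"
    "fmor F 0 X Y f \<in> mor D 0 (fob F X) (fob F Y)" "fmor F 0 Y X g \<in> mor D 0 (fob F Y) (fob F X)"
    "fmor F 0 X X (cmp C 0 0 X Y X f g) = cmp D 0 0 (fob F X) (fob F Y) (fob F X) (fmor F 0 X Y f) (fmor F 0 Y X g)"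
    "fmor F 0 Y Y (cmp C 0 0 Y X Y g f) = cmp D 0 0 (fob F Y) (fob F X) (fob F Y) (fmor F 0 Y X g) (fmor F 0 X Y f)"
    using tri X f g unfolding triangulated_functor_def C_zero_simps by blast+
  show ?thesis
    unfolding isomorphic_in_def is_iso_in_def C_zero_simps using F_Ob X fn fg by metis
qed

lemma free_map_chains: "c \<in> chains (Ob C) \<Longrightarrow> free_map F c \<in> chains (Ob D)"
  unfolding free_map_def by (rule chains_extend) (auto simp: F_Ob)

lemma free_map_acyclic_chains: "c \<in> chains (acyclics C) \<Longrightarrow> free_map F c \<in> chains (acyclics D)"
  unfolding free_map_def by (rule chains_extend) (auto simp: F_acyclic)

lemma free_map_R0: "x \<in> R_tri (C_zero C) \<Longrightarrow> free_map F x \<in> R_tri (C_zero D)"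
  unfolding free_map_def
proof (rule R_tri_map[OF C.C0.tri_objects D.sub_R0 additive_map_extend])
  fix A B E f g h assume "(A, B, E, f, g, h) \<in> ttri (C_zero C)"
  then obtain f' g' h' where "(fob F A, fob F B, fob F E, f', g', h') \<in> Tri D" using F_Tri by fastforce
  from D.R0_rel[OF this] show "frag_extend (\<lambda>X. frag_of (fob F X)) (frag_of B) -
      (frag_extend (\<lambda>X. frag_of (fob F X)) (frag_of A) + frag_extend (\<lambda>X. frag_of (fob F X)) (frag_of E)) \<in> R_tri (C_zero D)"
    by simp
qed

lemma free_map_RA: "x \<in> R_tri (AC_zero C) \<Longrightarrow> free_map F x \<in> R_tri (AC_zero D)"
  unfolding free_map_def
proof (rule R_tri_map[OF C.tri_objects_AC D.sub_RA additive_map_extend])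
  fix A B E f g h assume "(A, B, E, f, g, h) \<in> ttri (AC_zero C)"
  then have tri: "(A, B, E, f, g, h) \<in> Tri C" and ac: "A \<in> acyclics C" "B \<in> acyclics C" "E \<in> acyclics C"
    by (auto simp: C.AC_tri_iff)
  obtain f' g' h' where "(fob F A, fob F B, fob F E, f', g', h') \<in> Tri D" using F_Tri[OF tri] by blast
  from D.RA_rel[OF this F_acyclic[OF ac(1)] F_acyclic[OF ac(2)] F_acyclic[OF ac(3)]]
  show "frag_extend (\<lambda>X. frag_of (fob F X)) (frag_of B) -
      (frag_extend (\<lambda>X. frag_of (fob F X)) (frag_of A) + frag_extend (\<lambda>X. frag_of (fob F X)) (frag_of E)) \<in> R_tri (AC_zero D)"
    by simp
qed

lemma free_map_Rac: "x \<in> R_acyclic C \<Longrightarrow> free_map F x \<in> R_acyclic D"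
proof -
  have add: "additive_map (free_map F)" unfolding free_map_def by (rule additive_map_extend)
  have "R_acyclic C \<subseteq> free_map F -` R_acyclic D"
  proof (rule C.Rac_least[OF subgroup_vimage[OF add D.sub_Rac]])
    show "R_tri (C_zero C) \<subseteq> free_map F -` R_acyclic D"
      using free_map_R0 D.R0_Rac by auto
    show "frag_of A \<in> free_map F -` R_acyclic D" if "A \<in> acyclics C" for A
      using F_acyclic[OF that] D.acyclic_Rac[of "frag_of (fob F A)"] by (simp add: free_map_def)
  qed
  then show "x \<in> R_acyclic C \<Longrightarrow> free_map F x \<in> R_acyclic D" by auto
qed

end

lemma additive_free_map [intro]: "additive_map (free_map F)"
  unfolding free_map_def by (rule additive_map_extend)

context triangulated_persistence_category
begin

lemma exact_shift: "exact_functor k C C (shift C r)"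
  by (intro exact_functor.intro exact_functor_axioms.intro triangulated_persistence_category_axioms shift_functor shift_triangulated)

lemma shift_ext_free_map: "shift_ext C r = free_map (shift C r)"
  by (simp add: free_map_def fun_eq_iff)

lemmas shift_chains = exact_functor.free_map_chains[OF exact_shift, folded shift_ext_free_map]
  and shift_acyclic_chains = exact_functor.free_map_acyclic_chains[OF exact_shift, folded shift_ext_free_map]
  and shift_R0 = exact_functor.free_map_R0[OF exact_shift, folded shift_ext_free_map]
  and shift_Rac = exact_functor.free_map_Rac[OF exact_shift, folded shift_ext_free_map]

lemma TorG_frag_group: "frag_group (TorG C) (chains (acyclics C) \<inter> R_tri (C_zero C))"
  unfolding TorG_def using frag_group_restrict[OF G_free_frag_group[of "AC_zero C"] sub_R0] by simp

lemma quotient_K: "novikov_quotient (G_free (C_zero C)) (chains (Ob C)) (R_tri (C_zero C)) (Ob C) (sh C)"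
  by unfold_locales (use G_free_frag_group[of "C_zero C"] sub_R0 R_tri_carrier[OF C0.tri_objects] shift_0_ob shift_add_ob
      shift_chains shift_R0 in auto)

lemma quotient_KA: "novikov_quotient (G_free (AC_zero C)) (chains (acyclics C)) (R_tri (AC_zero C)) (Ob C) (sh C)"
  by unfold_locales (use G_free_frag_group[of "AC_zero C"] sub_RA R_tri_carrier[OF tri_objects_AC] shift_0_ob shift_add_ob
      shift_acyclic_chains shift_RA acyclics_Ob in auto)

lemma quotient_K_inf: "novikov_quotient (G_free (C_inf C)) (chains (Ob C)) (R_tri (C_inf C)) (Ob C) (sh C)"
  unfolding R_tri_C_inf
  by unfold_locales (use G_free_frag_group[of "C_inf C"] sub_Rac Rac_Ob shift_0_ob shift_add_ob
      shift_chains shift_Rac in auto)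

lemma quotient_TorK: "novikov_quotient (TorG C) (chains (acyclics C) \<inter> R_tri (C_zero C)) (R_tri (AC_zero C)) (Ob C) (sh C)"
  by unfold_locales (use TorG_frag_group sub_RA R_tri_carrier[OF tri_objects_AC] RA_R0 shift_0_ob shift_add_ob
      shift_acyclic_chains shift_R0 shift_RA acyclics_Ob in auto)

lemmas quot_K = novikov_quotient.axioms(1)[OF quotient_K]
  and quot_KA = novikov_quotient.axioms(1)[OF quotient_KA]
  and quot_K_inf = novikov_quotient.axioms(1)[OF quotient_K_inf]
  and quot_TorK = novikov_quotient.axioms(1)[OF quotient_TorK]

lemma carrier_K: "carrier (K C) = coset (R_tri (C_zero C)) ` chains (Ob C)"
  and carrier_KA: "carrier (KA C) = coset (R_tri (AC_zero C)) ` chains (acyclics C)"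
  and carrier_K_inf: "carrier (K_inf C) = coset (R_tri (C_inf C)) ` chains (Ob C)"
  and carrier_TorK: "carrier (TorK C) = coset (R_tri (AC_zero C)) ` (chains (acyclics C) \<inter> R_tri (C_zero C))"
  unfolding K_def KA_def K_inf_def TorK_def K_group_def
  using novikov_quotient.module_simps(1)[OF quotient_K refl] novikov_quotient.module_simps(1)[OF quotient_KA refl]
    novikov_quotient.module_simps(1)[OF quotient_K_inf refl] novikov_quotient.module_simps(1)[OF quotient_TorK refl] by blast+

lemma zero_K: "\<zero>\<^bsub>K C\<^esub> = coset (R_tri (C_zero C)) 0" and zero_K_inf: "\<zero>\<^bsub>K_inf C\<^esub> = coset (R_tri (C_inf C)) 0"
  unfolding K_def K_inf_def K_group_def
  using novikov_quotient.module_simps(4)[OF quotient_K refl] novikov_quotient.module_simps(4)[OF quotient_K_inf refl] by blast+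

lemma modules: "module Novikov (K C)" "module Novikov (KA C)" "module Novikov (K_inf C)" "module Novikov (TorK C)"
  unfolding K_def KA_def K_inf_def TorK_def K_group_def
  using novikov_quotient.module_quot[OF quotient_K refl] novikov_quotient.module_quot[OF quotient_KA refl]
    novikov_quotient.module_quot[OF quotient_K_inf refl] novikov_quotient.module_quot[OF quotient_TorK refl] .

subsection \<open>The comparison maps and the exact sequence\<close>

lemma sub_R_inf: "is_subgroup (R_tri (C_inf C))"
  by (simp add: R_tri_C_inf sub_Rac)

lemma psi_coset: "g \<in> chains (acyclics C) \<inter> R_tri (C_zero C) \<Longrightarrow> psi_map C (coset (R_tri (AC_zero C)) g) = coset (R_tri (AC_zero C)) g"
  unfolding psi_map_def by (rule quot_map_coset[OF quot_TorK quot_KA additive_map_id])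

lemma j_coset: "g \<in> chains (acyclics C) \<Longrightarrow> j_map C (coset (R_tri (AC_zero C)) g) = coset (R_tri (C_zero C)) g"
  unfolding j_map_def by (rule quot_map_coset[OF quot_KA quot_K additive_map_id]) (use RA_R0 in auto)

lemma pi_coset: "g \<in> chains (Ob C) \<Longrightarrow> pi_map C (coset (R_tri (C_zero C)) g) = coset (R_tri (C_inf C)) g"
  unfolding pi_map_def by (rule quot_map_coset[OF quot_K quot_K_inf additive_map_id]) (use R0_Rac R_tri_C_inf in auto)

lemma Q_relations:
  assumes r: "r \<ge> 0"
  shows "x \<in> R_tri (C_zero C) \<Longrightarrow> frag_extend (\<lambda>X. frag_of (eta_cone C r X)) x \<in> R_tri (AC_zero C)"
proof (rule R_tri_map[OF C0.tri_objects sub_RA additive_map_extend])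
  fix A B E f g h assume "(A, B, E, f, g, h) \<in> ttri (C_zero C)"
  then have "(A, B, E, f, g, h) \<in> Tri C" by simp
  from eta_cone_additive[OF this r]
  show "frag_extend (\<lambda>X. frag_of (eta_cone C r X)) (frag_of B) - (frag_extend (\<lambda>X. frag_of (eta_cone C r X)) (frag_of A)
      + frag_extend (\<lambda>X. frag_of (eta_cone C r X)) (frag_of E)) \<in> R_tri (AC_zero C)" by simp
qed auto

lemma Q_chains: "r \<ge> 0 \<Longrightarrow> x \<in> chains (Ob C) \<Longrightarrow> frag_extend (\<lambda>X. frag_of (eta_cone C r X)) x \<in> chains (acyclics C)"
  by (rule chains_extend) (auto simp: eta_cone_acyclic)

lemma Q_map_eq: "Q_map C r = quot_map (G_free (AC_zero C)) (R_tri (AC_zero C)) (frag_extend (\<lambda>X. frag_of (eta_cone C r X)))"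
  by (simp add: Q_map_def eta_cone_def)

lemma Q_coset: "r \<ge> 0 \<Longrightarrow> g \<in> chains (Ob C) \<Longrightarrow>
    Q_map C r (coset (R_tri (C_zero C)) g) = coset (R_tri (AC_zero C)) (frag_extend (\<lambda>X. frag_of (eta_cone C r X)) g)"
  unfolding Q_map_eq by (rule quot_map_coset[OF quot_K quot_KA additive_map_extend Q_relations])

lemma comparison_linear:
  "psi_map C \<in> linear_maps Novikov (TorK C) (KA C)" "j_map C \<in> linear_maps Novikov (KA C) (K C)"
  "pi_map C \<in> linear_maps Novikov (K C) (K_inf C)"
  unfolding K_def KA_def K_inf_def TorK_def K_group_def psi_map_def j_map_def pi_map_def
proof -
  show "quot_map (G_free (AC_zero C)) (R_tri (AC_zero C)) (\<lambda>g. g) \<in> linear_maps Novikov (quot_module C (TorG C) (R_tri (AC_zero C)))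
      (quot_module C (G_free (AC_zero C)) (R_tri (AC_zero C)))"
    by (rule quot_map_linear[OF quotient_TorK quotient_KA additive_map_id]) (use subgroup_zero[OF sub_RA] in auto)
  show "quot_map (G_free (C_zero C)) (R_tri (C_zero C)) (\<lambda>g. g) \<in> linear_maps Novikov (quot_module C (G_free (AC_zero C)) (R_tri (AC_zero C)))
      (quot_module C (G_free (C_zero C)) (R_tri (C_zero C)))"
    by (rule quot_map_linear[OF quotient_KA quotient_K additive_map_id]) (use subgroup_zero[OF sub_R0] RA_R0 acyclics_Ob in auto)
  show "quot_map (G_free (C_inf C)) (R_tri (C_inf C)) (\<lambda>g. g) \<in> linear_maps Novikov (quot_module C (G_free (C_zero C)) (R_tri (C_zero C)))
      (quot_module C (G_free (C_inf C)) (R_tri (C_inf C)))"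
    by (rule quot_map_linear[OF quotient_K quotient_K_inf additive_map_id]) (use subgroup_zero[OF sub_Rac] R_tri_C_inf R0_Rac in auto)
qed

lemma Q_linear:
  assumes r: "r \<ge> 0" shows "Q_map C r \<in> linear_maps Novikov (K C) (KA C)"
  unfolding K_def KA_def K_group_def Q_map_eq
proof (rule quot_map_linear[OF quotient_K quotient_KA additive_map_extend Q_relations[OF r] Q_chains[OF r]])
  fix t x assume x: "x \<in> chains (Ob C)"
  show "frag_extend (\<lambda>X. frag_of (eta_cone C r X)) (shift_ext C t x) - shift_ext C t (frag_extend (\<lambda>X. frag_of (eta_cone C r X)) x)
      \<in> R_tri (AC_zero C)"
    unfolding extend_extend frag_extend_of
    by (rule extend_agree_mod[OF sub_RA eta_cone_shift[OF _ r]]) (use x in auto)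
qed

lemma Q_class:
  assumes r: "r \<ge> 0" and X: "X \<in> Ob C" and Q: "is_cone_eta C r X Q"
  shows "Q_map C r (K_class (C_zero C) X) = K_class (AC_zero C) Q"
proof -
  have "K_class (C_zero C) X = coset (R_tri (C_zero C)) (frag_of X)"
    unfolding K_class_def by (rule r_coset_eq[OF G_free_frag_group])
  moreover have "K_class (AC_zero C) Q = coset (R_tri (AC_zero C)) (frag_of Q)"
    unfolding K_class_def by (rule r_coset_eq[OF G_free_frag_group])
  ultimately show ?thesis
    using Q_coset[OF r, of "frag_of X"] X coset_eqI[OF sub_RA is_cone_eta_rel[OF eta_cone[OF X r] Q r]] by simp
qed

lemma exact_sequence:
  "inj_on (psi_map C) (carrier (TorK C))"
  "psi_map C ` carrier (TorK C) = {x \<in> carrier (KA C). j_map C x = \<zero>\<^bsub>K C\<^esub>}"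
  "j_map C ` carrier (KA C) = {x \<in> carrier (K C). pi_map C x = \<zero>\<^bsub>K_inf C\<^esub>}"
  "pi_map C ` carrier (K C) = carrier (K_inf C)"
proof -
  let ?RA = "R_tri (AC_zero C)" and ?R0 = "R_tri (C_zero C)"
  show "inj_on (psi_map C) (carrier (TorK C))"
    unfolding carrier_TorK inj_on_def using psi_coset by auto
  have j0: "j_map C (coset ?RA g) = \<zero>\<^bsub>K C\<^esub> \<longleftrightarrow> g \<in> ?R0" if "g \<in> chains (acyclics C)" for g
    using j_coset[OF that] by (simp add: zero_K coset_eq_iff[OF sub_R0])
  have "psi_map C ` carrier (TorK C) = coset ?RA ` (chains (acyclics C) \<inter> ?R0)"
    unfolding carrier_TorK image_image by (rule image_cong[OF refl psi_coset])
  also have "\<dots> = {x \<in> carrier (KA C). j_map C x = \<zero>\<^bsub>K C\<^esub>}"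
    unfolding carrier_KA using j0 by auto
  finally show "psi_map C ` carrier (TorK C) = {x \<in> carrier (KA C). j_map C x = \<zero>\<^bsub>K C\<^esub>}" .
  have p0: "pi_map C (coset ?R0 g) = \<zero>\<^bsub>K_inf C\<^esub> \<longleftrightarrow> g \<in> R_acyclic C" if "g \<in> chains (Ob C)" for g
    using pi_coset[OF that] by (simp add: zero_K_inf R_tri_C_inf coset_eq_iff[OF sub_Rac])
  have ac: "chains (acyclics C) \<subseteq> chains (Ob C)" using acyclics_Ob by auto
  have "j_map C ` carrier (KA C) = coset ?R0 ` chains (acyclics C)"
    unfolding carrier_KA image_image by (rule image_cong[OF refl j_coset])
  also have "\<dots> = {x \<in> carrier (K C). pi_map C x = \<zero>\<^bsub>K_inf C\<^esub>}"
  proof (intro subset_antisym subsetI)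
    fix x assume "x \<in> coset ?R0 ` chains (acyclics C)"
    then obtain y where y: "Poly_Mapping.keys y \<subseteq> acyclics C" "x = coset ?R0 y" by auto
    then have "y \<in> chains (Ob C)" using ac by auto
    then show "x \<in> {x \<in> carrier (K C). pi_map C x = \<zero>\<^bsub>K_inf C\<^esub>}"
      using p0 acyclic_Rac[OF y(1)] y(2) by (simp add: carrier_K)
  next
    fix x assume "x \<in> {x \<in> carrier (K C). pi_map C x = \<zero>\<^bsub>K_inf C\<^esub>}"
    then obtain g where g: "g \<in> chains (Ob C)" "x = coset ?R0 g" "g \<in> R_acyclic C"
      unfolding carrier_K using p0 by auto
    then obtain a y where "g = a + y" "a \<in> ?R0" "y \<in> chains (acyclics C)" by (auto simp: R_acyclic_def)
    then have "coset ?R0 g = coset ?R0 y" by (intro coset_eqI[OF sub_R0]) simp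
    then show "x \<in> coset ?R0 ` chains (acyclics C)" using g(2) \<open>y \<in> _\<close> by blast
  qed
  finally show "j_map C ` carrier (KA C) = {x \<in> carrier (K C). pi_map C x = \<zero>\<^bsub>K_inf C\<^esub>}" .
  show "pi_map C ` carrier (K C) = carrier (K_inf C)"
    unfolding carrier_K carrier_K_inf image_image by (rule image_cong[OF refl pi_coset])
qed

subsection \<open>Compatibility with opposites\<close>

lemma quot_module_op: "quot_module (op_tpc C) G R = op_module (quot_module C G R)"
proof -
  have "novikov_act (\<lambda>r. sh C (- r)) p g = novikov_act (sh C) (novikov_bar p) g" for p g
    by (rule novikov_act_bar)
  moreover have "sh (op_tpc C) = (\<lambda>r. sh C (- r))" by (simp add: fun_eq_iff)
  ultimately show ?thesis by (simp add: quot_module_def op_module_def)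
qed

lemma G_free_op:
  "G_free (C_zero (op_tpc C)) = G_free (C_zero C)" "G_free (AC_zero (op_tpc C)) = G_free (AC_zero C)"
  "G_free (C_inf (op_tpc C)) = G_free (C_inf C)" "TorG (op_tpc C) = TorG C"
  by (simp_all add: G_free_def TorG_def AC_zero_def full_tri_sub_def R_tri_zero_op)

lemma R_tri_inf_op: "R_tri (C_inf (op_tpc C)) = R_tri (C_inf C)"
  by (simp add: R_tri_C_inf R_tri_C_inf_op)

lemma K_op: "K (op_tpc C) = op_module (K C)" "KA (op_tpc C) = op_module (KA C)"
  "K_inf (op_tpc C) = op_module (K_inf C)" "TorK (op_tpc C) = op_module (TorK C)"
  unfolding K_def KA_def K_inf_def TorK_def K_group_def quot_module_op G_free_op R_tri_zero_op R_tri_AC_op R_tri_inf_op by rule+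

lemma K_map_op:
  "K_map (op_tpc C) (op_pfun F) = K_map C F" "KA_map (op_tpc C) (op_pfun F) = KA_map C F"
  "K_inf_map (op_tpc C) (op_pfun F) = K_inf_map C F" "TorK_map (op_tpc C) (op_pfun F) = TorK_map C F"
  unfolding K_map_def KA_map_def K_inf_map_def TorK_map_def G_free_op R_tri_zero_op R_tri_AC_op R_tri_inf_op
  by (simp_all add: free_map_def op_pfun_def)

end

subsection \<open>Functoriality\<close>

context exact_functor
begin

lemma K_map_coset: "g \<in> chains (Ob C) \<Longrightarrow> K_map D F (coset (R_tri (C_zero C)) g) = coset (R_tri (C_zero D)) (free_map F g)"
  unfolding K_map_def by (rule quot_map_coset[OF C.quot_K D.quot_K additive_free_map free_map_R0])

lemma KA_map_coset: "g \<in> chains (acyclics C) \<Longrightarrow> KA_map D F (coset (R_tri (AC_zero C)) g) = coset (R_tri (AC_zero D)) (free_map F g)"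
  unfolding KA_map_def by (rule quot_map_coset[OF C.quot_KA D.quot_KA additive_free_map free_map_RA])

lemma free_map_R_inf: "x \<in> R_tri (C_inf C) \<Longrightarrow> free_map F x \<in> R_tri (C_inf D)"
  using free_map_Rac by (simp add: C.R_tri_C_inf D.R_tri_C_inf)

lemma K_inf_map_coset: "g \<in> chains (Ob C) \<Longrightarrow> K_inf_map D F (coset (R_tri (C_inf C)) g) = coset (R_tri (C_inf D)) (free_map F g)"
  unfolding K_inf_map_def by (rule quot_map_coset[OF C.quot_K_inf D.quot_K_inf additive_free_map free_map_R_inf])

lemma free_map_Tor: "c \<in> chains (acyclics C) \<inter> R_tri (C_zero C) \<Longrightarrow> free_map F c \<in> chains (acyclics D) \<inter> R_tri (C_zero D)"
  using free_map_acyclic_chains free_map_R0 by blast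

lemma TorK_map_coset: "g \<in> chains (acyclics C) \<inter> R_tri (C_zero C) \<Longrightarrow>
    TorK_map D F (coset (R_tri (AC_zero C)) g) = coset (R_tri (AC_zero D)) (free_map F g)"
  unfolding TorK_map_def by (rule quot_map_coset[OF C.quot_TorK D.quot_TorK additive_free_map free_map_RA])

end

text \<open>The additional conditions make the induced maps commute with \<open>t^r\<close> and with \<open>Q\<^sub>r\<close>.\<close>

locale tpc_functor_locale = exact_functor k C D F for k :: "('k, 'x) ring_scheme" and C :: "('k, 'o, 'm) tpc" and D :: "('k, 'p, 'n) tpc" and F +
  assumes F: "tpc_functor k C D F"
begin

lemma F_shift: "X \<in> Ob C \<Longrightarrow> fob F (sh C r X) = sh D r (fob F X)"
  using F by (auto simp: tpc_functor_def)

lemma F_eta_map: assumes X: "X \<in> Ob C" and r: "r \<ge> 0"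
  shows "fmor F 0 (sh C r X) X (eta_map C r X) = eta_map D r (fob F X)"
proof -
  have "fmor F (0 - r) (sh C r X) (sh C 0 X) (eta C r 0 X) = eta D r 0 (fob F X)"
    using F X unfolding tpc_functor_def by blast
  moreover have "fmor F 0 (sh C r X) X (inc C (- r) 0 (sh C r X) X (eta C r 0 X))
      = inc D (- r) 0 (fob F (sh C r X)) (fob F X) (fmor F (- r) (sh C r X) X (eta C r 0 X))"
    using pers X C.sh_Ob[OF X] C.eta_to[OF X, of r] r unfolding persistence_functor_def by (metis neg_le_0_iff_le)
  ultimately show ?thesis using X by (simp add: eta_map_def F_shift C.shift_0_ob)
qed

lemma free_map_shift: "x \<in> chains (Ob C) \<Longrightarrow> free_map F (shift_ext C r x) = shift_ext D r (free_map F x)"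
  unfolding free_map_def extend_extend frag_extend_of by (rule frag_extend_eq) (auto simp: F_shift)

lemma maps_linear:
  "K_map D F \<in> linear_maps Novikov (K C) (K D)" "KA_map D F \<in> linear_maps Novikov (KA C) (KA D)"
  "K_inf_map D F \<in> linear_maps Novikov (K_inf C) (K_inf D)" "TorK_map D F \<in> linear_maps Novikov (TorK C) (TorK D)"
  unfolding K_def KA_def K_inf_def TorK_def K_group_def K_map_def KA_map_def K_inf_map_def TorK_map_def
proof -
  have ac: "chains (acyclics C) \<subseteq> chains (Ob C)" using C.acyclics_Ob by auto
  show "quot_map (G_free (C_zero D)) (R_tri (C_zero D)) (free_map F)
      \<in> linear_maps Novikov (quot_module C (G_free (C_zero C)) (R_tri (C_zero C))) (quot_module D (G_free (C_zero D)) (R_tri (C_zero D)))"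
    by (rule quot_map_linear[OF C.quotient_K D.quotient_K additive_free_map free_map_R0 free_map_chains])
      (simp_all add: free_map_shift subgroup_zero[OF D.sub_R0])
  show "quot_map (G_free (AC_zero D)) (R_tri (AC_zero D)) (free_map F)
      \<in> linear_maps Novikov (quot_module C (G_free (AC_zero C)) (R_tri (AC_zero C))) (quot_module D (G_free (AC_zero D)) (R_tri (AC_zero D)))"
    by (rule quot_map_linear[OF C.quotient_KA D.quotient_KA additive_free_map free_map_RA free_map_acyclic_chains])
      (use ac free_map_shift subgroup_zero[OF D.sub_RA] in auto)
  show "quot_map (G_free (C_inf D)) (R_tri (C_inf D)) (free_map F)
      \<in> linear_maps Novikov (quot_module C (G_free (C_inf C)) (R_tri (C_inf C))) (quot_module D (G_free (C_inf D)) (R_tri (C_inf D)))"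
    by (rule quot_map_linear[OF C.quotient_K_inf D.quotient_K_inf additive_free_map free_map_R_inf free_map_chains])
      (simp_all add: free_map_shift subgroup_zero[OF D.sub_R_inf])
  show "quot_map (TorG D) (R_tri (AC_zero D)) (free_map F)
      \<in> linear_maps Novikov (quot_module C (TorG C) (R_tri (AC_zero C))) (quot_module D (TorG D) (R_tri (AC_zero D)))"
    by (rule quot_map_linear[OF C.quotient_TorK D.quotient_TorK additive_free_map free_map_RA])
      (use ac free_map_shift subgroup_zero[OF D.sub_RA] free_map_acyclic_chains free_map_R0 in auto)
qed

lemma Q_natural_mod:
  assumes r: "r \<ge> 0" and x: "x \<in> chains (Ob C)"
  shows "frag_extend (\<lambda>X. frag_of (eta_cone D r X)) (free_map F x) - free_map F (frag_extend (\<lambda>X. frag_of (eta_cone C r X)) x) \<in> R_tri (AC_zero D)"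
  unfolding free_map_def extend_extend frag_extend_of
proof (rule extend_agree_mod[OF D.sub_RA])
  show "frag_of (eta_cone D r (fob F X)) - frag_of (fob F (eta_cone C r X)) \<in> R_tri (AC_zero D)" if X: "X \<in> Ob C" for X
    using D.is_cone_eta_rel[OF D.eta_cone[OF F_Ob[OF X] r] _ r]
      is_cone_eta_functor[OF C.persistence_category_axioms D.persistence_category_axioms pers tri F_shift[OF X] F_eta_map[OF X r] C.eta_cone[OF X r] r]
    by blast
qed (use x in auto)

lemma natural:
  "x \<in> carrier (TorK C) \<Longrightarrow> psi_map D (TorK_map D F x) = KA_map D F (psi_map C x)"
  "x \<in> carrier (KA C) \<Longrightarrow> j_map D (KA_map D F x) = K_map D F (j_map C x)"
  "x \<in> carrier (K C) \<Longrightarrow> pi_map D (K_map D F x) = K_inf_map D F (pi_map C x)"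
  "r \<ge> 0 \<Longrightarrow> x \<in> carrier (K C) \<Longrightarrow> Q_map D r (K_map D F x) = KA_map D F (Q_map C r x)"
proof -
  have ac: "chains (acyclics C) \<subseteq> chains (Ob C)" using C.acyclics_Ob by auto
  show "psi_map D (TorK_map D F x) = KA_map D F (psi_map C x)" if x: "x \<in> carrier (TorK C)"
  proof -
    obtain g where "g \<in> chains (acyclics C) \<inter> R_tri (C_zero C)" "x = coset (R_tri (AC_zero C)) g" using x C.carrier_TorK by auto
    then show ?thesis
      using TorK_map_coset[of g] C.psi_coset[of g] D.psi_coset[of "free_map F g"] KA_map_coset[of g] free_map_acyclic_chains[of g] free_map_R0[of g] by simp
  qed
  show "j_map D (KA_map D F x) = K_map D F (j_map C x)" if x: "x \<in> carrier (KA C)"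
  proof -
    obtain g where "g \<in> chains (acyclics C)" "x = coset (R_tri (AC_zero C)) g" using x C.carrier_KA by auto
    then show ?thesis
      using KA_map_coset[of g] C.j_coset[of g] D.j_coset[of "free_map F g"] K_map_coset[of g] free_map_acyclic_chains[of g] ac by auto
  qed
  show "pi_map D (K_map D F x) = K_inf_map D F (pi_map C x)" if x: "x \<in> carrier (K C)"
  proof -
    obtain g where "g \<in> chains (Ob C)" "x = coset (R_tri (C_zero C)) g" using x C.carrier_K by auto
    then show ?thesis
      using K_map_coset[of g] C.pi_coset[of g] D.pi_coset[of "free_map F g"] K_inf_map_coset[of g] free_map_chains[of g] by simp
  qed
  show "Q_map D r (K_map D F x) = KA_map D F (Q_map C r x)" if r: "r \<ge> 0" and x: "x \<in> carrier (K C)"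
  proof -
    obtain g where "g \<in> chains (Ob C)" "x = coset (R_tri (C_zero C)) g" using x C.carrier_K by auto
    then show ?thesis
      using K_map_coset[of g] C.Q_coset[OF r, of g] D.Q_coset[OF r, of "free_map F g"] KA_map_coset[OF C.Q_chains[OF r, of g]] free_map_chains[of g]
        coset_eqI[OF D.sub_RA Q_natural_mod[OF r, of g]] by simp
  qed
qed

end

lemma tpc_functor_localeI:
  assumes "triangulated_persistence_category k C" "triangulated_persistence_category k D" "tpc_functor k C D F"
  shows "tpc_functor_locale k C D F"
  using assms by (intro tpc_functor_locale.intro exact_functor.intro exact_functor_axioms.intro tpc_functor_locale_axioms.intro)
    (auto simp: tpc_functor_def)

lemma free_map_id: "free_map id_pfun x = x"
  by (simp add: free_map_def id_pfun_def extend_of)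

lemma free_map_comp: "free_map (comp_pfun G F) x = free_map G (free_map F x)"
  by (simp add: free_map_def comp_pfun_def extend_extend)

lemma (in triangulated_persistence_category) maps_id:
  "x \<in> carrier (K C) \<Longrightarrow> K_map C id_pfun x = x" "x \<in> carrier (KA C) \<Longrightarrow> KA_map C id_pfun x = x"
  "x \<in> carrier (K_inf C) \<Longrightarrow> K_inf_map C id_pfun x = x" "x \<in> carrier (TorK C) \<Longrightarrow> TorK_map C id_pfun x = x"
  unfolding K_map_def KA_map_def K_inf_map_def TorK_map_def carrier_K carrier_KA carrier_K_inf carrier_TorK
  by (auto simp: quot_map_coset[OF quot_K quot_K additive_free_map] quot_map_coset[OF quot_KA quot_KA additive_free_map]
      quot_map_coset[OF quot_K_inf quot_K_inf additive_free_map] quot_map_coset[OF quot_TorK quot_TorK additive_free_map] free_map_id)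

lemma maps_comp:
  assumes "triangulated_persistence_category k C" "triangulated_persistence_category k D" "triangulated_persistence_category k E"
    "tpc_functor k C D F" "tpc_functor k D E G"
  shows "x \<in> carrier (K C) \<Longrightarrow> K_map E (comp_pfun G F) x = K_map E G (K_map D F x)"
    "x \<in> carrier (KA C) \<Longrightarrow> KA_map E (comp_pfun G F) x = KA_map E G (KA_map D F x)"
    "x \<in> carrier (K_inf C) \<Longrightarrow> K_inf_map E (comp_pfun G F) x = K_inf_map E G (K_inf_map D F x)"
    "x \<in> carrier (TorK C) \<Longrightarrow> TorK_map E (comp_pfun G F) x = TorK_map E G (TorK_map D F x)"
proof -
  interpret F: tpc_functor_locale k C D F by (rule tpc_functor_localeI) fact+
  interpret G: tpc_functor_locale k D E G by (rule tpc_functor_localeI) fact+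
  have FG: "free_map (comp_pfun G F) = (\<lambda>x. free_map G (free_map F x))"
    by (rule ext) (rule free_map_comp)
  show "x \<in> carrier (K C) \<Longrightarrow> K_map E (comp_pfun G F) x = K_map E G (K_map D F x)"
    unfolding K_map_def FG F.C.carrier_K
    by (rule quot_map_comp[OF F.C.quot_K F.D.quot_K G.D.quot_K additive_free_map additive_free_map F.free_map_R0 F.free_map_chains G.free_map_R0])
  show "x \<in> carrier (KA C) \<Longrightarrow> KA_map E (comp_pfun G F) x = KA_map E G (KA_map D F x)"
    unfolding KA_map_def FG F.C.carrier_KA
    by (rule quot_map_comp[OF F.C.quot_KA F.D.quot_KA G.D.quot_KA additive_free_map additive_free_map F.free_map_RA F.free_map_acyclic_chains G.free_map_RA])
  show "x \<in> carrier (K_inf C) \<Longrightarrow> K_inf_map E (comp_pfun G F) x = K_inf_map E G (K_inf_map D F x)"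
    unfolding K_inf_map_def FG F.C.carrier_K_inf
    by (rule quot_map_comp[OF F.C.quot_K_inf F.D.quot_K_inf G.D.quot_K_inf additive_free_map additive_free_map F.free_map_R_inf F.free_map_chains G.free_map_R_inf])
  show "x \<in> carrier (TorK C) \<Longrightarrow> TorK_map E (comp_pfun G F) x = TorK_map E G (TorK_map D F x)"
    unfolding TorK_map_def FG F.C.carrier_TorK
    by (rule quot_map_comp[OF F.C.quot_TorK F.D.quot_TorK G.D.quot_TorK additive_free_map additive_free_map F.free_map_RA F.free_map_Tor G.free_map_RA])
qed

section \<open>Products\<close>

lemma extend_in:
  assumes "is_subgroup H" "\<And>X. X \<in> S \<Longrightarrow> f X \<in> H" "Poly_Mapping.keys c \<subseteq> S" shows "frag_extend f c \<in> H"
  unfolding frag_extend_def using assms by (intro subgroup_sum subgroup_cmul) auto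

lemma extend_diff_fun: "frag_extend (\<lambda>X. f X - g X) c = frag_extend f c - frag_extend g c"
  by (simp add: frag_extend_def frag_cmul_diff sum_subtractf)

lemma additive_prod_left: "additive_map (\<lambda>x. free_prod M x y)"
  by (simp add: additive_map_def free_prod_def frag_extend_diff)

lemma additive_prod_right: "additive_map (free_prod M x)"
  by (simp add: additive_map_def free_prod_def frag_extend_diff extend_diff_fun)

text \<open>Multiplying by \<open>[Y]\<close> on the right is the map induced by the functor \<open>(-) \<otimes> Y\<close>, so that exactness of this functor gives ideals.\<close>

lemma free_prod_swap: "free_prod M x y = frag_extend (\<lambda>Y. free_map (ten M Y) x) y"
  using subset_UNIV[of "Poly_Mapping.keys x"] unfolding free_prod_def free_map_def
proof (induction x rule: frag_induction)
  case zero
  then show ?case by (simp add: frag_extend_eq_0)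
next
  case (diff a b)
  then show ?case by (simp add: frag_extend_diff extend_diff_fun)
qed simp

lemma free_map_prod: "free_map F (free_prod M x y) = frag_extend (\<lambda>X. frag_extend (\<lambda>Y. frag_of (fob F (tens M X Y))) y) x"
  by (simp add: free_map_def free_prod_def extend_extend)

lemma prod_free_map: "free_prod N (free_map F x) (free_map F y) = frag_extend (\<lambda>X. frag_extend (\<lambda>Y. frag_of (tens N (fob F X) (fob F Y))) y) x"
  by (simp add: free_map_def free_prod_def extend_extend)

lemma double_agree:
  assumes "is_subgroup H" "\<And>X Y. X \<in> S \<Longrightarrow> Y \<in> T \<Longrightarrow> f X Y - g X Y \<in> H" "Poly_Mapping.keys x \<subseteq> S" "Poly_Mapping.keys y \<subseteq> T"
  shows "frag_extend (\<lambda>X. frag_extend (f X) y) x - frag_extend (\<lambda>X. frag_extend (g X) y) x \<in> H"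
  by (intro extend_agree_mod[OF assms(1) _ assms(3)] extend_agree_mod[OF assms(1) _ assms(4)] assms(2))

lemma abelian_group_mult_update: "abelian_group (M\<lparr>monoid.mult := f\<rparr>) \<longleftrightarrow> abelian_group M"
  by (simp add: abelian_group_def abelian_monoid_def abelian_group_axioms_def)

lemma module_mult_update: "module R M \<Longrightarrow> module R (M\<lparr>monoid.mult := f\<rparr>)"
  by (simp add: module_def module_axioms_def abelian_group_mult_update)

lemma linear_maps_mult_update: "linear_maps R (M\<lparr>monoid.mult := f\<rparr>) (N\<lparr>monoid.mult := g\<rparr>) = linear_maps R M N"
  by (simp add: linear_maps_def)

context monoidal_tpc
begin

lemma exact_tensor: "A \<in> Ob C \<Longrightarrow> exact_functor k C C (ten M A)"
  by (intro exact_functor.intro exact_functor_axioms.intro triangulated_persistence_category_axioms ten_functor ten_triangulated)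

lemma tens_Ob: "X \<in> Ob C \<Longrightarrow> Y \<in> Ob C \<Longrightarrow> tens M X Y \<in> Ob C"
  using exact_functor.F_Ob[OF exact_tensor] .

lemma tens_acyclic: "X \<in> acyclics C \<Longrightarrow> Y \<in> Ob C \<Longrightarrow> tens M X Y \<in> acyclics C"
  using exact_functor.F_acyclic[OF exact_tensor] .

lemma iso_shift: "isomorphic_in (C_zero C) X Y \<Longrightarrow> isomorphic_in (C_zero C) (sh C r X) (sh C r Y)"
  using exact_functor.F_iso[OF exact_shift] .

lemma tens_shift_iso: "X \<in> Ob C \<Longrightarrow> A \<in> Ob C \<Longrightarrow> isomorphic_in (C_zero C) (tens M (sh C r X) A) (sh C r (tens M X A))"
  using ten_shift[of X A] unfolding isomorphic_in_def by blast

end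

text \<open>Conditions under which the tensor product descends to a quotient of chains: the relations \<open>R\<close> contain the
  differences of isomorphic objects of a class \<open>T\<close> closed under tensor product and shift, and form an ideal.
  Associativity, symmetry and the compatibility with \<open>\<Sigma>\<close> hold up to isomorphism, hence modulo \<open>R\<close>.\<close>

locale tensor_quotient = monoidal_tpc k C M + Q: novikov_quotient G S R "Ob C" "sh C"
  for k :: "('k, 'x) ring_scheme" and C :: "('k, 'o, 'm) tpc" and M :: "('o, 'm) tensor" and G S R +
  fixes T :: "'o set"
  assumes T_Ob: "X \<in> T \<Longrightarrow> X \<in> Ob C" and T_tens: "X \<in> T \<Longrightarrow> Y \<in> T \<Longrightarrow> tens M X Y \<in> T" and T_shift: "X \<in> T \<Longrightarrow> sh C r X \<in> T"
    and iso_R: "isomorphic_in (C_zero C) X Y \<Longrightarrow> X \<in> T \<Longrightarrow> Y \<in> T \<Longrightarrow> frag_of X - frag_of Y \<in> R"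
    and S_T: "x \<in> S \<Longrightarrow> Poly_Mapping.keys x \<subseteq> T"
    and prod_S: "x \<in> S \<Longrightarrow> y \<in> S \<Longrightarrow> free_prod M x y \<in> S"
    and prod_R: "x \<in> R \<Longrightarrow> y \<in> S \<Longrightarrow> free_prod M x y \<in> R"
begin

lemma prod_commute: "x \<in> S \<Longrightarrow> y \<in> S \<Longrightarrow> free_prod M x y - free_prod M y x \<in> R"
  unfolding free_prod_swap[of M y x] unfolding free_prod_def free_map_def
  by (rule double_agree[OF Q.subR _ S_T S_T]) (auto intro: iso_R ten_sym T_Ob T_tens)

lemma prod_R_right:
  assumes "x \<in> S" "y \<in> R" shows "free_prod M x y \<in> R"
  using subgroup_add[OF Q.subR prod_commute[OF assms(1) subsetD[OF Q.R_le assms(2)]] prod_R[OF assms(2,1)]] by simp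

lemma quot_prod_coset:
  assumes "g \<in> S" "h \<in> S" shows "quot_prod G R M (coset R g) (coset R h) = coset R (free_prod M g h)"
  unfolding quot_prod_def
proof (intro Q.UN_coset assms)
  fix g' h' assume g': "g' \<in> S" "g' - g \<in> R" and h': "h' \<in> S" "h' - h \<in> R"
  have "free_prod M (g' - g) h' + free_prod M g (h' - h) \<in> R"
    using subgroup_add[OF Q.subR prod_R[OF g'(2) h'(1)] prod_R_right[OF assms(1) h'(2)]] .
  then have "free_prod M g' h' - free_prod M g h \<in> R"
    by (simp add: additive_map_diff[OF additive_prod_left] additive_map_diff[OF additive_prod_right])
  then show "R #>\<^bsub>G\<^esub> free_prod M g' h' = coset R (free_prod M g h)"
    by (simp add: r_coset_eq[OF Q.frag_group] coset_eq_iff[OF Q.subR])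
qed

lemma prod_assoc:
  assumes "x \<in> S" "y \<in> S" "z \<in> S"
  shows "free_prod M (free_prod M x y) z - free_prod M x (free_prod M y z) \<in> R"
proof -
  have 1: "free_prod M (free_prod M x y) z = frag_extend (\<lambda>X. frag_extend (\<lambda>Y. frag_extend (\<lambda>Z. frag_of (tens M (tens M X Y) Z)) z) y) x"
    by (simp add: free_prod_def extend_extend)
  have 2: "free_prod M x (free_prod M y z) = frag_extend (\<lambda>X. frag_extend (\<lambda>Y. frag_extend (\<lambda>Z. frag_of (tens M X (tens M Y Z))) z) y) x"
    by (simp add: free_prod_def extend_extend)
  show ?thesis
    unfolding 1 2
    by (rule double_agree[OF Q.subR _ S_T[OF assms(1)] S_T[OF assms(2)]], rule extend_agree_mod[OF Q.subR _ S_T[OF assms(3)]])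
      (auto intro!: iso_R ten_assoc T_Ob T_tens)
qed

lemma prod_smult_left:
  assumes "x \<in> S" "y \<in> S" shows "free_prod M (novikov_act (sh C) p x) y - novikov_act (sh C) p (free_prod M x y) \<in> R"
proof (rule novikov_act_commute[OF Q.subR additive_prod_left])
  fix r
  show "free_prod M (shift_ext C r x) y - shift_ext C r (free_prod M x y) \<in> R"
    unfolding free_prod_def extend_extend frag_extend_of
    by (rule double_agree[OF Q.subR _ S_T[OF assms(1)] S_T[OF assms(2)]]) (auto intro!: iso_R tens_shift_iso T_Ob T_tens T_shift)
qed

lemma prod_smult_right:
  assumes "x \<in> S" "y \<in> S" shows "free_prod M x (novikov_act (sh C) p y) - novikov_act (sh C) p (free_prod M x y) \<in> R"
proof (rule novikov_act_commute[OF Q.subR additive_prod_right])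
  fix r
  have "frag_of (tens M X (sh C r Y)) - frag_of (sh C r (tens M X Y)) \<in> R" if X: "X \<in> T" and Y: "Y \<in> T" for X Y
  proof (rule subgroup_trans[OF Q.subR])
    show "frag_of (tens M X (sh C r Y)) - frag_of (tens M (sh C r Y) X) \<in> R"
      using X Y by (intro iso_R ten_sym T_Ob T_tens T_shift)
    show "frag_of (tens M (sh C r Y) X) - frag_of (sh C r (tens M X Y)) \<in> R"
    proof (rule subgroup_trans[OF Q.subR])
      show "frag_of (tens M (sh C r Y) X) - frag_of (sh C r (tens M Y X)) \<in> R"
        using X Y by (intro iso_R tens_shift_iso T_Ob T_tens T_shift)
      show "frag_of (sh C r (tens M Y X)) - frag_of (sh C r (tens M X Y)) \<in> R"
        using X Y by (intro iso_R iso_shift ten_sym T_Ob T_tens T_shift)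
    qed
  qed
  then show "free_prod M x (shift_ext C r y) - shift_ext C r (free_prod M x y) \<in> R"
    unfolding free_prod_def extend_extend frag_extend_of
    by (intro double_agree[OF Q.subR _ S_T[OF assms(1)] S_T[OF assms(2)]]) auto
qed

lemma nonunital_algebra: "nonunital_algebra Novikov ((quot_module C G R)\<lparr>monoid.mult := quot_prod G R M\<rparr>)"
proof (intro nonunital_algebra.intro nonunital_algebra_axioms.intro)
  let ?Q = "(quot_module C G R)\<lparr>monoid.mult := quot_prod G R M\<rparr>"
  note simps = Q.module_simps(1,2,3)[OF refl]
  note add = additive_map_add[OF additive_prod_left] additive_map_add[OF additive_prod_right]
  show "module Novikov ?Q" by (rule module_mult_update[OF Q.module_quot[OF refl]])
  fix x y assume "x \<in> carrier ?Q" "y \<in> carrier ?Q"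
  then obtain g h where gh: "g \<in> S" "x = coset R g" "h \<in> S" "y = coset R h" by (auto simp: simps)
  show "x \<otimes>\<^bsub>?Q\<^esub> y \<in> carrier ?Q"
    using gh by (auto simp: simps quot_prod_coset prod_S)
  show "(a \<odot>\<^bsub>?Q\<^esub> x) \<otimes>\<^bsub>?Q\<^esub> y = a \<odot>\<^bsub>?Q\<^esub> (x \<otimes>\<^bsub>?Q\<^esub> y)" for a
    using gh prod_smult_left by (simp add: simps quot_prod_coset prod_S Q.act_S coset_eq_iff[OF Q.subR])
  show "x \<otimes>\<^bsub>?Q\<^esub> (a \<odot>\<^bsub>?Q\<^esub> y) = a \<odot>\<^bsub>?Q\<^esub> (x \<otimes>\<^bsub>?Q\<^esub> y)" for a
    using gh prod_smult_right by (simp add: simps quot_prod_coset prod_S Q.act_S coset_eq_iff[OF Q.subR])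
  fix z assume "z \<in> carrier ?Q"
  then obtain l where l: "l \<in> S" "z = coset R l" by (auto simp: simps)
  show "(x \<otimes>\<^bsub>?Q\<^esub> y) \<otimes>\<^bsub>?Q\<^esub> z = x \<otimes>\<^bsub>?Q\<^esub> (y \<otimes>\<^bsub>?Q\<^esub> z)"
    using gh l prod_assoc by (simp add: simps quot_prod_coset prod_S coset_eq_iff[OF Q.subR])
  show "(x \<oplus>\<^bsub>?Q\<^esub> y) \<otimes>\<^bsub>?Q\<^esub> z = (x \<otimes>\<^bsub>?Q\<^esub> z) \<oplus>\<^bsub>?Q\<^esub> (y \<otimes>\<^bsub>?Q\<^esub> z)"
    "x \<otimes>\<^bsub>?Q\<^esub> (y \<oplus>\<^bsub>?Q\<^esub> z) = (x \<otimes>\<^bsub>?Q\<^esub> y) \<oplus>\<^bsub>?Q\<^esub> (x \<otimes>\<^bsub>?Q\<^esub> z)"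
    using gh l by (simp_all add: simps quot_prod_coset subgroup_add[OF Q.subS] add)
qed

end

lemma tensor_quotient_map:
  assumes A: "tensor_quotient k C M G S R T" and B: "tensor_quotient k D N G' S' R' T'"
    and lin: "quot_map G' R' (free_map F) \<in> linear_maps Novikov (quot_module C G R) (quot_module D G' R')"
    and F: "\<And>x. x \<in> R \<Longrightarrow> free_map F x \<in> R'" "\<And>x. x \<in> S \<Longrightarrow> free_map F x \<in> S'" "\<And>X. X \<in> T \<Longrightarrow> fob F X \<in> T'"
    and iso: "\<And>X Y. X \<in> T \<Longrightarrow> Y \<in> T \<Longrightarrow> isomorphic_in (C_zero D) (fob F (tens M X Y)) (tens N (fob F X) (fob F Y))"
  shows "quot_map G' R' (free_map F) \<in> algebra_maps Novikov
    ((quot_module C G R)\<lparr>monoid.mult := quot_prod G R M\<rparr>) ((quot_module D G' R')\<lparr>monoid.mult := quot_prod G' R' N\<rparr>)"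
proof -
  interpret A: tensor_quotient k C M G S R T by fact
  interpret B: tensor_quotient k D N G' S' R' T' by fact
  have map: "quot_map G' R' (free_map F) (coset R g) = coset R' (free_map F g)" if "g \<in> S" for g
    by (rule quot_map_coset[OF A.Q.frag_quotient_axioms B.Q.frag_quotient_axioms additive_free_map F(1) that])
  have "free_map F (free_prod M g h) - free_prod N (free_map F g) (free_map F h) \<in> R'" if "g \<in> S" "h \<in> S" for g h
    unfolding free_map_prod prod_free_map
    by (rule double_agree[OF B.Q.subR _ A.S_T[OF that(1)] A.S_T[OF that(2)]]) (auto intro!: B.iso_R iso F(3) A.T_tens B.T_tens)
  then have "quot_map G' R' (free_map F) (quot_prod G R M x y) =
      quot_prod G' R' N (quot_map G' R' (free_map F) x) (quot_map G' R' (free_map F) y)"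
    if "x \<in> coset R ` S" "y \<in> coset R ` S" for x y
    using that by (elim imageE) (simp add: map A.quot_prod_coset B.quot_prod_coset A.prod_S F(2) coset_eq_iff[OF B.Q.subR])
  then show ?thesis
    using lin A.Q.module_simps(1)[OF refl] unfolding algebra_maps_def linear_maps_mult_update by simp
qed

context monoidal_tpc
begin

lemma prod_in:
  assumes "is_subgroup H" "\<And>Y. Y \<in> Ob C \<Longrightarrow> free_map (ten M Y) x \<in> H" "y \<in> chains (Ob C)"
  shows "free_prod M x y \<in> H"
  unfolding free_prod_swap by (rule extend_in[OF assms(1,2)]) (use assms(3) in auto)

lemma prod_chains: "x \<in> chains (Ob C) \<Longrightarrow> y \<in> chains (Ob C) \<Longrightarrow> free_prod M x y \<in> chains (Ob C)"
  by (rule prod_in[OF subgroup_keys exact_functor.free_map_chains[OF exact_tensor]])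

lemma prod_acyclic_chains: "x \<in> chains (acyclics C) \<Longrightarrow> y \<in> chains (Ob C) \<Longrightarrow> free_prod M x y \<in> chains (acyclics C)"
  by (rule prod_in[OF subgroup_keys exact_functor.free_map_acyclic_chains[OF exact_tensor]])

lemma prod_R0: "x \<in> R_tri (C_zero C) \<Longrightarrow> y \<in> chains (Ob C) \<Longrightarrow> free_prod M x y \<in> R_tri (C_zero C)"
  by (rule prod_in[OF sub_R0 exact_functor.free_map_R0[OF exact_tensor]])

lemma prod_RA: "x \<in> R_tri (AC_zero C) \<Longrightarrow> y \<in> chains (Ob C) \<Longrightarrow> free_prod M x y \<in> R_tri (AC_zero C)"
  by (rule prod_in[OF sub_RA exact_functor.free_map_RA[OF exact_tensor]])

lemma prod_R_inf: "x \<in> R_tri (C_inf C) \<Longrightarrow> y \<in> chains (Ob C) \<Longrightarrow> free_prod M x y \<in> R_tri (C_inf C)"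
  by (rule prod_in[OF sub_R_inf exact_functor.free_map_R_inf[OF exact_tensor]])

lemma acyclic_chains_Ob: "x \<in> chains (acyclics C) \<Longrightarrow> x \<in> chains (Ob C)"
  using acyclics_Ob by auto

lemma tensor_K: "tensor_quotient k C M (G_free (C_zero C)) (chains (Ob C)) (R_tri (C_zero C)) (Ob C)"
  by (intro tensor_quotient.intro tensor_quotient_axioms.intro monoidal_tpc_axioms quotient_K)
    (simp_all only: tens_Ob sh_Ob iso_rel_tri(1) mem_Collect_eq prod_chains[unfolded mem_Collect_eq] prod_R0[unfolded mem_Collect_eq])

lemma tensor_K_inf: "tensor_quotient k C M (G_free (C_inf C)) (chains (Ob C)) (R_tri (C_inf C)) (Ob C)"
  by (intro tensor_quotient.intro tensor_quotient_axioms.intro monoidal_tpc_axioms quotient_K_inf)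
    (simp_all only: tens_Ob sh_Ob R0_Rac[OF iso_rel_tri(1), folded R_tri_C_inf] mem_Collect_eq prod_chains[unfolded mem_Collect_eq] prod_R_inf[unfolded mem_Collect_eq])

lemma tensor_KA: "tensor_quotient k C M (G_free (AC_zero C)) (chains (acyclics C)) (R_tri (AC_zero C)) (acyclics C)"
proof (intro tensor_quotient.intro tensor_quotient_axioms.intro monoidal_tpc_axioms quotient_KA)
  show "free_prod M x y \<in> chains (acyclics C)" if "x \<in> chains (acyclics C)" "y \<in> chains (acyclics C)" for x y
    using prod_acyclic_chains[OF that(1) acyclic_chains_Ob[OF that(2)]] .
  show "free_prod M x y \<in> R_tri (AC_zero C)" if "x \<in> R_tri (AC_zero C)" "y \<in> chains (acyclics C)" for x y
    using prod_RA[OF that(1) acyclic_chains_Ob[OF that(2)]] .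
qed (auto simp: acyclics_Ob tens_acyclic acyclic_shift iso_rel_tri(2))

lemma tensor_TorK: "tensor_quotient k C M (TorG C) (chains (acyclics C) \<inter> R_tri (C_zero C)) (R_tri (AC_zero C)) (acyclics C)"
proof (intro tensor_quotient.intro tensor_quotient_axioms.intro monoidal_tpc_axioms quotient_TorK)
  show "free_prod M x y \<in> chains (acyclics C) \<inter> R_tri (C_zero C)"
    if "x \<in> chains (acyclics C) \<inter> R_tri (C_zero C)" "y \<in> chains (acyclics C) \<inter> R_tri (C_zero C)" for x y
    using prod_acyclic_chains[of x y] prod_R0[of x y] acyclic_chains_Ob[of y] that by blast
  show "free_prod M x y \<in> R_tri (AC_zero C)" if "x \<in> R_tri (AC_zero C)" "y \<in> chains (acyclics C) \<inter> R_tri (C_zero C)" for x y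
    using prod_RA[OF that(1) acyclic_chains_Ob] that(2) by blast
qed (auto simp: acyclics_Ob tens_acyclic acyclic_shift iso_rel_tri(2))

lemma algebras:
  "nonunital_algebra Novikov (K_alg C M)" "nonunital_algebra Novikov (KA_alg C M)"
  "nonunital_algebra Novikov (K_inf_alg C M)" "nonunital_algebra Novikov (TorK_alg C M)"
  unfolding K_alg_def KA_alg_def K_inf_alg_def TorK_alg_def K_def KA_def K_inf_def TorK_def K_group_def
  using tensor_quotient.nonunital_algebra[OF tensor_K] tensor_quotient.nonunital_algebra[OF tensor_KA]
    tensor_quotient.nonunital_algebra[OF tensor_K_inf] tensor_quotient.nonunital_algebra[OF tensor_TorK] .

end

lemma algebra_functor_maps:
  assumes C: "monoidal_tpc k C M" and D: "monoidal_tpc k D N" and F: "monoidal_functor k C M D N F"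
  shows "K_map D F \<in> algebra_maps Novikov (K_alg C M) (K_alg D N)" "KA_map D F \<in> algebra_maps Novikov (KA_alg C M) (KA_alg D N)"
    "K_inf_map D F \<in> algebra_maps Novikov (K_inf_alg C M) (K_inf_alg D N)" "TorK_map D F \<in> algebra_maps Novikov (TorK_alg C M) (TorK_alg D N)"
proof -
  interpret C: monoidal_tpc k C M by fact
  interpret D: monoidal_tpc k D N by fact
  interpret F: tpc_functor_locale k C D F
    using F by (intro tpc_functor_localeI C.triangulated_persistence_category_axioms D.triangulated_persistence_category_axioms)
      (simp add: monoidal_functor_def)
  have iso: "isomorphic_in (C_zero D) (fob F (tens M X Y)) (tens N (fob F X) (fob F Y))" if "X \<in> Ob C" "Y \<in> Ob C" for X Y
    using F that by (auto simp: monoidal_functor_def)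
  note lin = F.maps_linear[unfolded K_def KA_def K_inf_def TorK_def K_group_def K_map_def KA_map_def K_inf_map_def TorK_map_def]
  note defs = K_alg_def KA_alg_def K_inf_alg_def TorK_alg_def K_def KA_def K_inf_def TorK_def K_group_def K_map_def KA_map_def K_inf_map_def TorK_map_def
  show "K_map D F \<in> algebra_maps Novikov (K_alg C M) (K_alg D N)"
    unfolding defs by (rule tensor_quotient_map[OF C.tensor_K D.tensor_K lin(1) F.free_map_R0 F.free_map_chains F.F_Ob iso])
  show "KA_map D F \<in> algebra_maps Novikov (KA_alg C M) (KA_alg D N)"
    unfolding defs by (rule tensor_quotient_map[OF C.tensor_KA D.tensor_KA lin(2) F.free_map_RA F.free_map_acyclic_chains F.F_acyclic
      iso[OF C.acyclics_Ob C.acyclics_Ob]])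
  show "K_inf_map D F \<in> algebra_maps Novikov (K_inf_alg C M) (K_inf_alg D N)"
    unfolding defs by (rule tensor_quotient_map[OF C.tensor_K_inf D.tensor_K_inf lin(3) F.free_map_R_inf F.free_map_chains F.F_Ob iso])
  show "TorK_map D F \<in> algebra_maps Novikov (TorK_alg C M) (TorK_alg D N)"
    unfolding defs
  proof (rule tensor_quotient_map[OF C.tensor_TorK D.tensor_TorK lin(4) F.free_map_RA _ F.F_acyclic iso[OF C.acyclics_Ob C.acyclics_Ob]])
    show "free_map F x \<in> chains (acyclics D) \<inter> R_tri (C_zero D)" if "x \<in> chains (acyclics C) \<inter> R_tri (C_zero C)" for x
      using F.free_map_acyclic_chains[of x] F.free_map_R0[of x] that by blast
  qed
qed

section \<open>The K-theoretic functors of triangulated persistence categories\<close>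

theorem theorem3p6p1:
  fixes k :: "'k ring"
    and C :: "('k, 'o, 'm) tpc" and D :: "('k, 'p, 'n) tpc" and E :: "('k, 'q, 'l) tpc"
  assumes "triangulated_persistence_category k C"
    and "triangulated_persistence_category k D"
    and "triangulated_persistence_category k E"
  shows
    "\<comment> \<open>the four functors: objects\<close>
     module Novikov (K C) \<and> module Novikov (KA C) \<and>
     module Novikov (K_inf C) \<and> module Novikov (TorK C) \<and>
     \<comment> \<open>the four functors: morphisms, identities, composition\<close>
     (\<forall>F. tpc_functor k C D F \<longrightarrow>
        K_map D F \<in> linear_maps Novikov (K C) (K D) \<and>
        KA_map D F \<in> linear_maps Novikov (KA C) (KA D) \<and>
        K_inf_map D F \<in> linear_maps Novikov (K_inf C) (K_inf D) \<and>
        TorK_map D F \<in> linear_maps Novikov (TorK C) (TorK D)) \<and>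
     (\<forall>x\<in>carrier (K C). K_map C id_pfun x = x) \<and>
     (\<forall>x\<in>carrier (KA C). KA_map C id_pfun x = x) \<and>
     (\<forall>x\<in>carrier (K_inf C). K_inf_map C id_pfun x = x) \<and>
     (\<forall>x\<in>carrier (TorK C). TorK_map C id_pfun x = x) \<and>
     (\<forall>F G. tpc_functor k C D F \<and> tpc_functor k D E G \<longrightarrow>
        (\<forall>x\<in>carrier (K C). K_map E (comp_pfun G F) x = K_map E G (K_map D F x)) \<and>
        (\<forall>x\<in>carrier (KA C). KA_map E (comp_pfun G F) x = KA_map E G (KA_map D F x)) \<and>
        (\<forall>x\<in>carrier (K_inf C). K_inf_map E (comp_pfun G F) x = K_inf_map E G (K_inf_map D F x)) \<and>
        (\<forall>x\<in>carrier (TorK C). TorK_map E (comp_pfun G F) x = TorK_map E G (TorK_map D F x))) \<and>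
     \<comment> \<open>the natural transformations; the class of a cone of \<open>\<eta>\<^sub>r\<^sup>X\<close> does not depend on its choice\<close>
     psi_map C \<in> linear_maps Novikov (TorK C) (KA C) \<and>
     j_map C \<in> linear_maps Novikov (KA C) (K C) \<and>
     pi_map C \<in> linear_maps Novikov (K C) (K_inf C) \<and>
     (\<forall>r\<ge>0. Q_map C r \<in> linear_maps Novikov (K C) (KA C) \<and>
        (\<forall>X\<in>Ob C. \<forall>Q. is_cone_eta C r X Q \<longrightarrow>
           Q_map C r (K_class (C_zero C) X) = K_class (AC_zero C) Q)) \<and>
     (\<forall>F. tpc_functor k C D F \<longrightarrow>
        (\<forall>x\<in>carrier (TorK C). psi_map D (TorK_map D F x) = KA_map D F (psi_map C x)) \<and>
        (\<forall>x\<in>carrier (KA C). j_map D (KA_map D F x) = K_map D F (j_map C x)) \<and>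
        (\<forall>x\<in>carrier (K C). pi_map D (K_map D F x) = K_inf_map D F (pi_map C x)) \<and>
        (\<forall>r\<ge>0. \<forall>x\<in>carrier (K C). Q_map D r (K_map D F x) = KA_map D F (Q_map C r x))) \<and>
     \<comment> \<open>the exact sequence\<close>
     inj_on (psi_map C) (carrier (TorK C)) \<and>
     psi_map C ` carrier (TorK C) = {x \<in> carrier (KA C). j_map C x = \<zero>\<^bsub>K C\<^esub>} \<and>
     j_map C ` carrier (KA C) = {x \<in> carrier (K C). pi_map C x = \<zero>\<^bsub>K_inf C\<^esub>} \<and>
     pi_map C ` carrier (K C) = carrier (K_inf C) \<and>
     \<comment> \<open>compatibility with the opposites; on underlying groups a linear map and its opposite agree\<close>
     K (op_tpc C) = op_module (K C) \<and> KA (op_tpc C) = op_module (KA C) \<and>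
     K_inf (op_tpc C) = op_module (K_inf C) \<and> TorK (op_tpc C) = op_module (TorK C) \<and>
     (\<forall>F. tpc_functor k C D F \<longrightarrow>
        (\<forall>x\<in>carrier (K C). K_map (op_tpc D) (op_pfun F) x = K_map D F x) \<and>
        (\<forall>x\<in>carrier (KA C). KA_map (op_tpc D) (op_pfun F) x = KA_map D F x) \<and>
        (\<forall>x\<in>carrier (K_inf C). K_inf_map (op_tpc D) (op_pfun F) x = K_inf_map D F x) \<and>
        (\<forall>x\<in>carrier (TorK C). TorK_map (op_tpc D) (op_pfun F) x = TorK_map D F x)) \<and>
     \<comment> \<open>monoidal TPCs and functors\<close>
     (\<forall>M. monoidal_tpc k C M \<longrightarrow>
        nonunital_algebra Novikov (K_alg C M) \<and> nonunital_algebra Novikov (KA_alg C M) \<and>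
        nonunital_algebra Novikov (K_inf_alg C M) \<and> nonunital_algebra Novikov (TorK_alg C M)) \<and>
     (\<forall>M N F. monoidal_tpc k C M \<and> monoidal_tpc k D N \<and> monoidal_functor k C M D N F \<longrightarrow>
        K_map D F \<in> algebra_maps Novikov (K_alg C M) (K_alg D N) \<and>
        KA_map D F \<in> algebra_maps Novikov (KA_alg C M) (KA_alg D N) \<and>
        K_inf_map D F \<in> algebra_maps Novikov (K_inf_alg C M) (K_inf_alg D N) \<and>
        TorK_map D F \<in> algebra_maps Novikov (TorK_alg C M) (TorK_alg D N))"
proof -
  interpret C: triangulated_persistence_category k C by fact
  interpret D: triangulated_persistence_category k D by fact
  note loc = tpc_functor_localeI[OF assms(1,2)]
  note linear = tpc_functor_locale.maps_linear[OF loc] and natural = tpc_functor_locale.natural[OF loc]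
  note comp = maps_comp[OF assms]
  note op = fun_cong[OF D.K_map_op(1)] fun_cong[OF D.K_map_op(2)] fun_cong[OF D.K_map_op(3)] fun_cong[OF D.K_map_op(4)]
  show ?thesis
    by (intro conjI allI impI ballI; (elim conjE)?;
      (rule C.modules linear C.maps_id comp C.comparison_linear C.Q_linear C.Q_class natural C.exact_sequence
        C.K_op op monoidal_tpc.algebras algebra_functor_maps; assumption))
qed

end
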